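(* Let $\mathbb K$ be a (Hausdorff, commutative, unital) topological ring whose unit group $\mathbb K^\times$ is dense, $V,V'$ (Hausdorff) topological $\mathbb K$-modules, and $U\subset V$, $U'\subset V'$ non-empty open subsets. Then, for every $n\in\mathbb N\cup\{\infty\}$, taking base maps induces bijections between: (i) $C^n$-maps $f:U\to U'$; (ii) continuous $C^n$-laws between $U$ and $U'$; (iii) continuous homogeneous $C^n$-laws between $U$ and $U'$. That is, every $C^n$-map $f$ is the base map of exactly one continuous $C^n$-law and of exactly one continuous homogeneous $C^n$-law, and the base map of every continuous [homogeneous] $C^n$-law is a $C^n$-map.
   Context: **$C^n$-maps.** For $X$ open in a topological $\mathbb K$-module $E$ let $X^{[1]}=X^{\{1\}}=\{(x,v,t)\in E^2\times\mathbb K:x\in X,\ x+tv\in X\}$. A map $f:U\to W$ into a topological $\mathbb K$-module is $C^0$ if continuous; it is $C^1$ if it is continuous and there is a continuous map $f^{[1]}:U^{[1]}\to W$ with $f^{[1]}(x,v,t)=\frac{f(x+tv)-f(x)}{t}$ for all $(x,v,t)\in U^{[1]}$ with $t\in\mathbb K^\times$. It is $C^n$ ($n\ge2$) if it is $C^{n-1}$ and $f^{[n-1]}$ is $C^1$ on $U^{[n-1]}=(U^{[n-2]})^{[1]}$, and then $f^{[n]}=(f^{[n-1]})^{[1]}$. $C^\infty$ means $C^n$ for all $n$. A map to $U'$ is $C^n$ if it is so as a map to $V'$. **$m$-fold categories.** A small category has source $\pi_0$, target $\pi_1$, unit section, product $g'*g$ defined iff $\pi_1(g)=\pi_0(g')$.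 A small $m$-fold category indexed by a finite set $N$ ($|N|=m$) is a family of sets $(C_\alpha)_{\alpha\subset N}$ with a small category (morphisms $C_\alpha$, objects $C_\beta$) for each edge $(\beta,\alpha=\beta\cup\{i\})$, $i\notin\beta$, such that on each face the four edge categories form a double category. It is an $m$-fold groupoid if all edge categories are groupoids. Morphisms are families of maps of vertex sets that are functors on each edge category. **First order.** For a subset $X$ of a module $E$: $\mathsf G^{\{k\}}X$ is the groupoid with objects $X\times\mathbb K$, morphisms $X^{\{k\}}=X^{\{1\}}$, $\pi_0(x,v,t)=(x,t)$, $\pi_1(x,v,t)=(x+tv,t)$, unit $(x,0,t)$, $(x',v',t)*(x,v,t)=(x,v+v',t)$. $\mathsf G^{\overline{\{k\}}}X$ is the double category indexed by $\{k,k'\}$ with $C_\emptyset=X\times\mathbb K$, $C_{\{k\}}=X^{\{k\}}$, $C_{\{k'\}}=X\times\mathbb K^2$, $C_{\{k,k'\}}=\{(x,v,s,t)\in E^2\times\mathbb K^2:x\in X,\ x+stv\in X\}$; direction $k$: on the edge $(\emptyset,\{k\})$, $\pi_0(x,v,t)=(x,t)$, $\pi_1(x,v,t)=(x+tv,t)$, unit $(x,0,t)$, $(x',v',t)*(x,v,t)=(x,v+v',t)$, and on the edge $(\{k'\},\{k,k'\})$, $\pi_0(x,v,s,t)=(x,s,t)$, $\pi_1(x,v,s,t)=(x+stv,s,t)$, unit $(x,0,s,t)$, $(x',v',s,t)*(x,v,s,t)=(x,v+v',s,t)$; direction $k'$: source $\partial_0(x,s,t)=(x,st)$, target $\partial_1(x,s,t)=(x,t)$,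 unit $(x,1,t)$, $(x,s',t')\bullet(x,s,t)=(x,ss',t')$, and $\partial_0(x,v,s,t)=(x,v,st)$, $\partial_1(x,v,s,t)=(x,sv,t)$, unit $(x,v,1,t)$, $(x,v',s',t')\bullet(x,v,s,t)=(x,v,ss',t')$. **Recursion.** For a polynomial map $h$ (all structure maps of the $n$-fold and $2n$-fold categories defined in this recursion are polynomial), $h^{[1]}(x,v,t)$ is obtained by writing $h(x+Tv)=h(x)+T\,F$ with $T$ an indeterminate and putting $T=t$ in $F$; $h^{\{1\}}(x,v,t)=(h(x),h^{[1]}(x,v,t),t)$, $h^{\overline{\{1\}}}(x,v,s,t)=(h(x),h^{[1]}(x,v,st),s,t)$. $\mathsf G^{\mathsf 0}U=\mathsf G^{\overline{\mathsf 0}}U=U$. $\mathsf G^{\mathsf n}U$ (indexed by $\{1,\dots,n\}$): if $X_\alpha$ are the vertex sets of $\mathsf G^{\mathsf{n-1}}U$, the vertex sets at $\alpha,\alpha\cup\{n\}$ are $X_\alpha\times\mathbb K$, $X_\alpha^{\{n\}}$, with $\mathsf G^{\{n\}}X_\alpha$ as structure in direction $n$; in old directions structure maps $h$ are replaced by $h\times\mathrm{id}_{\mathbb K}$, resp. $h^{\{1\}}$ (products restricted to pairs composable for the derived projections). $\mathsf G^{\overline{\mathsf n}}U$ (indexed by $\{1,1',\dots,n,n'\}$): if $X_\alpha$ are the vertex sets of $\mathsf G^{\overline{\mathsf{n-1}}}U$, at $\alpha,\alpha\cup\{n\},\alpha\cup\{n'\},\alpha\cup\{n,n'\}$ take the four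 vertex sets of $\mathsf G^{\overline{\{n\}}}X_\alpha$, with its structure in directions $n,n'$; in old directions replace $h$ by $h\times\mathrm{id}$, $h^{\{1\}}$, $h\times\mathrm{id}$, $h^{\overline{\{1\}}}$. Vertex sets carry the subspace topology. **Laws.** A $C^n$-law between $U$ and $U'$ is a family of morphisms of $k$-fold groupoids $\mathbf f^{\mathsf k}:\mathsf G^{\mathsf k}U\to\mathsf G^{\mathsf k}U'$, $k=0,\dots,n$ (all $k\ge 0$ if $n=\infty$), such that for $k\ge1$ the vertex map of $\mathbf f^{\mathsf k}$ at each $\alpha\not\ni k$ is the vertex map of $\mathbf f^{\mathsf{k-1}}$ at $\alpha$ times $\mathrm{id}_{\mathbb K}$. A homogeneous $C^n$-law is a family of morphisms of $2k$-fold categories $\mathbf f^{\overline{\mathsf k}}:\mathsf G^{\overline{\mathsf k}}U\to\mathsf G^{\overline{\mathsf k}}U'$ such that for $k\ge1$ the vertex map of $\mathbf f^{\overline{\mathsf k}}$ at each $\alpha$ containing neither $k$ nor $k'$ is that of $\mathbf f^{\overline{\mathsf{k-1}}}$ times $\mathrm{id}_{\mathbb K}$, and the scalar variables $s,t$ added at step $k$ are preserved. The base map is the map $U\to U'$ for $k=0$. A law is continuous if all its vertex maps are continuous. *)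

theory Defs
  imports "HOL-Analysis.Analysis" "HOL-Library.Extended_Nat" "HOL-Library.FuncSet"
begin

section \<open>Topological modules and their iterated products\<close>

locale topological_module = module scale
  for scale :: "'k::{comm_ring_1, topological_ab_group_add, topological_semigroup_mult} \<Rightarrow>
                'v::topological_ab_group_add \<Rightarrow> 'v" +
  assumes continuous_scale: "continuous_on UNIV (\<lambda>(t, x). scale t x)"

text \<open>
  All modules occurring in the iteration are finite products with factors \<open>V\<close> and \<open>\<bbbK>\<close>, bracketed in
  some way. Their disjoint union is a single type of trees, and each such module \<open>E\<close> is the set of
  all trees of a fixed shape. Tuples are bracketed to the right: \<open>(x, v, t)\<close> is
  \<open>x \<bowtie> v \<bowtie> Scal t\<close>.
\<close>

datatype ('v, 'k) pt = Vec (the_vec: 'v) | Scal (the_scal: 'k)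
  | Join (pfst: "('v, 'k) pt") (psnd: "('v, 'k) pt") (infixr "\<bowtie>" 65)

type_synonym shape = "(unit, unit) pt"

definition shape :: "('v, 'k) pt \<Rightarrow> shape" where
  "shape = map_pt (\<lambda>_. ()) (\<lambda>_. ())"

fun padd :: "('v::plus, 'k::plus) pt \<Rightarrow> ('v, 'k) pt \<Rightarrow> ('v, 'k) pt" where
  "padd (Vec a) (Vec b) = Vec (a + b)"
| "padd (Scal a) (Scal b) = Scal (a + b)"
| "padd (x \<bowtie> y) (x' \<bowtie> y') = padd x x' \<bowtie> padd y y'"
| "padd _ _ = undefined"

primrec pzero :: "('v::zero, 'k::zero) pt \<Rightarrow> ('v, 'k) pt" where
  "pzero (Vec a) = Vec 0"
| "pzero (Scal a) = Scal 0"
| "pzero (x \<bowtie> y) = pzero x \<bowtie> pzero y"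

primrec pscale :: "('k::times \<Rightarrow> 'v \<Rightarrow> 'v) \<Rightarrow> 'k \<Rightarrow> ('v, 'k) pt \<Rightarrow> ('v, 'k) pt" where
  "pscale sc t (Vec a) = Vec (sc t a)"
| "pscale sc t (Scal a) = Scal (t * a)"
| "pscale sc t (x \<bowtie> y) = pscale sc t x \<bowtie> pscale sc t y"

text \<open>
  The topology generated by the boxes. On the trees of a fixed shape it is the product topology, and
  these sets are open and closed. Hence a set of trees of one shape is open iff it is
  open in the corresponding module.
\<close>

inductive pt_box :: "('v::topological_space, 'k::topological_space) pt set \<Rightarrow> bool" where
  "open A \<Longrightarrow> pt_box (Vec ` A)"
| "open B \<Longrightarrow> pt_box (Scal ` B)"
| "pt_box S \<Longrightarrow> pt_box T \<Longrightarrow> pt_box {x \<bowtie> y | x y. x \<in> S \<and> y \<in> T}"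

instantiation pt :: (topological_space, topological_space) topological_space
begin

definition open_pt :: "('a, 'b) pt set \<Rightarrow> bool" where
  "open_pt = generate_topology (Collect pt_box)"

instance
  by intro_classes (auto simp: open_pt_def intro: generate_topology.intros)

end


section \<open>Maps of class \<open>C\<^sup>n\<close>\<close>

definition ext1 :: "('k::{plus, times} \<Rightarrow> 'v::plus \<Rightarrow> 'v) \<Rightarrow> ('v, 'k) pt set \<Rightarrow> ('v, 'k) pt set" where
  "ext1 sc X = {x \<bowtie> v \<bowtie> Scal t | x v t. x \<in> X \<and> shape v = shape x \<and> padd x (pscale sc t v) \<in> X}"

text \<open>In \<open>is_slope\<close>, \<open>r\<close> is the inverse of the unit \<open>t\<close>; thus \<open>g\<close> is a version of \<open>f\<^sup>[\<^sup>1\<^sup>]\<close>.\<close>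

definition is_slope :: "('k::{comm_ring_1, topological_space} \<Rightarrow> 'v::{plus, topological_space} \<Rightarrow> 'v) \<Rightarrow>
    ('k \<Rightarrow> 'w::{minus, topological_space} \<Rightarrow> 'w) \<Rightarrow> ('v, 'k) pt set \<Rightarrow>
    (('v, 'k) pt \<Rightarrow> 'w) \<Rightarrow> (('v, 'k) pt \<Rightarrow> 'w) \<Rightarrow> bool" where
  "is_slope scV scW X f g \<longleftrightarrow> continuous_on (ext1 scV X) g \<and>
     (\<forall>x v t r. x \<bowtie> v \<bowtie> Scal t \<in> ext1 scV X \<longrightarrow> t * r = 1 \<longrightarrow>
        g (x \<bowtie> v \<bowtie> Scal t) = scW r (f (padd x (pscale scV t v)) - f x))"

definition C1 where
  "C1 scV scW X f \<longleftrightarrow> continuous_on X f \<and> (\<exists>g. is_slope scV scW X f g)"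

text \<open>
  \<open>f\<^sup>[\<^sup>n\<^sup>]\<close> with its domain \<open>U\<^sup>[\<^sup>n\<^sup>]\<close>. If units are dense, continuous slopes are unique on \<open>ext1 scV X\<close> for
  open \<open>X\<close>, so the choice is immaterial there.
\<close>

primrec slope_dom :: "('k::{plus, times} \<Rightarrow> 'v::plus \<Rightarrow> 'v) \<Rightarrow> 'v set \<Rightarrow> nat \<Rightarrow> ('v, 'k) pt set" where
  "slope_dom scV U 0 = Vec ` U"
| "slope_dom scV U (Suc n) = ext1 scV (slope_dom scV U n)"

primrec slope where
  "slope scV scW U f 0 = f \<circ> the_vec"
| "slope scV scW U f (Suc n) =
     (SOME g. is_slope scV scW (slope_dom scV U n) (slope scV scW U f n) g)"

primrec Cn where
  "Cn scV scW U f 0 \<longleftrightarrow> continuous_on U f"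
| "Cn scV scW U f (Suc n) \<longleftrightarrow>
     Cn scV scW U f n \<and> C1 scV scW (slope_dom scV U n) (slope scV scW U f n)"

definition C_maps where
  "C_maps scV scW n U U' = {f \<in> U \<rightarrow>\<^sub>E U'. \<forall>k. enat k \<le> n \<longrightarrow> Cn scV scW U f k}"


section \<open>Polynomial maps and their difference quotients\<close>

text \<open>Formal polynomial maps. \<open>PZero\<close> sends \<open>x\<close> to the zero of the module in which \<open>x\<close> lies.\<close>

datatype pmap = PId | PFst | PSnd | PZero | POne
  | PJoin pmap pmap (infixr "\<bowtie>\<^sub>p" 65)
  | PAdd pmap pmap (infixl "+\<^sub>p" 66)
  | PScale pmap pmap (infixr "*\<^sub>p" 70)
  | PComp pmap pmap (infixl "\<odot>\<^sub>p" 75)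

primrec ev :: "('k::comm_ring_1 \<Rightarrow> 'v::ab_group_add \<Rightarrow> 'v) \<Rightarrow> pmap \<Rightarrow> ('v, 'k) pt \<Rightarrow> ('v, 'k) pt" where
  "ev sc PId x = x"
| "ev sc PFst x = pfst x"
| "ev sc PSnd x = psnd x"
| "ev sc PZero x = pzero x"
| "ev sc POne x = Scal 1"
| "ev sc (p \<bowtie>\<^sub>p q) x = ev sc p x \<bowtie> ev sc q x"
| "ev sc (p +\<^sub>p q) x = padd (ev sc p x) (ev sc q x)"
| "ev sc (p *\<^sub>p q) x = pscale sc (the_scal (ev sc p x)) (ev sc q x)"
| "ev sc (p \<odot>\<^sub>p q) x = ev sc p (ev sc q x)"

text \<open>Coordinates: \<open>pr1, pr2, pr3\<close> are the first three entries of a tuple (not its last entry),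
  and \<open>rest2\<close>, \<open>rest3\<close> are what remains after two and three entries.\<close>

abbreviation "pr1 \<equiv> PFst"
abbreviation "pr2 \<equiv> PFst \<odot>\<^sub>p PSnd"
abbreviation "pr3 \<equiv> PFst \<odot>\<^sub>p (PSnd \<odot>\<^sub>p PSnd)"
abbreviation "rest2 \<equiv> PSnd \<odot>\<^sub>p PSnd"
abbreviation "rest3 \<equiv> PSnd \<odot>\<^sub>p (PSnd \<odot>\<^sub>p PSnd)"

text \<open>
  \<open>dq h\<close> is \<open>h\<^sup>[\<^sup>1\<^sup>]\<close>, as a polynomial map in \<open>(x, v, t)\<close>. By \<open>ev_dq\<close> below, the identity
  \<open>h (x + t v) = h x + t * h\<^sup>[\<^sup>1\<^sup>] (x, v, t)\<close> holds over every commutative ring \<open>\<bbbK>\<close> and every module \<open>V\<close>.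
  Read over \<open>\<bbbK>[T]\<close> and \<open>V[T]\<close> at \<open>t = T\<close> it says that \<open>h\<^sup>[\<^sup>1\<^sup>] (x, v, T)\<close> is the unique \<open>F\<close>
  with \<open>h (x + T v) = h x + T F\<close>.
\<close>

primrec dq :: "pmap \<Rightarrow> pmap" where
  "dq PId = pr2"
| "dq PFst = PFst \<odot>\<^sub>p pr2"
| "dq PSnd = PSnd \<odot>\<^sub>p pr2"
| "dq PZero = PZero \<odot>\<^sub>p pr1"
| "dq POne = PZero \<odot>\<^sub>p rest2"
| "dq (p \<bowtie>\<^sub>p q) = dq p \<bowtie>\<^sub>p dq q"
| "dq (p +\<^sub>p q) = dq p +\<^sub>p dq q"
| "dq (p *\<^sub>p q) = dq p *\<^sub>p (q \<odot>\<^sub>p pr1) +\<^sub>p (p \<odot>\<^sub>p (pr1 +\<^sub>p rest2 *\<^sub>p pr2)) *\<^sub>p dq q"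
| "dq (p \<odot>\<^sub>p q) = dq p \<odot>\<^sub>p (q \<odot>\<^sub>p pr1 \<bowtie>\<^sub>p dq q \<bowtie>\<^sub>p rest2)"

inductive typed :: "pmap \<Rightarrow> shape \<Rightarrow> shape \<Rightarrow> bool" where
  "typed PId a a"
| "typed PFst (a \<bowtie> b) a"
| "typed PSnd (a \<bowtie> b) b"
| "typed PZero a a"
| "typed POne a (Scal ())"
| "typed p a b \<Longrightarrow> typed q a c \<Longrightarrow> typed (p \<bowtie>\<^sub>p q) a (b \<bowtie> c)"
| "typed p a b \<Longrightarrow> typed q a b \<Longrightarrow> typed (p +\<^sub>p q) a b"
| "typed p a (Scal ()) \<Longrightarrow> typed q a b \<Longrightarrow> typed (p *\<^sub>p q) a b"
| "typed q a b \<Longrightarrow> typed p b c \<Longrightarrow> typed (p \<odot>\<^sub>p q) a c"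

lemma shape_simps [simp]:
  "shape (Vec a) = Vec ()" "shape (Scal k) = Scal ()" "shape (x \<bowtie> y) = shape x \<bowtie> shape y"
  by (simp_all add: shape_def)

lemma shape_eq_iff [simp]:
  "shape x = Vec () \<longleftrightarrow> (\<exists>a. x = Vec a)"
  "shape x = Scal () \<longleftrightarrow> (\<exists>k. x = Scal k)"
  "shape x = a \<bowtie> b \<longleftrightarrow> (\<exists>y z. x = y \<bowtie> z \<and> shape y = a \<and> shape z = b)"
  by (cases x; auto)+

lemma shape_padd [simp]: "shape x = shape y \<Longrightarrow> shape (padd x y) = shape y"
  by (induction x y rule: padd.induct) auto

lemma shape_pzero [simp]: "shape (pzero x) = shape x"
  by (induction x) auto

lemma shape_pscale [simp]: "shape (pscale sc t x) = shape x"
  by (induction x) auto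

lemma pzero_padd: "shape x = shape y \<Longrightarrow> pzero (padd x y) = pzero x"
  by (induction x y rule: padd.induct) auto

lemma padd_pscale_pzero: "module sc \<Longrightarrow> padd (pzero x) (pscale sc t (pzero x)) = pzero x"
  by (induction x) (auto simp: module.scale_zero_right)

lemma padd_pscale_padd:
  assumes "module sc"
  shows "shape x = c \<Longrightarrow> shape y = c \<Longrightarrow> shape u = c \<Longrightarrow> shape v = c \<Longrightarrow>
    padd (padd x (pscale sc t u)) (padd y (pscale sc t v)) =
    padd (padd x y) (pscale sc t (padd u v))"
proof (induction c arbitrary: x y u v)
  case (Vec a)
  then show ?case using assms by (auto simp: module.scale_right_distrib)
next
  case (Scal a)
  then show ?case by (auto simp: algebra_simps)
next
  case (Join pr1 pr2)
  then show ?case by auto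
qed

lemma pscale_product:
  assumes "module sc"
  shows "shape x = c \<Longrightarrow> shape u = c \<Longrightarrow>
    pscale sc (k + t * l) (padd x (pscale sc t u)) =
    padd (pscale sc k x) (pscale sc t (padd (pscale sc l x) (pscale sc (k + t * l) u)))"
proof (induction c arbitrary: x u)
  case (Vec a)
  then show ?case using assms
    by (auto simp: module.scale_right_distrib module.scale_left_distrib module.scale_scale algebra_simps)
next
  case (Scal a)
  then show ?case by (auto simp: algebra_simps)
next
  case (Join pr1 pr2)
  then show ?case by auto
qed

theorem ev_dq:
  assumes "module sc"
  shows "typed h a b \<Longrightarrow> shape x = a \<Longrightarrow> shape v = a \<Longrightarrow>
    shape (ev sc h x) = b \<and> shape (ev sc (dq h) (x \<bowtie> v \<bowtie> Scal t)) = b \<and>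
    ev sc h (padd x (pscale sc t v)) =
      padd (ev sc h x) (pscale sc t (ev sc (dq h) (x \<bowtie> v \<bowtie> Scal t)))"
proof (induction h a b arbitrary: x v rule: typed.induct)
  case (8 p a q b)
  obtain k l where kl: "ev sc p x = Scal k" "ev sc (dq p) (x \<bowtie> v \<bowtie> Scal t) = Scal l"
    using 8(3)[OF 8(5,6)] by auto
  have pt: "ev sc p (padd x (pscale sc t v)) = Scal (k + t * l)"
    using 8(3)[OF 8(5,6)] kl by auto
  show ?case
    using 8(4)[OF 8(5,6)] kl pt pscale_product[OF assms, of "ev sc q x" b] by auto
next
  case (7 p a b q)
  show ?case
    using 7(3)[OF 7(5,6)] 7(4)[OF 7(5,6)]
    by (auto simp: padd_pscale_padd[OF assms, where c = b])
next
  case (5 a)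
  then show ?case by auto
next
  case (9 q a b p c)
  show ?case using 9(3)[OF 9(5,6)] 9(4)[of "ev sc q x" "ev sc (dq q) (x \<bowtie> v \<bowtie> Scal t)"] by auto
qed (auto simp: padd_pscale_pzero[OF assms] pzero_padd)


section \<open>Small \<open>m\<close>-fold categories\<close>

text \<open>
  The data of a small \<open>m\<close>-fold category with vertex sets \<open>vertex C \<alpha>\<close>, \<open>\<alpha> \<subseteq> N\<close>. The edge category with
  objects \<open>vertex C \<beta>\<close> and morphisms \<open>vertex C (insert i \<beta>)\<close> has structure maps
  \<open>source C \<beta> i\<close>, \<open>target C \<beta> i\<close>, \<open>unit C \<beta> i\<close>, and \<open>mult C \<beta> i g' g\<close> is \<open>g' * g\<close>, which is meaningful if
  \<open>target C \<beta> i g = source C \<beta> i g'\<close>.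
\<close>

record ('i, 'a) cube =
  vertex :: "'i set \<Rightarrow> 'a set"
  source :: "'i set \<Rightarrow> 'i \<Rightarrow> 'a \<Rightarrow> 'a"
  target :: "'i set \<Rightarrow> 'i \<Rightarrow> 'a \<Rightarrow> 'a"
  unit :: "'i set \<Rightarrow> 'i \<Rightarrow> 'a \<Rightarrow> 'a"
  mult :: "'i set \<Rightarrow> 'i \<Rightarrow> 'a \<Rightarrow> 'a \<Rightarrow> 'a"

definition edge_functor :: "('i, 'a) cube \<Rightarrow> ('i, 'b) cube \<Rightarrow> ('i set \<Rightarrow> 'a \<Rightarrow> 'b) \<Rightarrow> 'i set \<Rightarrow> 'i \<Rightarrow> bool" where
  "edge_functor C D F \<beta> i \<longleftrightarrow>
     (\<forall>g \<in> vertex C (insert i \<beta>).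
        source D \<beta> i (F (insert i \<beta>) g) = F \<beta> (source C \<beta> i g) \<and>
        target D \<beta> i (F (insert i \<beta>) g) = F \<beta> (target C \<beta> i g)) \<and>
     (\<forall>x \<in> vertex C \<beta>. F (insert i \<beta>) (unit C \<beta> i x) = unit D \<beta> i (F \<beta> x)) \<and>
     (\<forall>g \<in> vertex C (insert i \<beta>). \<forall>g' \<in> vertex C (insert i \<beta>).
        target C \<beta> i g = source C \<beta> i g' \<longrightarrow>
        F (insert i \<beta>) (mult C \<beta> i g' g) = mult D \<beta> i (F (insert i \<beta>) g') (F (insert i \<beta>) g))"

definition cube_morphisms :: "'i set \<Rightarrow> ('i, 'a) cube \<Rightarrow> ('i, 'b) cube \<Rightarrow> ('i set \<Rightarrow> 'a \<Rightarrow> 'b) set" where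
  "cube_morphisms N C D =
     {F \<in> (\<Pi>\<^sub>E \<alpha>\<in>Pow N. vertex C \<alpha> \<rightarrow>\<^sub>E vertex D \<alpha>).
        \<forall>i\<in>N. \<forall>\<beta>. \<beta> \<subseteq> N - {i} \<longrightarrow> edge_functor C D F \<beta> i}"

text \<open>Polynomial structure maps of an edge category; \<open>emult\<close> takes the pair \<open>g' \<bowtie> g\<close> as argument.\<close>

record poly_edge =
  esource :: pmap
  etarget :: pmap
  eunit :: pmap
  emult :: pmap

definition poly_cube where
  "poly_cube sc X E =
     \<lparr>vertex = X,
      source = \<lambda>\<beta> i. ev sc (esource (E \<beta> i)),
      target = \<lambda>\<beta> i. ev sc (etarget (E \<beta> i)),
      unit = \<lambda>\<beta> i. ev sc (eunit (E \<beta> i)),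
      mult = \<lambda>\<beta> i g' g. ev sc (emult (E \<beta> i)) (g' \<bowtie> g)\<rparr>"

text \<open>
  Lifting of the structure maps in old directions. \<open>lift_id h\<close> is \<open>h \<times> id\<close> on \<open>(x, t)\<close> or \<open>(x, s, t)\<close>,
  \<open>lift1 h\<close> is \<open>h\<^sup>{\<^sup>1\<^sup>}\<close> on \<open>(x, v, t)\<close>, and \<open>lift1_bar h\<close> is its homogeneous analogue
  \<open>(h x, h\<^sup>[\<^sup>1\<^sup>] (x, v, s t), s, t)\<close> on \<open>(x, v, s, t)\<close>.
\<close>

definition lift_id :: "pmap \<Rightarrow> pmap" where
  "lift_id h = h \<odot>\<^sub>p PFst \<bowtie>\<^sub>p PSnd"

definition lift1 :: "pmap \<Rightarrow> pmap" where
  "lift1 h = h \<odot>\<^sub>p pr1 \<bowtie>\<^sub>p dq h \<bowtie>\<^sub>p rest2"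

definition lift1_bar :: "pmap \<Rightarrow> pmap" where
  "lift1_bar h = h \<odot>\<^sub>p pr1 \<bowtie>\<^sub>p dq h \<odot>\<^sub>p (pr1 \<bowtie>\<^sub>p pr2 \<bowtie>\<^sub>p pr3 *\<^sub>p rest3) \<bowtie>\<^sub>p rest2"

text \<open>
  Products are defined on pairs, so they are lifted along
  \<open>((g', r'), (g, r)) \<mapsto> ((g', g), r)\<close> and \<open>((g', w', r'), (g, w, r)) \<mapsto> ((g', g), (w', w), r)\<close>,
  where \<open>r\<close> is the tuple of new scalars, and \<open>r' = r\<close> for composable pairs.
\<close>

definition shuffle_id :: pmap where
  "shuffle_id = (PFst \<odot>\<^sub>p PFst \<bowtie>\<^sub>p PFst \<odot>\<^sub>p PSnd) \<bowtie>\<^sub>p PSnd \<odot>\<^sub>p PSnd"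

definition shuffle1 :: pmap where
  "shuffle1 = (pr1 \<odot>\<^sub>p PFst \<bowtie>\<^sub>p pr1 \<odot>\<^sub>p PSnd) \<bowtie>\<^sub>p (pr2 \<odot>\<^sub>p PFst \<bowtie>\<^sub>p pr2 \<odot>\<^sub>p PSnd) \<bowtie>\<^sub>p rest2 \<odot>\<^sub>p PSnd"

definition lift_edge :: "(pmap \<Rightarrow> pmap) \<Rightarrow> pmap \<Rightarrow> poly_edge \<Rightarrow> poly_edge" where
  "lift_edge L S e =
     \<lparr>esource = L (esource e), etarget = L (etarget e), eunit = L (eunit e),
      emult = L (emult e) \<odot>\<^sub>p S\<rparr>"


section \<open>The \<open>n\<close>-fold groupoids of \<open>U\<close>\<close>

definition times_scalars :: "('v, 'k) pt set \<Rightarrow> ('v, 'k) pt set" where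
  "times_scalars X = {x \<bowtie> Scal t | x t. x \<in> X}"

primrec G_vertex :: "('k::{plus, times} \<Rightarrow> 'v::plus \<Rightarrow> 'v) \<Rightarrow> 'v set \<Rightarrow> nat \<Rightarrow> nat set \<Rightarrow> ('v, 'k) pt set" where
  "G_vertex sc U 0 \<alpha> = Vec ` U"
| "G_vertex sc U (Suc n) \<alpha> =
     (if Suc n \<in> \<alpha> then ext1 sc (G_vertex sc U n (\<alpha> - {Suc n})) else times_scalars (G_vertex sc U n \<alpha>))"

text \<open>First order: morphisms \<open>(x, v, t)\<close>, objects \<open>(x, t)\<close>.\<close>

definition edge1 :: poly_edge where
  "edge1 =
     \<lparr>esource = pr1 \<bowtie>\<^sub>p rest2,
      etarget = (pr1 +\<^sub>p rest2 *\<^sub>p pr2) \<bowtie>\<^sub>p rest2,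
      eunit = PFst \<bowtie>\<^sub>p PZero \<odot>\<^sub>p PFst \<bowtie>\<^sub>p PSnd,
      emult = pr1 \<odot>\<^sub>p PSnd \<bowtie>\<^sub>p (pr2 \<odot>\<^sub>p PSnd +\<^sub>p pr2 \<odot>\<^sub>p PFst) \<bowtie>\<^sub>p rest2 \<odot>\<^sub>p PSnd\<rparr>"

text \<open>For \<open>n = 0\<close> there are no edges.\<close>

primrec G_edge :: "nat \<Rightarrow> nat set \<Rightarrow> nat \<Rightarrow> poly_edge" where
  "G_edge 0 \<beta> i = undefined"
| "G_edge (Suc n) \<beta> i =
     (if i = Suc n then edge1
      else if Suc n \<in> \<beta> then lift_edge lift1 shuffle1 (G_edge n (\<beta> - {Suc n}) i)
      else lift_edge lift_id shuffle_id (G_edge n \<beta> i))"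

definition G_cube :: "('k::comm_ring_1 \<Rightarrow> 'v::ab_group_add \<Rightarrow> 'v) \<Rightarrow> 'v set \<Rightarrow> nat \<Rightarrow> (nat, ('v, 'k) pt) cube" where
  "G_cube sc U n = poly_cube sc (G_vertex sc U n) (G_edge n)"


section \<open>The homogeneous \<open>2n\<close>-fold categories of \<open>U\<close>\<close>

datatype dir = Dir nat | Dir' nat

definition dirs :: "nat \<Rightarrow> dir set" where
  "dirs n = Dir ` {1..n} \<union> Dir' ` {1..n}"

definition times_scalars2 :: "('v, 'k) pt set \<Rightarrow> ('v, 'k) pt set" where
  "times_scalars2 X = {x \<bowtie> Scal s \<bowtie> Scal t | x s t. x \<in> X}"

definition ext1_bar :: "('k::{plus, times} \<Rightarrow> 'v::plus \<Rightarrow> 'v) \<Rightarrow> ('v, 'k) pt set \<Rightarrow> ('v, 'k) pt set" where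
  "ext1_bar sc X = {x \<bowtie> v \<bowtie> Scal s \<bowtie> Scal t | x v s t.
     x \<in> X \<and> shape v = shape x \<and> padd x (pscale sc (s * t) v) \<in> X}"

primrec H_vertex :: "('k::{plus, times} \<Rightarrow> 'v::plus \<Rightarrow> 'v) \<Rightarrow> 'v set \<Rightarrow> nat \<Rightarrow> dir set \<Rightarrow> ('v, 'k) pt set" where
  "H_vertex sc U 0 \<alpha> = Vec ` U"
| "H_vertex sc U (Suc n) \<alpha> =
     (let X = H_vertex sc U n (\<alpha> - {Dir (Suc n), Dir' (Suc n)}) in
      if Dir (Suc n) \<in> \<alpha>
      then (if Dir' (Suc n) \<in> \<alpha> then ext1_bar sc X else ext1 sc X)
      else (if Dir' (Suc n) \<in> \<alpha> then times_scalars2 X else times_scalars X))"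

text \<open>Direction \<open>k\<close> on the edge with morphisms \<open>(x, v, s, t)\<close> and objects \<open>(x, s, t)\<close>.\<close>

definition edge1_bar :: poly_edge where
  "edge1_bar =
     \<lparr>esource = pr1 \<bowtie>\<^sub>p rest2,
      etarget = (pr1 +\<^sub>p (pr3 *\<^sub>p rest3) *\<^sub>p pr2) \<bowtie>\<^sub>p rest2,
      eunit = PFst \<bowtie>\<^sub>p PZero \<odot>\<^sub>p PFst \<bowtie>\<^sub>p PSnd,
      emult = pr1 \<odot>\<^sub>p PSnd \<bowtie>\<^sub>p (pr2 \<odot>\<^sub>p PSnd +\<^sub>p pr2 \<odot>\<^sub>p PFst) \<bowtie>\<^sub>p rest2 \<odot>\<^sub>p PSnd\<rparr>"

text \<open>Direction \<open>k'\<close>: morphisms \<open>(x, s, t)\<close> over objects \<open>(x, t)\<close>, resp.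
  morphisms \<open>(x, v, s, t)\<close> over objects \<open>(x, v, t)\<close>.\<close>

definition edge_scal :: poly_edge where
  "edge_scal =
     \<lparr>esource = pr1 \<bowtie>\<^sub>p pr2 *\<^sub>p rest2,
      etarget = pr1 \<bowtie>\<^sub>p rest2,
      eunit = PFst \<bowtie>\<^sub>p POne \<bowtie>\<^sub>p PSnd,
      emult = pr1 \<odot>\<^sub>p PSnd \<bowtie>\<^sub>p (pr2 \<odot>\<^sub>p PSnd) *\<^sub>p (pr2 \<odot>\<^sub>p PFst) \<bowtie>\<^sub>p rest2 \<odot>\<^sub>p PFst\<rparr>"

definition edge_scal_bar :: poly_edge where
  "edge_scal_bar =
     \<lparr>esource = pr1 \<bowtie>\<^sub>p pr2 \<bowtie>\<^sub>p pr3 *\<^sub>p rest3,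
      etarget = pr1 \<bowtie>\<^sub>p pr3 *\<^sub>p pr2 \<bowtie>\<^sub>p rest3,
      eunit = pr1 \<bowtie>\<^sub>p pr2 \<bowtie>\<^sub>p POne \<bowtie>\<^sub>p rest2,
      emult = pr1 \<odot>\<^sub>p PSnd \<bowtie>\<^sub>p pr2 \<odot>\<^sub>p PSnd \<bowtie>\<^sub>p (pr3 \<odot>\<^sub>p PSnd) *\<^sub>p (pr3 \<odot>\<^sub>p PFst) \<bowtie>\<^sub>p rest3 \<odot>\<^sub>p PFst\<rparr>"

primrec H_edge :: "nat \<Rightarrow> dir set \<Rightarrow> dir \<Rightarrow> poly_edge" where
  "H_edge 0 \<beta> i = undefined"
| "H_edge (Suc n) \<beta> i =
     (if i = Dir (Suc n) then (if Dir' (Suc n) \<in> \<beta> then edge1_bar else edge1)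
      else if i = Dir' (Suc n) then (if Dir (Suc n) \<in> \<beta> then edge_scal_bar else edge_scal)
      else let e = H_edge n (\<beta> - {Dir (Suc n), Dir' (Suc n)}) i in
        if Dir (Suc n) \<in> \<beta>
        then lift_edge (if Dir' (Suc n) \<in> \<beta> then lift1_bar else lift1) shuffle1 e
        else lift_edge lift_id shuffle_id e)"

definition H_cube :: "('k::comm_ring_1 \<Rightarrow> 'v::ab_group_add \<Rightarrow> 'v) \<Rightarrow> 'v set \<Rightarrow> nat \<Rightarrow> (dir, ('v, 'k) pt) cube" where
  "H_cube sc U n = poly_cube sc (H_vertex sc U n) (H_edge n)"


section \<open>Laws\<close>

definition laws where
  "laws scV scW n U U' =
     {F \<in> (\<Pi>\<^sub>E k\<in>{k. enat k \<le> n}. cube_morphisms {1..k} (G_cube scV U k) (G_cube scW U' k)).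
        \<forall>k. enat (Suc k) \<le> n \<longrightarrow> (\<forall>\<alpha> \<subseteq> {1..Suc k}. Suc k \<notin> \<alpha> \<longrightarrow>
          (\<forall>x \<in> vertex (G_cube scV U k) \<alpha>. \<forall>t. F (Suc k) \<alpha> (x \<bowtie> Scal t) = F k \<alpha> x \<bowtie> Scal t))}"

definition continuous_laws where
  "continuous_laws scV scW n U U' =
     {F \<in> laws scV scW n U U'.
        \<forall>k. enat k \<le> n \<longrightarrow> (\<forall>\<alpha> \<subseteq> {1..k}. continuous_on (vertex (G_cube scV U k) \<alpha>) (F k \<alpha>))}"

definition homogeneous_laws where
  "homogeneous_laws scV scW n U U' =
     {F \<in> (\<Pi>\<^sub>E k\<in>{k. enat k \<le> n}. cube_morphisms (dirs k) (H_cube scV U k) (H_cube scW U' k)).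
        \<forall>k. enat (Suc k) \<le> n \<longrightarrow> (\<forall>\<alpha> \<subseteq> dirs (Suc k).
          (Dir (Suc k) \<notin> \<alpha> \<longrightarrow> Dir' (Suc k) \<notin> \<alpha> \<longrightarrow>
             (\<forall>x \<in> vertex (H_cube scV U k) \<alpha>. \<forall>t. F (Suc k) \<alpha> (x \<bowtie> Scal t) = F k \<alpha> x \<bowtie> Scal t)) \<and>
          (Dir (Suc k) \<in> \<alpha> \<longrightarrow> Dir' (Suc k) \<notin> \<alpha> \<longrightarrow>
             (\<forall>x v t. x \<bowtie> v \<bowtie> Scal t \<in> vertex (H_cube scV U (Suc k)) \<alpha> \<longrightarrow>
                (\<exists>y w. F (Suc k) \<alpha> (x \<bowtie> v \<bowtie> Scal t) = y \<bowtie> w \<bowtie> Scal t))) \<and>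
          (Dir (Suc k) \<notin> \<alpha> \<longrightarrow> Dir' (Suc k) \<in> \<alpha> \<longrightarrow>
             (\<forall>x s t. x \<bowtie> Scal s \<bowtie> Scal t \<in> vertex (H_cube scV U (Suc k)) \<alpha> \<longrightarrow>
                (\<exists>y. F (Suc k) \<alpha> (x \<bowtie> Scal s \<bowtie> Scal t) = y \<bowtie> Scal s \<bowtie> Scal t))) \<and>
          (Dir (Suc k) \<in> \<alpha> \<longrightarrow> Dir' (Suc k) \<in> \<alpha> \<longrightarrow>
             (\<forall>x v s t. x \<bowtie> v \<bowtie> Scal s \<bowtie> Scal t \<in> vertex (H_cube scV U (Suc k)) \<alpha> \<longrightarrow>
                (\<exists>y w. F (Suc k) \<alpha> (x \<bowtie> v \<bowtie> Scal s \<bowtie> Scal t) = y \<bowtie> w \<bowtie> Scal s \<bowtie> Scal t))))}"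

definition continuous_homogeneous_laws where
  "continuous_homogeneous_laws scV scW n U U' =
     {F \<in> homogeneous_laws scV scW n U U'.
        \<forall>k. enat k \<le> n \<longrightarrow> (\<forall>\<alpha> \<subseteq> dirs k. continuous_on (vertex (H_cube scV U k) \<alpha>) (F k \<alpha>))}"

definition base_map :: "'v set \<Rightarrow> (nat \<Rightarrow> 'i set \<Rightarrow> ('v, 'k) pt \<Rightarrow> ('w, 'k) pt) \<Rightarrow> 'v \<Rightarrow> 'w" where
  "base_map U F = (\<lambda>x\<in>U. the_vec (F 0 {} (Vec x)))"

end

theory Submission
  imports Defs
begin

text \<open>
  An arrow \<open>(x, v, t)\<close> of the last direction added to the \<open>k\<close>-fold groupoid goes from \<open>(x, t)\<close> to
  \<open>(x + t v, t)\<close>. Compatibility with its source and target forces a law to send it to \<open>(F x, w, t)\<close> with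
  \<open>F (x + t v) = F x + t w\<close>. For invertible \<open>t\<close> this determines \<open>w\<close>, and by density and continuity
  \<open>w\<close> is the value of the difference quotient of \<open>F\<close>. Hence laws are determined by their base maps, and
  iterated difference quotients of the base map can be read off from a law. In the homogeneous case the
  scalar directions \<open>k'\<close> determine the remaining vertex maps in the same way.

  Conversely, the iterated difference quotients of a \<open>C\<^sup>n\<close>-map define the vertex maps of a homogeneous law.
  They respect the new edge categories because difference quotients are additive and homogeneous in \<open>v\<close>,
  and the old ones because the chain rule and the uniqueness of continuous difference quotients let one
  differentiate every identity between maps on open sets. Keeping only the directions \<open>k\<close> yields a law
  of groupoids with the same base map.
\<close>

section \<open>Topology and algebra of the iterated products\<close>

text \<open>Two obstacles shape the details. Structure maps are syntax (\<open>pmap\<close>) with a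
  syntactic difference quotient \<open>dq\<close>, whereas vertex maps of a law have only
  topological ones. Both are brought under one division-free notion, \<open>slope_of\<close>: the
  equation \<open>F (x + t v) = F x + t * G (x, v, t)\<close> at every \<open>t\<close>, invertible
  or not. It composes with polynomial maps, and on open sets density leaves at most one continuous
  \<open>G\<close>. The other obstacle is that the product of an edge category is defined on
  composable pairs only, while density differentiates identities on open sets. Each edge category is
  therefore carried through the recursion together with polynomial maps that correct an arbitrary
  pair to a composable one; they are written down for the four first-order edges and lifted like any
  other polynomial map. Restriction to the unprimed directions is used twice: it also shows that the
  base map of a homogeneous law is of class \<open>C^n\<close>.\<close>

lemma pt_box_Int: "pt_box S \<Longrightarrow> pt_box T \<Longrightarrow> S \<inter> T = {} \<or> pt_box (S \<inter> T)"
proof (induction arbitrary: T rule: pt_box.induct)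
  case (1 A)
  from 1(2) show ?case
  proof cases
    case (1 B)
    then have "Vec ` A \<inter> T = Vec ` (A \<inter> B)" by auto
    then show ?thesis using 1 \<open>open A\<close> pt_box.intros(1)[of "A \<inter> B"] by auto
  qed auto
next
  case (2 A)
  from 2(2) show ?case
  proof cases
    case (2 B)
    then have "Scal ` A \<inter> T = Scal ` (A \<inter> B)" by auto
    then show ?thesis using 2 \<open>open A\<close> pt_box.intros(2)[of "A \<inter> B"] by auto
  qed auto
next
  case (3 S1 S2)
  from 3(5) show ?case
  proof cases
    case (3 T1 T2)
    have eq: "{x \<bowtie> y |x y. x \<in> S1 \<and> y \<in> S2} \<inter> T = {x \<bowtie> y |x y. x \<in> S1 \<inter> T1 \<and> y \<in> S2 \<inter> T2}"
      using 3 by auto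
    show ?thesis
      unfolding eq using "3.IH"(1)[OF 3(2)] "3.IH"(2)[OF 3(3)] pt_box.intros(3)[of "S1 \<inter> T1" "S2 \<inter> T2"]
      by auto
  qed auto
qed

lemma pt_box_shape: "pt_box {x :: ('v::topological_space, 'k::topological_space) pt. shape x = a}"
proof (induction a)
  case (Vec u)
  have "{x :: ('v, 'k) pt. shape x = Vec u} = Vec ` UNIV" by auto
  then show ?case using pt_box.intros(1)[of UNIV] by simp
next
  case (Scal u)
  have "{x :: ('v, 'k) pt. shape x = Scal u} = Scal ` UNIV" by auto
  then show ?case using pt_box.intros(2)[of UNIV] by simp
next
  case (Join a b)
  have "{x :: ('v, 'k) pt. shape x = a \<bowtie> b} =
      {x \<bowtie> y |x y. x \<in> {x. shape x = a} \<and> y \<in> {x. shape x = b}}" by auto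
  then show ?case using pt_box.intros(3)[OF Join.IH] by simp
qed

lemma pt_box_open: "pt_box S \<Longrightarrow> open S"
  unfolding open_pt_def by (auto intro: generate_topology.Basis)

text \<open>The boxes form a basis and not only a subbasis: by \<open>pt_box_Int\<close> two of them
  meet in a box or not at all, and by \<open>pt_box_shape\<close> they cover. Continuity of the
  constructors can thus be tested on boxes.\<close>

lemma open_pt_iff: "open S \<longleftrightarrow> (\<forall>x\<in>S. \<exists>B. pt_box B \<and> x \<in> B \<and> B \<subseteq> S)"
proof
  assume "open S"
  then have "generate_topology (Collect pt_box) S" by (simp add: open_pt_def)
  then show "\<forall>x\<in>S. \<exists>B. pt_box B \<and> x \<in> B \<and> B \<subseteq> S"
  proof induction
    case UNIV
    show ?case
    proof
      fix x :: "('a, 'b) pt"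
      show "\<exists>B. pt_box B \<and> x \<in> B \<and> B \<subseteq> UNIV"
        using pt_box_shape[of "shape x"] by (intro exI[of _ "{y. shape y = shape x}"]) auto
    qed
  next
    case (Int a b)
    show ?case
    proof
      fix x assume x: "x \<in> a \<inter> b"
      then obtain A where A: "pt_box A" "x \<in> A" "A \<subseteq> a" using Int by blast
      obtain B where B: "pt_box B" "x \<in> B" "B \<subseteq> b" using Int x by blast
      show "\<exists>B. pt_box B \<and> x \<in> B \<and> B \<subseteq> a \<inter> b"
        using pt_box_Int[OF A(1) B(1)] A B by (intro exI[of _ "A \<inter> B"]) blast
    qed
  next
    case (UN K)
    then show ?case by (meson Union_iff Union_upper subset_trans)
  qed auto
next
  assume *: "\<forall>x\<in>S. \<exists>B. pt_box B \<and> x \<in> B \<and> B \<subseteq> S"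
  then have "S = \<Union>{B. pt_box B \<and> B \<subseteq> S}" by blast
  moreover have "open (\<Union>{B. pt_box B \<and> B \<subseteq> S})" by (auto intro: pt_box_open)
  ultimately show "open S" by simp
qed

lemma open_shape: "open {x :: ('v::topological_space, 'k::topological_space) pt. shape x = a}"
  by (intro pt_box_open pt_box_shape)

lemma open_Vec_image: "open A \<Longrightarrow> open (Vec ` A)"
  by (intro pt_box_open pt_box.intros)

lemma open_Join:
  assumes "open S" "open T"
  shows "open {x \<bowtie> y |x y. x \<in> S \<and> y \<in> T}"
  unfolding open_pt_iff
proof
  fix z assume "z \<in> {x \<bowtie> y |x y. x \<in> S \<and> y \<in> T}"
  then obtain x y where z: "z = x \<bowtie> y" "x \<in> S" "y \<in> T" by blast
  then obtain A B where "pt_box A" "x \<in> A" "A \<subseteq> S" "pt_box B" "y \<in> B" "B \<subseteq> T"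
    using assms unfolding open_pt_iff by meson
  then show "\<exists>B. pt_box B \<and> z \<in> B \<and> B \<subseteq> {x \<bowtie> y |x y. x \<in> S \<and> y \<in> T}"
    using z by (intro exI[of _ "{x \<bowtie> y |x y. x \<in> A \<and> y \<in> B}"]) (auto intro: pt_box.intros)
qed

lemma pt_separate_shape:
  assumes "shape y \<noteq> shape x"
  shows "\<exists>S T. open S \<and> open T \<and> x \<in> S \<and> y \<in> T \<and> S \<inter> T = {}"
  by (rule exI[of _ "{z. shape z = shape x}"], rule exI[of _ "{z. shape z = shape y}"])
    (use assms in \<open>simp add: open_shape set_eq_iff\<close>)

text \<open>Trees of different shapes are separated by their shape classes, trees of one shape by
  the first coordinate in which they differ. The Hausdorff property lets density arguments apply to
  tree-valued slopes.\<close>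

lemma pt_separate:
  "x \<noteq> y \<Longrightarrow> \<exists>S T. open S \<and> open T \<and> x \<in> S \<and> y \<in> T \<and> S \<inter> T = {}"
  for x y :: "('a::t2_space, 'b::t2_space) pt"
proof (induction x arbitrary: y)
  case (Vec a)
  show ?case
  proof (cases y)
    case (Vec b)
    then obtain A B where "open A" "open B" "a \<in> A" "b \<in> B" "A \<inter> B = {}"
      using \<open>Vec a \<noteq> y\<close> hausdorff[of a b] by blast
    then show ?thesis
      using Vec by (intro exI[of _ "Vec ` A"] exI[of _ "Vec ` B"]) (auto intro: open_Vec_image)
  qed (rule pt_separate_shape, simp)+
next
  case (Scal a)
  show ?case
  proof (cases y)
    case (Scal b)
    then obtain A B where "open A" "open B" "a \<in> A" "b \<in> B" "A \<inter> B = {}"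
      using \<open>Scal a \<noteq> y\<close> hausdorff[of a b] by blast
    then show ?thesis
      using Scal by (intro exI[of _ "Scal ` A"] exI[of _ "Scal ` B"])
        (auto intro!: pt_box_open pt_box.intros)
  qed (rule pt_separate_shape, simp)+
next
  case (Join x1 x2)
  show ?case
  proof (cases y)
    case J: (Join y1 y2)
    show ?thesis
    proof (cases "x1 = y1")
      case False
      then obtain A B where "open A" "open B" "x1 \<in> A" "y1 \<in> B" "A \<inter> B = {}"
        using Join.IH(1)[of y1] by blast
      then show ?thesis
        using J by (intro exI[of _ "{x \<bowtie> y |x y. x \<in> A \<and> y \<in> UNIV}"]
            exI[of _ "{x \<bowtie> y |x y. x \<in> B \<and> y \<in> UNIV}"] conjI open_Join) auto
    next
      case True
      then have "x2 \<noteq> y2" using Join.prems J by simp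
      then obtain A B where "open A" "open B" "x2 \<in> A" "y2 \<in> B" "A \<inter> B = {}"
        using Join.IH(2)[of y2] by blast
      then show ?thesis
        using J by (intro exI[of _ "{x \<bowtie> y |x y. x \<in> UNIV \<and> y \<in> A}"]
            exI[of _ "{x \<bowtie> y |x y. x \<in> UNIV \<and> y \<in> B}"] conjI open_Join) auto
    qed
  qed (rule pt_separate_shape, simp)+
qed

instance pt :: (t2_space, t2_space) t2_space
  by intro_classes (metis pt_separate)

section \<open>Continuity of constructors, selectors and polynomial maps\<close>

lemma continuous_on_Vec [continuous_intros]:
  fixes f :: "'d::topological_space \<Rightarrow> 'a::topological_space"
  assumes "continuous_on S f" shows "continuous_on S (\<lambda>x. Vec (f x))"
proof (rule continuous_on_compose2[OF _ assms])
  show "continuous_on UNIV (Vec :: 'a \<Rightarrow> ('a, 'c::topological_space) pt)"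
    unfolding continuous_on_open_vimage[OF open_UNIV]
  proof (intro allI impI)
    fix B :: "('a, 'c) pt set" assume "open B"
    show "open (Vec -` B \<inter> UNIV)"
    proof (subst open_subopen, intro ballI)
      fix a assume "a \<in> Vec -` B \<inter> UNIV"
      then obtain C where C: "pt_box C" "Vec a \<in> C" "C \<subseteq> B" using \<open>open B\<close> unfolding open_pt_iff by auto
      from C(1) obtain A where "open A" "C = Vec ` A" using C(2) by cases auto
      then show "\<exists>T. open T \<and> a \<in> T \<and> T \<subseteq> Vec -` B \<inter> UNIV" using C by (intro exI[of _ A]) auto
    qed
  qed
qed simp

lemma continuous_on_Scal [continuous_intros]:
  fixes f :: "'d::topological_space \<Rightarrow> 'a::topological_space"
  assumes "continuous_on S f" shows "continuous_on S (\<lambda>x. Scal (f x))"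
proof (rule continuous_on_compose2[OF _ assms])
  show "continuous_on UNIV (Scal :: 'a \<Rightarrow> ('c::topological_space, 'a) pt)"
    unfolding continuous_on_open_vimage[OF open_UNIV]
  proof (intro allI impI)
    fix B :: "('c, 'a) pt set" assume "open B"
    show "open (Scal -` B \<inter> UNIV)"
    proof (subst open_subopen, intro ballI)
      fix a assume "a \<in> Scal -` B \<inter> UNIV"
      then obtain C where C: "pt_box C" "Scal a \<in> C" "C \<subseteq> B" using \<open>open B\<close> unfolding open_pt_iff by auto
      from C(1) obtain A where "open A" "C = Scal ` A" using C(2) by cases auto
      then show "\<exists>T. open T \<and> a \<in> T \<and> T \<subseteq> Scal -` B \<inter> UNIV" using C by (intro exI[of _ A]) auto
    qed
  qed
qed simp

lemma continuous_on_Join [continuous_intros]: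
  assumes "continuous_on S f" "continuous_on S g" shows "continuous_on S (\<lambda>x. f x \<bowtie> g x)"
proof (rule continuous_on_compose2[OF _ continuous_on_Pair[OF assms], of UNIV "\<lambda>(x, y). x \<bowtie> y", simplified])
  show "continuous_on UNIV (\<lambda>(x, y). x \<bowtie> y :: ('b, 'c) pt)"
    unfolding continuous_on_open_vimage[OF open_UNIV]
  proof (intro allI impI)
    fix B :: "('b, 'c) pt set" assume "open B"
    show "open ((\<lambda>(x, y). x \<bowtie> y) -` B \<inter> UNIV)"
    proof (subst open_subopen, intro ballI)
      fix p assume p: "p \<in> (\<lambda>(x, y). x \<bowtie> y) -` B \<inter> UNIV"
      obtain a b where ab: "p = (a, b)" by (cases p)
      then obtain C where C: "pt_box C" "a \<bowtie> b \<in> C" "C \<subseteq> B"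
        using p \<open>open B\<close> unfolding open_pt_iff by auto
      from C(1) obtain A1 A2 where "pt_box A1" "pt_box A2" "C = {x \<bowtie> y |x y. x \<in> A1 \<and> y \<in> A2}"
        using C(2) by cases auto
      then show "\<exists>T. open T \<and> p \<in> T \<and> T \<subseteq> (\<lambda>(x, y). x \<bowtie> y) -` B \<inter> UNIV"
        using C ab by (intro exI[of _ "A1 \<times> A2"]) (fastforce intro!: open_Times pt_box_open)
    qed
  qed
qed

lemma open_range_Vec: "open (range Vec)"
  and open_range_Scal: "open (range Scal)"
  and open_range_Join: "open {x \<bowtie> y |x y. True}"
  using open_Vec_image[of UNIV] pt_box_open[OF pt_box.intros(2), of UNIV] open_Join[of UNIV UNIV]
  by auto

text \<open>Selectors have unspecified values off their own constructor, whence the range hypothesis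
  here and in the next three lemmas. The ranges are open, so preimages may be computed inside
  them.\<close>

lemma continuous_on_the_vec:
  assumes "continuous_on S f" "\<And>x. x \<in> S \<Longrightarrow> f x \<in> range Vec"
  shows "continuous_on S (\<lambda>x. the_vec (f x))"
proof (rule continuous_on_compose2[OF _ assms(1)])
  show "continuous_on (range Vec) (the_vec :: ('b, 'c) pt \<Rightarrow> 'b)"
    unfolding continuous_on_open_vimage[OF open_range_Vec]
  proof (intro allI impI)
    fix B :: "'b set" assume "open B"
    moreover have "the_vec -` B \<inter> range Vec = (Vec ` B :: ('b, 'c) pt set)" by auto
    ultimately show "open (the_vec -` B \<inter> range Vec :: ('b, 'c) pt set)" by (simp add: open_Vec_image)
  qed
qed (use assms in auto)

lemma continuous_on_the_scal:
  assumes "continuous_on S f" "\<And>x. x \<in> S \<Longrightarrow> f x \<in> range Scal"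
  shows "continuous_on S (\<lambda>x. the_scal (f x))"
proof (rule continuous_on_compose2[OF _ assms(1)])
  show "continuous_on (range Scal) (the_scal :: ('b, 'c) pt \<Rightarrow> 'c)"
    unfolding continuous_on_open_vimage[OF open_range_Scal]
  proof (intro allI impI)
    fix B :: "'c set" assume "open B"
    moreover have "the_scal -` B \<inter> range Scal = (Scal ` B :: ('b, 'c) pt set)" by auto
    ultimately show "open (the_scal -` B \<inter> range Scal :: ('b, 'c) pt set)"
      by (simp add: pt_box_open pt_box.intros)
  qed
qed (use assms in auto)

lemma continuous_on_pfst:
  assumes "continuous_on S f" "\<And>x. x \<in> S \<Longrightarrow> \<exists>y z. f x = y \<bowtie> z"
  shows "continuous_on S (\<lambda>x. pfst (f x))"
proof (rule continuous_on_compose2[OF _ assms(1)])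
  show "continuous_on {x \<bowtie> y |x y. True} (pfst :: ('b, 'c) pt \<Rightarrow> _)"
    unfolding continuous_on_open_vimage[OF open_range_Join]
  proof (intro allI impI)
    fix B :: "('b, 'c) pt set" assume "open B"
    moreover have "pfst -` B \<inter> {x \<bowtie> y |x y. True} = {x \<bowtie> y |x y. x \<in> B \<and> y \<in> UNIV}" by auto
    ultimately show "open (pfst -` B \<inter> {x \<bowtie> y |x y. True})"
      using open_Join[of B UNIV] by simp
  qed
qed (use assms in auto)

lemma continuous_on_psnd:
  assumes "continuous_on S f" "\<And>x. x \<in> S \<Longrightarrow> \<exists>y z. f x = y \<bowtie> z"
  shows "continuous_on S (\<lambda>x. psnd (f x))"
proof (rule continuous_on_compose2[OF _ assms(1)])
  show "continuous_on {x \<bowtie> y |x y. True} (psnd :: ('b, 'c) pt \<Rightarrow> _)"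
    unfolding continuous_on_open_vimage[OF open_range_Join]
  proof (intro allI impI)
    fix B :: "('b, 'c) pt set" assume "open B"
    moreover have "psnd -` B \<inter> {x \<bowtie> y |x y. True} = {x \<bowtie> y |x y. x \<in> UNIV \<and> y \<in> B}" by auto
    ultimately show "open (psnd -` B \<inter> {x \<bowtie> y |x y. True})"
      using open_Join[of UNIV B] by simp
  qed
qed (use assms in auto)

lemma shape_VecE: assumes "shape x = Vec u" obtains a where "x = Vec a"
  using assms by (cases x) auto

lemma shape_ScalE: assumes "shape x = Scal u" obtains a where "x = Scal a"
  using assms by (cases x) auto

lemma shape_JoinE: assumes "shape x = a \<bowtie> b" obtains y z where "x = y \<bowtie> z" "shape y = a" "shape z = b"
  using assms by (cases x) auto

text \<open>\<open>padd\<close> is \<open>undefined\<close> on trees of different shapes, so both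
  maps are held in one shape; induction on it reduces the claim to addition in the module and in the
  ring.\<close>

lemma continuous_on_padd:
  fixes f g :: "'a::topological_space \<Rightarrow> ('v::topological_ab_group_add, 'k::topological_ab_group_add) pt"
  shows "continuous_on S f \<Longrightarrow> continuous_on S g \<Longrightarrow> (\<And>x. x \<in> S \<Longrightarrow> shape (f x) = a) \<Longrightarrow>
    (\<And>x. x \<in> S \<Longrightarrow> shape (g x) = a) \<Longrightarrow> continuous_on S (\<lambda>x. padd (f x) (g x))"
proof (induction a arbitrary: f g)
  case (Vec u)
  have R: "f x \<in> range Vec" "g x \<in> range Vec" if "x \<in> S" for x
    using Vec(3,4)[OF that] by (auto elim: shape_VecE)
  have "continuous_on S (\<lambda>x. Vec (the_vec (f x) + the_vec (g x)) :: ('v, 'k) pt)"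
    using Vec(1,2) R by (intro continuous_intros continuous_on_the_vec)
  moreover have "Vec (the_vec (f x) + the_vec (g x)) = padd (f x) (g x)" if "x \<in> S" for x
    using R[OF that] by auto
  ultimately show ?case by (simp cong: continuous_on_cong)
next
  case (Scal u)
  have R: "f x \<in> range Scal" "g x \<in> range Scal" if "x \<in> S" for x
    using Scal(3,4)[OF that] by (auto elim: shape_ScalE)
  have "continuous_on S (\<lambda>x. Scal (the_scal (f x) + the_scal (g x)) :: ('v, 'k) pt)"
    using Scal(1,2) R by (intro continuous_intros continuous_on_the_scal)
  moreover have "Scal (the_scal (f x) + the_scal (g x)) = padd (f x) (g x)" if "x \<in> S" for x
    using R[OF that] by auto
  ultimately show ?case by (simp cong: continuous_on_cong)
next
  case (Join a b)
  have F: "\<exists>y z. f x = y \<bowtie> z" "shape (pfst (f x)) = a" "shape (psnd (f x)) = b" if "x \<in> S" for x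
    using Join.prems(3)[OF that] by auto
  have G: "\<exists>y z. g x = y \<bowtie> z" "shape (pfst (g x)) = a" "shape (psnd (g x)) = b" if "x \<in> S" for x
    using Join.prems(4)[OF that] by auto
  have "continuous_on S (\<lambda>x. padd (pfst (f x)) (pfst (g x)) \<bowtie> padd (psnd (f x)) (psnd (g x)))"
  proof (intro continuous_on_Join)
    show "continuous_on S (\<lambda>x. padd (pfst (f x)) (pfst (g x)))"
      by (rule Join.IH(1)) (use Join.prems(1,2) F G continuous_on_pfst in blast)+
    show "continuous_on S (\<lambda>x. padd (psnd (f x)) (psnd (g x)))"
      by (rule Join.IH(2)) (use Join.prems(1,2) F G continuous_on_psnd in blast)+
  qed
  moreover have "padd (pfst (f x)) (pfst (g x)) \<bowtie> padd (psnd (f x)) (psnd (g x)) = padd (f x) (g x)" if "x \<in> S" for x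
    using F(1)[OF that] G(1)[OF that] by auto
  ultimately show ?case by (simp cong: continuous_on_cong)
qed

text \<open>\<open>pzero\<close> depends on the shape only, so it is constant on trees of one
  shape.\<close>

lemma continuous_on_pzero:
  fixes f :: "'a::topological_space \<Rightarrow> ('v::{zero, topological_space}, 'k::{zero, topological_space}) pt"
  assumes "\<And>x. x \<in> S \<Longrightarrow> shape (f x) = a"
  shows "continuous_on S (\<lambda>x. pzero (f x))"
proof -
  have *: "shape x = a \<Longrightarrow> shape y = a \<Longrightarrow> pzero x = pzero y" for x y :: "('v, 'k) pt"
  proof (induction a arbitrary: x y)
    case (Join a b)
    from Join.prems(1) obtain x1 x2 where "x = x1 \<bowtie> x2" "shape x1 = a" "shape x2 = b"
      by (rule shape_JoinE)
    moreover from Join.prems(2) obtain y1 y2 where "y = y1 \<bowtie> y2" "shape y1 = a" "shape y2 = b"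
      by (rule shape_JoinE)
    ultimately show ?case using Join.IH(1)[of x1 y1] Join.IH(2)[of x2 y2] by simp
  qed auto
  show ?thesis
  proof (cases "S = {}")
    case False
    then obtain y where "y \<in> S" by auto
    have "continuous_on S (\<lambda>x. pzero (f y))" by (rule continuous_on_const)
    then show ?thesis
      by (rule continuous_on_eq) (use *[OF assms[OF \<open>y \<in> S\<close>] assms] in blast)
  qed auto
qed

context topological_module
begin

lemma continuous_on_scale:
  assumes "continuous_on S f" "continuous_on S g" shows "continuous_on S (\<lambda>x. scale (f x) (g x))"
  using continuous_on_compose2[OF continuous_scale continuous_on_Pair[OF assms]] by simp

lemma continuous_on_pscale:
  fixes f :: "'a::topological_space \<Rightarrow> ('v, 'k) pt"
  shows "continuous_on S k \<Longrightarrow> continuous_on S f \<Longrightarrow> (\<And>x. x \<in> S \<Longrightarrow> shape (f x) = a) \<Longrightarrow>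
    continuous_on S (\<lambda>x. pscale scale (k x) (f x))"
proof (induction a arbitrary: f)
  case (Vec u)
  have R: "f x \<in> range Vec" if "x \<in> S" for x
    using Vec(3)[OF that] by (auto elim: shape_VecE)
  have "continuous_on S (\<lambda>x. Vec (scale (k x) (the_vec (f x))) :: ('v, 'k) pt)"
    using Vec(1,2) R by (intro continuous_intros continuous_on_the_vec continuous_on_scale)
  moreover have "Vec (scale (k x) (the_vec (f x))) = pscale scale (k x) (f x)" if "x \<in> S" for x
    using R[OF that] by auto
  ultimately show ?case by (simp cong: continuous_on_cong)
next
  case (Scal u)
  have R: "f x \<in> range Scal" if "x \<in> S" for x
    using Scal(3)[OF that] by (auto elim: shape_ScalE)
  have "continuous_on S (\<lambda>x. Scal (k x * the_scal (f x)) :: ('v, 'k) pt)"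
    using Scal(1,2) R by (intro continuous_intros continuous_on_the_scal continuous_on_mult')
  moreover have "Scal (k x * the_scal (f x)) = pscale scale (k x) (f x)" if "x \<in> S" for x
    using R[OF that] by auto
  ultimately show ?case by (simp cong: continuous_on_cong)
next
  case (Join a b)
  have F: "\<exists>y z. f x = y \<bowtie> z" "shape (pfst (f x)) = a" "shape (psnd (f x)) = b" if "x \<in> S" for x
    using Join.prems(3)[OF that] by auto
  have "continuous_on S (\<lambda>x. pscale scale (k x) (pfst (f x)) \<bowtie> pscale scale (k x) (psnd (f x)))"
  proof (intro continuous_on_Join)
    show "continuous_on S (\<lambda>x. pscale scale (k x) (pfst (f x)))"
      by (rule Join.IH(1)) (use Join.prems(1,2) F continuous_on_pfst in blast)+
    show "continuous_on S (\<lambda>x. pscale scale (k x) (psnd (f x)))"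
      by (rule Join.IH(2)) (use Join.prems(1,2) F continuous_on_psnd in blast)+
  qed
  moreover have "pscale scale (k x) (pfst (f x)) \<bowtie> pscale scale (k x) (psnd (f x)) = pscale scale (k x) (f x)" if "x \<in> S" for x
    using F(1)[OF that] by auto
  ultimately show ?case by (simp cong: continuous_on_cong)
qed

text \<open>This is the typing part of \<open>ev_dq\<close>, with \<open>x\<close> itself as some
  direction of the right shape.\<close>

lemma shape_ev: "typed p a b \<Longrightarrow> shape x = a \<Longrightarrow> shape (ev scale p x) = b"
  using ev_dq[OF module_axioms, of p a b x x] by blast

lemma continuous_on_ev:
  "typed p a b \<Longrightarrow> continuous_on S f \<Longrightarrow> (\<And>x. x \<in> S \<Longrightarrow> shape (f x) = a) \<Longrightarrow>
    continuous_on S (\<lambda>x. ev scale p (f x))"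
proof (induction arbitrary: f rule: typed.induct)
  case (2 a b)
  have "\<exists>y z. f x = y \<bowtie> z" if "x \<in> S" for x
    using 2(2)[OF that] by (rule shape_JoinE) simp
  then show ?case using 2(1) by (simp add: continuous_on_pfst)
next
  case (3 a b)
  have "\<exists>y z. f x = y \<bowtie> z" if "x \<in> S" for x
    using 3(2)[OF that] by (rule shape_JoinE) simp
  then show ?case using 3(1) by (simp add: continuous_on_psnd)
next
  case (4 a)
  show ?case unfolding ev.simps by (rule continuous_on_pzero[OF 4(2)])
next
  case (7 p a b q)
  show ?case unfolding ev.simps
    by (rule continuous_on_padd[OF 7(3)[OF 7(5,6)] 7(4)[OF 7(5,6)] shape_ev[OF 7(1) 7(6)]
          shape_ev[OF 7(2) 7(6)]])
next
  case (8 p a q b)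
  have "ev scale p (f x) \<in> range Scal" if "x \<in> S" for x
    using shape_ev[OF 8(1) 8(6)[OF that]] by (rule shape_ScalE) simp
  then have "continuous_on S (\<lambda>x. the_scal (ev scale p (f x)))"
    using 8(3)[OF 8(5,6)] by (intro continuous_on_the_scal)
  then show ?case unfolding ev.simps
    by (rule continuous_on_pscale[OF _ 8(4)[OF 8(5,6)] shape_ev[OF 8(2) 8(6)]])
next
  case (9 q a b p c)
  show ?case unfolding ev.simps
    by (rule 9(4)[OF 9(3)[OF 9(5,6)] shape_ev[OF 9(1) 9(6)]])
qed (simp_all add: continuous_on_Join continuous_on_Scal continuous_on_const)

end

section \<open>Pointwise difference quotients\<close>

text \<open>As a rewrite rule, \<open>shape_eq_iff(3)\<close> makes the simplifier loop on equations between shapes.\<close>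

declare shape_eq_iff(3) [simp del]

lemma padd_assoc:
  "shape x = c \<Longrightarrow> shape y = c \<Longrightarrow> shape z = c \<Longrightarrow> padd (padd x y) z = padd x (padd y z)"
  for x y :: "('v::ab_semigroup_add, 'k::ab_semigroup_add) pt"
proof (induction c arbitrary: x y z)
  case (Join a b)
  then show ?case by (elim shape_JoinE) simp
qed (auto simp: add.assoc)

lemma padd_pzero [simp]: "padd x (pzero x) = x"
  for x :: "('v::monoid_add, 'k::monoid_add) pt"
  by (induction x) auto

lemma padd_left_cancel:
  "shape x = c \<Longrightarrow> shape y = c \<Longrightarrow> shape z = c \<Longrightarrow> padd x y = padd x z \<Longrightarrow> y = z"
  for x y :: "('v::cancel_semigroup_add, 'k::cancel_semigroup_add) pt"
proof (induction c arbitrary: x y z)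
  case (Join a b)
  obtain x1 x2 where x: "x = x1 \<bowtie> x2" "shape x1 = a" "shape x2 = b"
    using Join.prems(1) by (rule shape_JoinE)
  obtain y1 y2 where y: "y = y1 \<bowtie> y2" "shape y1 = a" "shape y2 = b"
    using Join.prems(2) by (rule shape_JoinE)
  obtain z1 z2 where z: "z = z1 \<bowtie> z2" "shape z1 = a" "shape z2 = b"
    using Join.prems(3) by (rule shape_JoinE)
  from x y z show ?case using Join.IH(1)[of x1 y1 z1] Join.IH(2)[of x2 y2 z2] Join.prems(4) by simp
qed auto

context module
begin

lemma pscale_padd: "shape x = c \<Longrightarrow> shape y = c \<Longrightarrow>
    pscale scale t (padd x y) = padd (pscale scale t x) (pscale scale t y)"
proof (induction c arbitrary: x y)
  case (Join a b)
  then show ?case by (elim shape_JoinE) simp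
qed (auto simp: scale_right_distrib algebra_simps)

lemma pscale_pscale: "pscale scale s (pscale scale t x) = pscale scale (s * t) x"
  by (induction x) (auto simp: mult.assoc)

lemma pscale_one [simp]: "pscale scale 1 x = x"
  by (induction x) auto

lemma pscale_pzero [simp]: "pscale scale t (pzero x) = pzero x"
  by (induction x) auto

text \<open>\<open>t dvd 1\<close> says that \<open>t\<close> is invertible, and multiplying by its
  inverse removes it. At units the slope equation therefore determines the slope.\<close>

lemma unit_cancel:
  assumes "shape x = c" "shape y = c" "shape z = c" "t dvd 1"
    and "padd x (pscale scale t y) = padd x (pscale scale t z)"
  shows "y = z"
proof -
  obtain r where r: "1 = t * r" using assms(4) by (elim dvdE)
  have "pscale scale t y = pscale scale t z"
    using padd_left_cancel[of x c "pscale scale t y" "pscale scale t z"] assms by simp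
  then have "pscale scale (r * t) y = pscale scale (r * t) z" by (metis pscale_pscale)
  then show ?thesis using r by (simp add: mult.commute)
qed

end

lemma ext1_iff: "x \<bowtie> v \<bowtie> Scal t \<in> ext1 sc X \<longleftrightarrow>
    x \<in> X \<and> shape v = shape x \<and> padd x (pscale sc t v) \<in> X"
  by (auto simp: ext1_def)

lemma ext1E:
  assumes "z \<in> ext1 sc X"
  obtains x v t where "z = x \<bowtie> v \<bowtie> Scal t" "x \<in> X" "shape v = shape x" "padd x (pscale sc t v) \<in> X"
  using assms by (auto simp: ext1_def)

lemma typed_dq: "typed p a b \<Longrightarrow> typed (dq p) (a \<bowtie> a \<bowtie> Scal ()) b"
  by (induction rule: typed.induct; (simp only: dq.simps)?; (assumption | rule typed.intros)+)

text \<open>A division-free difference quotient for tree-valued maps: in contrast to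
  \<open>is_slope\<close>, the equation is demanded at every scalar, non-units included, so it can
  be composed with polynomial maps directly. The shape condition keeps \<open>padd\<close>
  meaningful.\<close>

definition slope_of :: "('k::{comm_ring_1, topological_space} \<Rightarrow> 'v::{plus, topological_space} \<Rightarrow> 'v) \<Rightarrow>
    ('k \<Rightarrow> 'w::{plus, topological_space} \<Rightarrow> 'w) \<Rightarrow> ('v, 'k) pt set \<Rightarrow>
    (('v, 'k) pt \<Rightarrow> ('w, 'k) pt) \<Rightarrow> (('v, 'k) pt \<Rightarrow> ('w, 'k) pt) \<Rightarrow> bool" where
  "slope_of scV scW X F G \<longleftrightarrow> continuous_on X F \<and> continuous_on (ext1 scV X) G \<and>
     (\<forall>x v t. x \<bowtie> v \<bowtie> Scal t \<in> ext1 scV X \<longrightarrow>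
        shape (G (x \<bowtie> v \<bowtie> Scal t)) = shape (F x) \<and>
        F (padd x (pscale scV t v)) = padd (F x) (pscale scW t (G (x \<bowtie> v \<bowtie> Scal t))))"

lemma slope_ofI:
  assumes "continuous_on X F" "continuous_on (ext1 scV X) G"
    and "\<And>x v t. x \<in> X \<Longrightarrow> shape v = shape x \<Longrightarrow> padd x (pscale scV t v) \<in> X \<Longrightarrow>
        shape (G (x \<bowtie> v \<bowtie> Scal t)) = shape (F x) \<and>
        F (padd x (pscale scV t v)) = padd (F x) (pscale scW t (G (x \<bowtie> v \<bowtie> Scal t)))"
  shows "slope_of scV scW X F G"
  using assms unfolding slope_of_def ext1_iff by blast

lemma slope_ofD:
  assumes "slope_of scV scW X F G"
  shows "continuous_on X F" "continuous_on (ext1 scV X) G"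
    and "x \<in> X \<Longrightarrow> shape v = shape x \<Longrightarrow> padd x (pscale scV t v) \<in> X \<Longrightarrow>
        shape (G (x \<bowtie> v \<bowtie> Scal t)) = shape (F x)"
    and "x \<in> X \<Longrightarrow> shape v = shape x \<Longrightarrow> padd x (pscale scV t v) \<in> X \<Longrightarrow>
        F (padd x (pscale scV t v)) = padd (F x) (pscale scW t (G (x \<bowtie> v \<bowtie> Scal t)))"
  using assms unfolding slope_of_def ext1_iff by blast+

context topological_module
begin

lemma continuous_on_line:
  assumes "shape v = shape x"
  shows "continuous_on S (\<lambda>t. padd x (pscale scale t v))"
  by (rule continuous_on_padd[where a = "shape x"])
    (use assms in \<open>auto intro: continuous_on_pscale[where a = "shape x"] continuous_on_const continuous_on_id\<close>)

lemma open_line: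
  assumes "open X" "shape v = shape x"
  shows "open {t. padd x (pscale scale t v) \<in> X}"
  using continuous_on_line[OF assms(2), of UNIV] assms(1)
  unfolding continuous_on_open_vimage[OF open_UNIV] vimage_def by auto

text \<open>Among the trees of the right shape, \<open>ext1 scale X\<close> is cut out by two
  continuous maps into the module of \<open>X\<close>: the projection to \<open>x\<close> and the
  polynomial map \<open>?p\<close> with value \<open>x + t v\<close>.\<close>

lemma open_ext1:
  assumes "open X" "X \<subseteq> {x. shape x = a}"
  shows "open (ext1 scale X)"
proof -
  let ?E = "{z :: ('a, 'k) pt. shape z = a \<bowtie> a \<bowtie> Scal ()}"
  let ?p = "PFst +\<^sub>p (PSnd \<odot>\<^sub>p PSnd) *\<^sub>p (PFst \<odot>\<^sub>p PSnd)"
  have "typed ?p (a \<bowtie> a \<bowtie> Scal ()) a" by (rule typed.intros)+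
  then have c: "continuous_on ?E (ev scale ?p)" by (rule continuous_on_ev) (auto intro: continuous_on_id)
  have c1: "continuous_on ?E pfst"
    by (rule continuous_on_pfst[OF continuous_on_id]) (auto elim: shape_JoinE)
  have "open (ev scale ?p -` X \<inter> ?E)" "open (pfst -` X \<inter> ?E)"
    using c c1 assms(1) unfolding continuous_on_open_vimage[OF open_shape] by blast+
  moreover have "ext1 scale X = (ev scale ?p -` X \<inter> ?E) \<inter> (pfst -` X \<inter> ?E)"
    using assms(2) by (auto simp: ext1_def elim!: shape_JoinE shape_ScalE)
  ultimately show ?thesis by (simp only: open_Int)
qed

end

lemma shape_ext1: "X \<subseteq> {x. shape x = a} \<Longrightarrow> ext1 sc X \<subseteq> {x. shape x = a \<bowtie> a \<bowtie> Scal ()}"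
  by (auto simp: ext1_def)

lemma ev_lift1 [simp]: "ev sc (lift1 p) (x \<bowtie> v \<bowtie> r) = ev sc p x \<bowtie> ev sc (dq p) (x \<bowtie> v \<bowtie> r) \<bowtie> r"
  by (simp add: lift1_def)

lemma typed_lift1: "typed p a b \<Longrightarrow> typed (lift1 p) (a \<bowtie> a \<bowtie> Scal ()) (b \<bowtie> b \<bowtie> Scal ())"
  unfolding lift1_def by (rule typed.intros typed_dq | assumption)+

text \<open>By \<open>ev_dq\<close>, \<open>p\<close> takes \<open>x + t v\<close> to
  \<open>p x + t * dq p (x, v, t)\<close>, so the second membership condition of \<open>ext1\<close>
  passes from \<open>X\<close> to \<open>Y\<close>.\<close>

lemma ev_lift1_ext1:
  assumes "module sc" "typed p a b" "X \<subseteq> {x. shape x = a}" "\<And>x. x \<in> X \<Longrightarrow> ev sc p x \<in> Y" "z \<in> ext1 sc X"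
  shows "ev sc (lift1 p) z \<in> ext1 sc Y"
proof -
  obtain x v t where z: "z = x \<bowtie> v \<bowtie> Scal t" "x \<in> X" "shape v = shape x" "padd x (pscale sc t v) \<in> X"
    using assms(5) by (rule ext1E)
  have sh: "shape x = a" using z assms(3) by auto
  show ?thesis
    using ev_dq[OF assms(1,2) sh, of v t] z sh assms(4)[of x] assms(4)[of "padd x (pscale sc t v)"]
    by (simp add: ext1_iff)
qed

text \<open>The linear map that forgets the \<open>V\<close>-coordinates; it carries scalars from trees over \<open>V\<close> to
  trees over \<open>W\<close>.\<close>

definition recast :: "('v, 'k) pt \<Rightarrow> ('w::zero, 'k) pt" where
  "recast = map_pt (\<lambda>_. 0) (\<lambda>t. t)"

lemma recast_simps [simp]:
  "recast (Vec a) = Vec 0" "recast (Scal t) = Scal t" "recast (x \<bowtie> y) = recast x \<bowtie> recast y"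
  by (simp_all add: recast_def)

lemma shape_recast [simp]: "shape (recast x) = shape x"
  by (induction x) auto

lemma recast_padd: "shape x = c \<Longrightarrow> shape y = c \<Longrightarrow>
    (recast (padd x y) :: ('w::monoid_add, 'k::plus) pt) = padd (recast x) (recast y)"
proof (induction c arbitrary: x y)
  case (Join a b)
  then show ?case by (elim shape_JoinE) simp
qed auto

lemma recast_pscale: "module sc' \<Longrightarrow> recast (pscale sc t x) = pscale sc' t (recast x)"
  by (induction x) (auto simp: module.scale_zero_right)

lemma continuous_on_recast:
  "continuous_on S f \<Longrightarrow> (\<And>x. x \<in> S \<Longrightarrow> shape (f x) = a) \<Longrightarrow>
    continuous_on S (\<lambda>x. recast (f x) :: ('w::{zero, topological_space}, 'k::topological_space) pt)"
proof (induction a arbitrary: f)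
  case (Vec u)
  have "continuous_on S (\<lambda>x. Vec 0 :: ('w, 'k) pt)" by (rule continuous_on_const)
  moreover have "Vec 0 = (recast (f x) :: ('w, 'k) pt)" if "x \<in> S" for x
    using Vec(2)[OF that] by auto
  ultimately show ?case by (simp cong: continuous_on_cong)
next
  case (Scal u)
  have R: "f x \<in> range Scal" if "x \<in> S" for x
    using Scal(2)[OF that] by auto
  have "continuous_on S (\<lambda>x. Scal (the_scal (f x)) :: ('w, 'k) pt)"
    using Scal(1) R by (intro continuous_on_Scal continuous_on_the_scal)
  moreover have "Scal (the_scal (f x)) = (recast (f x) :: ('w, 'k) pt)" if "x \<in> S" for x
    using R[OF that] by auto
  ultimately show ?case by (simp cong: continuous_on_cong)
next
  case (Join a b)
  have F: "\<exists>y z. f x = y \<bowtie> z" "shape (pfst (f x)) = a" "shape (psnd (f x)) = b" if "x \<in> S" for x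
    using Join.prems(2)[OF that] by (auto elim: shape_JoinE)
  have "continuous_on S (\<lambda>x. recast (pfst (f x)) \<bowtie> recast (psnd (f x)) :: ('w, 'k) pt)"
    by (intro continuous_on_Join Join.IH continuous_on_pfst continuous_on_psnd Join.prems(1) F)
  moreover have "recast (pfst (f x)) \<bowtie> recast (psnd (f x)) = (recast (f x) :: ('w, 'k) pt)"
    if "x \<in> S" for x
    using F(1)[OF that] by auto
  ultimately show ?case by (simp cong: continuous_on_cong)
qed

section \<open>Density of units: uniqueness and algebraic rules for slopes\<close>

locale dense_modules = V: topological_module scV + W: topological_module scW
  for scV :: "'k::{comm_ring_1, topological_ab_group_add, topological_semigroup_mult, t2_space} \<Rightarrow>
      'v::{topological_ab_group_add, t2_space} \<Rightarrow> 'v"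
    and scW :: "'k \<Rightarrow> 'w::{topological_ab_group_add, t2_space} \<Rightarrow> 'w" +
  assumes dense: "closure {t::'k. t dvd 1} = UNIV"
begin

text \<open>If \<open>g\<close> and \<open>h\<close> differ at \<open>t\<close>, they take values in
  disjoint open sets on a whole neighbourhood of \<open>t\<close>, and that neighbourhood contains a
  unit. Every later appeal to density goes through this lemma.\<close>

lemma dense_eq:
  fixes g h :: "'k \<Rightarrow> 'c::t2_space"
  assumes "open T" "continuous_on T g" "continuous_on T h"
    and eq: "\<And>t. t \<in> T \<Longrightarrow> t dvd 1 \<Longrightarrow> g t = h t" and "t \<in> T"
  shows "g t = h t"
proof (rule ccontr)
  assume "g t \<noteq> h t"
  from hausdorff[OF this] obtain A B where AB: "open A" "open B" "g t \<in> A" "h t \<in> B" "A \<inter> B = {}"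
    by blast
  have "open (g -` A \<inter> T)" "open (h -` B \<inter> T)"
    using assms(2,3) AB(1,2) unfolding continuous_on_open_vimage[OF assms(1)] by blast+
  then have "open ((g -` A \<inter> T) \<inter> (h -` B \<inter> T))" by (rule open_Int)
  moreover have "t \<in> (g -` A \<inter> T) \<inter> (h -` B \<inter> T)" using AB(3,4) assms(5) by simp
  ultimately obtain u where "u dvd 1" "u \<in> (g -` A \<inter> T) \<inter> (h -` B \<inter> T)"
    using open_Int_closure_eq_empty[of "(g -` A \<inter> T) \<inter> (h -` B \<inter> T)" "{t. t dvd 1}"]
    unfolding dense by blast
  then show False using eq[of u] AB(5) by auto
qed

lemma continuous_on_line_slope:
  assumes "continuous_on (ext1 scV X) g" "x \<in> X" "shape v = shape x"
  shows "continuous_on {t. padd x (pscale scV t v) \<in> X} (\<lambda>t. g (x \<bowtie> v \<bowtie> Scal t))"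
  by (rule continuous_on_compose2[OF assms(1)])
    (use assms in \<open>auto simp: ext1_iff intro!: continuous_intros\<close>)

lemma continuous_on_slope_line:
  assumes "slope_of scV scW X F G" "x \<in> X" "shape v = shape x"
  shows "continuous_on {t. padd x (pscale scV t v) \<in> X} (\<lambda>t. G (x \<bowtie> v \<bowtie> Scal t))"
  by (rule continuous_on_line_slope[OF slope_ofD(2)[OF assms(1)] assms(2,3)])

text \<open>Density is used only along the line with fixed \<open>x\<close> and \<open>v\<close>:
  the scalars \<open>t\<close> with \<open>x + t v\<close> in \<open>X\<close> form an open set, and
  at the units among them \<open>unit_cancel\<close> identifies the two slopes.\<close>

lemma slope_unique:
  assumes G: "slope_of scV scW X F G" and G': "slope_of scV scW X F' G'"
    and eq: "\<And>x. x \<in> X \<Longrightarrow> F x = F' x" and X: "open X" and z: "z \<in> ext1 scV X"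
  shows "G z = G' z"
proof -
  obtain x v t where *: "z = x \<bowtie> v \<bowtie> Scal t" "x \<in> X" "shape v = shape x" "padd x (pscale scV t v) \<in> X"
    using z by (rule ext1E)
  have "G (x \<bowtie> v \<bowtie> Scal u) = G' (x \<bowtie> v \<bowtie> Scal u)"
    if u: "u \<in> {t. padd x (pscale scV t v) \<in> X}" "u dvd 1" for u
  proof (rule W.unit_cancel[OF _ _ _ u(2)])
    have u': "padd x (pscale scV u v) \<in> X" using u by simp
    show "shape (F x) = shape (F x)" ..
    show "shape (G (x \<bowtie> v \<bowtie> Scal u)) = shape (F x)" by (rule slope_ofD(3)[OF G *(2,3) u'])
    show "shape (G' (x \<bowtie> v \<bowtie> Scal u)) = shape (F x)"
      using slope_ofD(3)[OF G' *(2,3) u'] eq[OF *(2)] by simp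
    show "padd (F x) (pscale scW u (G (x \<bowtie> v \<bowtie> Scal u))) =
        padd (F x) (pscale scW u (G' (x \<bowtie> v \<bowtie> Scal u)))"
      using slope_ofD(4)[OF G *(2,3) u'] slope_ofD(4)[OF G' *(2,3) u'] eq[OF *(2)] eq[OF u'] by simp
  qed
  from dense_eq[OF V.open_line[OF X *(3)] continuous_on_slope_line[OF G *(2,3)]
      continuous_on_slope_line[OF G' *(2,3)] this, of t] show ?thesis using * by simp
qed

text \<open>For a unit \<open>t\<close> this is the telescoping of
  \<open>F (x + t (v + v')) - F x\<close> through \<open>x + t v\<close>. It becomes compatibility
  with the product of \<open>edge1\<close>: the second term starts at the target of the first
  arrow.\<close>

lemma slope_add:
  assumes G: "slope_of scV scW X F G" and X: "open X" and x: "x \<in> X"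
    and v: "shape v = shape x" "padd x (pscale scV t v) \<in> X"
    and v': "shape v' = shape x" "padd (padd x (pscale scV t v)) (pscale scV t v') \<in> X"
    and sh: "\<And>x. x \<in> X \<Longrightarrow> shape (F x) = b"
  shows "G (x \<bowtie> padd v v' \<bowtie> Scal t) =
    padd (G (x \<bowtie> v \<bowtie> Scal t)) (G (padd x (pscale scV t v) \<bowtie> v' \<bowtie> Scal t))"
proof -
  let ?y = "\<lambda>t. padd x (pscale scV t v)"
  \<comment> \<open>The scalars for which the intermediate and the final point both stay in
    \<open>X\<close>; each condition is open because it concerns a line in \<open>t\<close>.\<close>
  let ?T = "{t. ?y t \<in> X} \<inter> {t. padd x (pscale scV t (padd v v')) \<in> X}"
  have yv': "padd (?y s) (pscale scV s v') = padd x (pscale scV s (padd v v'))" for s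
    using V.pscale_padd[of v "shape x" v' s] padd_assoc[of x "shape x" "pscale scV s v" "pscale scV s v'"]
      v(1) v'(1) by simp
  have shy: "shape (?y s) = shape x" for s using v by simp
  have shv: "shape (padd v v') = shape x" using v v' by simp
  have T: "open ?T" by (intro open_Int V.open_line X v(1) shv)
  have c1: "continuous_on ?T (\<lambda>t. G (x \<bowtie> padd v v' \<bowtie> Scal t))"
    by (rule continuous_on_subset[OF continuous_on_slope_line[OF G x shv]]) auto
  have c2: "continuous_on ?T (\<lambda>t. G (x \<bowtie> v \<bowtie> Scal t))"
    by (rule continuous_on_subset[OF continuous_on_slope_line[OF G x v(1)]]) auto
  have c3: "continuous_on ?T (\<lambda>t. G (?y t \<bowtie> v' \<bowtie> Scal t))"
    by (rule continuous_on_compose2[OF slope_ofD(2)[OF G]])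
      (use v v' shy yv' in \<open>auto simp: ext1_iff intro!: continuous_intros V.continuous_on_line\<close>)
  have s2: "shape (G (x \<bowtie> v \<bowtie> Scal s)) = b" and s3: "shape (G (?y s \<bowtie> v' \<bowtie> Scal s)) = b"
    and s1: "shape (G (x \<bowtie> padd v v' \<bowtie> Scal s)) = b" if "s \<in> ?T" for s
  proof -
    show "shape (G (x \<bowtie> v \<bowtie> Scal s)) = b"
      using slope_ofD(3)[OF G x v(1), of s] sh[OF x] that by simp
    show "shape (G (x \<bowtie> padd v v' \<bowtie> Scal s)) = b"
      using slope_ofD(3)[OF G x shv, of s] sh[OF x] that by simp
    show "shape (G (?y s \<bowtie> v' \<bowtie> Scal s)) = b"
      using slope_ofD(3)[OF G, of "?y s" v' s] sh[of "?y s"] that shy yv' v' by simp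
  qed
  have c4: "continuous_on ?T (\<lambda>t. padd (G (x \<bowtie> v \<bowtie> Scal t)) (G (?y t \<bowtie> v' \<bowtie> Scal t)))"
    by (rule continuous_on_padd[OF c2 c3 s2 s3])
  have "G (x \<bowtie> padd v v' \<bowtie> Scal u) = padd (G (x \<bowtie> v \<bowtie> Scal u)) (G (?y u \<bowtie> v' \<bowtie> Scal u))"
    if u: "u \<in> ?T" "u dvd 1" for u
  proof (rule W.unit_cancel[OF sh[OF x] s1[OF u(1)] _ u(2)])
    show "shape (padd (G (x \<bowtie> v \<bowtie> Scal u)) (G (?y u \<bowtie> v' \<bowtie> Scal u))) = b"
      using s2[OF u(1)] s3[OF u(1)] by simp
    have "padd (F x) (pscale scW u (G (x \<bowtie> padd v v' \<bowtie> Scal u))) = F (padd (?y u) (pscale scV u v'))"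
      using slope_ofD(4)[OF G x shv, of u] u yv' by simp
    also have "\<dots> = padd (F (?y u)) (pscale scW u (G (?y u \<bowtie> v' \<bowtie> Scal u)))"
      using slope_ofD(4)[OF G, of "?y u" v' u] u yv' shy v' by simp
    also have "F (?y u) = padd (F x) (pscale scW u (G (x \<bowtie> v \<bowtie> Scal u)))"
      using slope_ofD(4)[OF G x v(1), of u] u by simp
    finally show "padd (F x) (pscale scW u (G (x \<bowtie> padd v v' \<bowtie> Scal u))) =
        padd (F x) (pscale scW u (padd (G (x \<bowtie> v \<bowtie> Scal u)) (G (?y u \<bowtie> v' \<bowtie> Scal u))))"
      using W.pscale_padd[OF s2[OF u(1)] s3[OF u(1)]] sh[OF x] s2[OF u(1)] s3[OF u(1)]
      by (simp add: padd_assoc[where c = b])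
  qed
  from dense_eq[OF T c1 c4 this, of t] show ?thesis using v v' yv' by simp
qed

lemma slope_zero:
  assumes G: "slope_of scV scW X F G" and X: "open X" and x: "x \<in> X"
  shows "G (x \<bowtie> pzero x \<bowtie> Scal t) = pzero (F x)"
proof -
  let ?T = "{t. padd x (pscale scV t (pzero x)) \<in> X}"
  have shz: "shape (pzero x) = shape x" by simp
  have in_X: "padd x (pscale scV u (pzero x)) \<in> X" for u using x by simp
  have "G (x \<bowtie> pzero x \<bowtie> Scal u) = pzero (F x)" if u: "u \<in> ?T" "u dvd 1" for u
  proof (rule W.unit_cancel[OF refl _ _ u(2)])
    show "shape (G (x \<bowtie> pzero x \<bowtie> Scal u)) = shape (F x)" by (rule slope_ofD(3)[OF G x shz in_X])
    show "padd (F x) (pscale scW u (G (x \<bowtie> pzero x \<bowtie> Scal u))) =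
        padd (F x) (pscale scW u (pzero (F x)))"
      using slope_ofD(4)[OF G x shz in_X, of u] by simp
  qed simp
  from dense_eq[OF V.open_line[OF X shz] continuous_on_slope_line[OF G x shz] continuous_on_const this, of t]
  show ?thesis using in_X by simp
qed

text \<open>Both sides describe the change of \<open>F\<close> from \<open>x\<close> to
  \<open>x + s t v\<close>. Only \<open>t\<close> is taken to be a unit in the comparison, so
  \<open>s\<close> is arbitrary. This becomes compatibility with the primed directions.\<close>

lemma slope_scale:
  assumes G: "slope_of scV scW X F G" and X: "open X" and x: "x \<in> X"
    and v: "shape v = shape x" "padd x (pscale scV (s * t) v) \<in> X"
  shows "G (x \<bowtie> pscale scV s v \<bowtie> Scal t) = pscale scW s (G (x \<bowtie> v \<bowtie> Scal (s * t)))"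
proof -
  let ?w = "pscale scV s v"
  let ?T = "{t. padd x (pscale scV t ?w) \<in> X}"
  have shw: "shape ?w = shape x" using v by simp
  have eq: "pscale scV u ?w = pscale scV (s * u) v" for u
    by (simp add: V.pscale_pscale mult.commute)
  have sh: "shape (G (x \<bowtie> v \<bowtie> Scal (s * u))) = shape (F x)" if "u \<in> ?T" for u
    using slope_ofD(3)[OF G x v(1)] that eq by simp
  have "continuous_on ?T (\<lambda>t. G (x \<bowtie> v \<bowtie> Scal (s * t)))"
    by (rule continuous_on_compose2[OF continuous_on_slope_line[OF G x v(1)], of _ "\<lambda>t. s * t"])
      (auto simp: eq intro: continuous_on_mult' continuous_on_const continuous_on_id)
  then have c: "continuous_on ?T (\<lambda>t. pscale scW s (G (x \<bowtie> v \<bowtie> Scal (s * t))))"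
    by (rule W.continuous_on_pscale[OF continuous_on_const _ sh])
  have "G (x \<bowtie> ?w \<bowtie> Scal u) = pscale scW s (G (x \<bowtie> v \<bowtie> Scal (s * u)))"
    if u: "u \<in> ?T" "u dvd 1" for u
  proof (rule W.unit_cancel[OF refl _ _ u(2)])
    have u': "padd x (pscale scV u ?w) \<in> X" using u by simp
    show "shape (G (x \<bowtie> ?w \<bowtie> Scal u)) = shape (F x)" by (rule slope_ofD(3)[OF G x shw u'])
    show "shape (pscale scW s (G (x \<bowtie> v \<bowtie> Scal (s * u)))) = shape (F x)" using sh u by simp
    have "padd (F x) (pscale scW u (G (x \<bowtie> ?w \<bowtie> Scal u))) = F (padd x (pscale scV (s * u) v))"
      using slope_ofD(4)[OF G x shw u'] eq by simp
    also have "\<dots> = padd (F x) (pscale scW (s * u) (G (x \<bowtie> v \<bowtie> Scal (s * u))))"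
      using slope_ofD(4)[OF G x v(1)] u eq by simp
    finally show "padd (F x) (pscale scW u (G (x \<bowtie> ?w \<bowtie> Scal u))) =
      padd (F x) (pscale scW u (pscale scW s (G (x \<bowtie> v \<bowtie> Scal (s * u)))))"
      by (simp add: W.pscale_pscale mult.commute)
  qed
  from dense_eq[OF V.open_line[OF X shw] continuous_on_slope_line[OF G x shw] c this, of t]
  show ?thesis using v eq by simp
qed

text \<open>Chain rule for an inner polynomial map: by \<open>ev_dq\<close>,
  \<open>p (x + t v)\<close> is \<open>p x + t w\<close> with \<open>w\<close> the value of
  \<open>dq p\<close>, and this is the line on which \<open>G\<close> is evaluated. The identity is
  exact at every \<open>t\<close>.\<close>

lemma slope_comp:
  assumes G: "slope_of scV scW Y F G" and p: "typed p a b" and X: "X \<subseteq> {x. shape x = a}"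
    and XY: "\<And>x. x \<in> X \<Longrightarrow> ev scV p x \<in> Y"
  shows "slope_of scV scW X (\<lambda>x. F (ev scV p x)) (\<lambda>z. G (ev scV (lift1 p) z))"
proof (rule slope_ofI)
  have ce: "continuous_on X (ev scV p)"
    by (rule V.continuous_on_ev[OF p continuous_on_id]) (use X in auto)
  show "continuous_on X (\<lambda>x. F (ev scV p x))"
    by (rule continuous_on_compose2[OF slope_ofD(1)[OF G] ce]) (use XY in auto)
  have "continuous_on (ext1 scV X) (ev scV (lift1 p))"
    by (rule V.continuous_on_ev[OF typed_lift1[OF p] continuous_on_id]) (use shape_ext1[OF X] in auto)
  then show "continuous_on (ext1 scV X) (\<lambda>z. G (ev scV (lift1 p) z))"
    by (rule continuous_on_compose2[OF slope_ofD(2)[OF G]])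
      (use ev_lift1_ext1[OF V.module_axioms p X XY] in auto)
next
  fix x v t assume x: "x \<in> X" "shape v = shape x" "padd x (pscale scV t v) \<in> X"
  have sh: "shape x = a" using subsetD[OF X x(1)] by simp
  have shv: "shape v = a" using x(2) sh by (rule trans)
  let ?d = "ev scV (dq p) (x \<bowtie> v \<bowtie> Scal t)"
  have e: "shape (ev scV p x) = b" "shape ?d = b"
      "ev scV p (padd x (pscale scV t v)) = padd (ev scV p x) (pscale scV t ?d)"
    using ev_dq[OF V.module_axioms p sh shv, of t] by blast+
  have "padd (ev scV p x) (pscale scV t ?d) \<in> Y" using XY[OF x(3)] e by simp
  then show "shape (G (ev scV (lift1 p) (x \<bowtie> v \<bowtie> Scal t))) = shape (F (ev scV p x)) \<and>
      F (ev scV p (padd x (pscale scV t v))) =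
      padd (F (ev scV p x)) (pscale scW t (G (ev scV (lift1 p) (x \<bowtie> v \<bowtie> Scal t))))"
    using slope_ofD(3,4)[OF G XY[OF x(1)], of ?d t] e by simp
qed

text \<open>Chain rule for an outer polynomial map: \<open>ev_dq\<close> over \<open>W\<close> at
  the base point \<open>F x\<close> in the direction \<open>G z\<close>. The scalar is taken out and
  wrapped again because it passes from trees over \<open>V\<close> to trees over
  \<open>W\<close>.\<close>

lemma slope_post:
  assumes G: "slope_of scV scW X F G" and sh: "\<And>x. x \<in> X \<Longrightarrow> shape (F x) = b" and q: "typed q b c"
  shows "slope_of scV scW X (\<lambda>x. ev scW q (F x))
    (\<lambda>z. ev scW (dq q) (F (pfst z) \<bowtie> G z \<bowtie> Scal (the_scal (psnd (psnd z)))))"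
proof (rule slope_ofI)
  show "continuous_on X (\<lambda>x. ev scW q (F x))"
    by (rule W.continuous_on_ev[OF q slope_ofD(1)[OF G] sh])
  have cf: "continuous_on (ext1 scV X) pfst"
    by (rule continuous_on_pfst[OF continuous_on_id]) (auto simp: ext1_def)
  have cs: "continuous_on (ext1 scV X) (\<lambda>z. the_scal (psnd (psnd z)))"
    by (intro continuous_on_psnd continuous_on_the_scal continuous_on_id) (auto simp: ext1_def)
  have cF: "continuous_on (ext1 scV X) (\<lambda>z. F (pfst z))"
    by (rule continuous_on_compose2[OF slope_ofD(1)[OF G] cf]) (auto simp: ext1_def)
  show "continuous_on (ext1 scV X)
      (\<lambda>z. ev scW (dq q) (F (pfst z) \<bowtie> G z \<bowtie> Scal (the_scal (psnd (psnd z)))))"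
  proof (rule W.continuous_on_ev[OF typed_dq[OF q]])
    show "continuous_on (ext1 scV X) (\<lambda>z. F (pfst z) \<bowtie> G z \<bowtie> Scal (the_scal (psnd (psnd z))))"
      by (intro continuous_on_Join continuous_on_Scal cF cs slope_ofD(2)[OF G])
    fix z assume "z \<in> ext1 scV X"
    then obtain x v t where z: "z = x \<bowtie> v \<bowtie> Scal t" "x \<in> X" "shape v = shape x"
        "padd x (pscale scV t v) \<in> X"
      by (rule ext1E)
    then show "shape (F (pfst z) \<bowtie> G z \<bowtie> Scal (the_scal (psnd (psnd z)))) = b \<bowtie> b \<bowtie> Scal ()"
      using slope_ofD(3)[OF G z(2-4)] sh[OF z(2)] by simp
  qed
next
  fix x v t assume x: "x \<in> X" "shape v = shape x" "padd x (pscale scV t v) \<in> X"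
  show "shape (ev scW (dq q) (F (pfst (x \<bowtie> v \<bowtie> Scal t)) \<bowtie> G (x \<bowtie> v \<bowtie> Scal t) \<bowtie>
        Scal (the_scal (psnd (psnd (x \<bowtie> v \<bowtie> Scal t)))))) = shape (ev scW q (F x)) \<and>
      ev scW q (F (padd x (pscale scV t v))) = padd (ev scW q (F x)) (pscale scW t
        (ev scW (dq q) (F (pfst (x \<bowtie> v \<bowtie> Scal t)) \<bowtie> G (x \<bowtie> v \<bowtie> Scal t) \<bowtie>
        Scal (the_scal (psnd (psnd (x \<bowtie> v \<bowtie> Scal t)))))))"
    using ev_dq[OF W.module_axioms q sh[OF x(1)], of "G (x \<bowtie> v \<bowtie> Scal t)" t]
      slope_ofD(3,4)[OF G x] sh[OF x(1)] by simp
qed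

lemma slope_Join:
  assumes "slope_of scV scW X F G" "slope_of scV scW X F' G'"
  shows "slope_of scV scW X (\<lambda>x. F x \<bowtie> F' x) (\<lambda>z. G z \<bowtie> G' z)"
  by (rule slope_ofI)
    (use slope_ofD[OF assms(1)] slope_ofD[OF assms(2)] in \<open>auto intro: continuous_on_Join\<close>)

lemma slope_recast_ev:
  assumes p: "typed p a b" and X: "X \<subseteq> {x. shape x = a}"
  shows "slope_of scV scW X (\<lambda>x. recast (ev scV p x)) (\<lambda>z. recast (ev scV (dq p) z))"
proof (rule slope_ofI)
  show "continuous_on X (\<lambda>x. recast (ev scV p x) :: ('w, 'k) pt)"
    by (rule continuous_on_recast[OF V.continuous_on_ev[OF p continuous_on_id], where a = b])
      (use X V.shape_ev[OF p] in auto)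
  show "continuous_on (ext1 scV X) (\<lambda>z. recast (ev scV (dq p) z) :: ('w, 'k) pt)"
    by (rule continuous_on_recast[OF V.continuous_on_ev[OF typed_dq[OF p] continuous_on_id], where a = b])
      (use shape_ext1[OF X, of scV] V.shape_ev[OF typed_dq[OF p]] in auto)
  fix x v t assume x: "x \<in> X" "shape v = shape x" "padd x (pscale scV t v) \<in> X"
  have sh: "shape x = a" using subsetD[OF X x(1)] by simp
  have shv: "shape v = a" using x(2) sh by (rule trans)
  let ?d = "ev scV (dq p) (x \<bowtie> v \<bowtie> Scal t)"
  have e: "shape (ev scV p x) = b" "shape ?d = b"
      "ev scV p (padd x (pscale scV t v)) = padd (ev scV p x) (pscale scV t ?d)"
    using ev_dq[OF V.module_axioms p sh shv, of t] by blast+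
  then show "shape (recast ?d :: ('w, 'k) pt) = shape (recast (ev scV p x) :: ('w, 'k) pt) \<and>
      (recast (ev scV p (padd x (pscale scV t v))) :: ('w, 'k) pt) =
      padd (recast (ev scV p x)) (pscale scW t (recast ?d))"
    by (simp add: recast_padd[where c = b] recast_pscale[OF W.module_axioms])
qed

end

text \<open>The syntactic quotient is also a topological one; polynomial identities can therefore be
  differentiated by uniqueness of slopes.\<close>

lemma (in topological_module) slope_ev:
  assumes p: "typed p a b" and X: "X \<subseteq> {x. shape x = a}"
  shows "slope_of scale scale X (ev scale p) (ev scale (dq p))"
proof (rule slope_ofI)
  show "continuous_on X (ev scale p)"
    by (rule continuous_on_ev[OF p continuous_on_id]) (use X in auto)
  show "continuous_on (ext1 scale X) (ev scale (dq p))"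
    by (rule continuous_on_ev[OF typed_dq[OF p] continuous_on_id]) (use shape_ext1[OF X] in auto)
  fix x v t assume x: "x \<in> X" "shape v = shape x" "padd x (pscale scale t v) \<in> X"
  have sh: "shape x = a" using subsetD[OF X x(1)] by simp
  have shv: "shape v = a" using x(2) sh by (rule trans)
  then show "shape (ev scale (dq p) (x \<bowtie> v \<bowtie> Scal t)) = shape (ev scale p x) \<and>
      ev scale p (padd x (pscale scale t v)) =
      padd (ev scale p x) (pscale scale t (ev scale (dq p) (x \<bowtie> v \<bowtie> Scal t)))"
    using ev_dq[OF module_axioms p sh shv, of t] sh by simp
qed

text \<open>\<open>dq\<close> works on syntax, so equal values of \<open>p\<close> and
  \<open>q\<close> do not formally give equal quotients. They do over \<open>V\<close>, because both
  quotients are continuous slopes of one map on an open set.\<close>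

lemma (in dense_modules) dq_cong:
  assumes p: "typed p a b" and q: "typed q a b" and eq: "\<And>x. shape x = a \<Longrightarrow> ev scV p x = ev scV q x"
    and z: "shape z = a \<bowtie> a \<bowtie> Scal ()"
  shows "ev scV (dq p) z = ev scV (dq q) z"
proof -
  \<comment> \<open>\<open>V\<close> is both source and target module here, since the values of
    polynomial maps lie over \<open>V\<close> again.\<close>
  interpret VV: dense_modules scV scV
    using dense by unfold_locales
  let ?X = "{x :: ('v, 'k) pt. shape x = a}"
  obtain x v t where "z = x \<bowtie> v \<bowtie> Scal t" "shape x = a" "shape v = a"
    using z by (elim shape_JoinE shape_ScalE) blast
  then have "z \<in> ext1 scV ?X" by (simp add: ext1_iff)
  then show ?thesis
    using VV.slope_unique[OF V.slope_ev[OF p] V.slope_ev[OF q] _ open_shape \<open>z \<in> ext1 scV ?X\<close>] eq by simp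
qed

section \<open>Lifting functors of edge categories\<close>

text \<open>
  The composable pairs of a derived edge category do not form an open set, so the density of units
  cannot be applied to them directly. They are however the image of an open set under a polynomial
  retraction: \<open>\<Phi> (g', y)\<close> corrects the source of \<open>g'\<close> to \<open>y\<close>, as far as a polynomial can, and
  \<open>\<Psi> (g, y)\<close> corrects the target of \<open>g\<close> accordingly. Unlike composability itself, these
  identities pass to difference quotients.
\<close>

definition fix_left :: "pmap \<Rightarrow> poly_edge \<Rightarrow> pmap" where
  "fix_left \<Phi> e = \<Phi> \<odot>\<^sub>p (PFst \<bowtie>\<^sub>p etarget e \<odot>\<^sub>p PSnd)"

definition fix_right :: "pmap \<Rightarrow> pmap \<Rightarrow> poly_edge \<Rightarrow> pmap" where
  "fix_right \<Phi> \<Psi> e = \<Psi> \<odot>\<^sub>p (PSnd \<bowtie>\<^sub>p esource e \<odot>\<^sub>p fix_left \<Phi> e)"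

definition typed_edge :: "poly_edge \<Rightarrow> shape \<Rightarrow> shape \<Rightarrow> bool" where
  "typed_edge e a b \<longleftrightarrow> typed (esource e) b a \<and> typed (etarget e) b a \<and> typed (eunit e) a b \<and>
     typed (emult e) (b \<bowtie> b) b"

text \<open>By the first two identities \<open>fix_left\<close> and \<open>fix_right\<close> return
  \<open>g'\<close> and \<open>g\<close> for a composable pair \<open>g' \<bowtie> g\<close>; by the
  third, the corrected pair is composable whatever \<open>z\<close> is. All three hold on whole
  shapes, hence on open sets.\<close>

definition retractable :: "('k::comm_ring_1 \<Rightarrow> 'v::ab_group_add \<Rightarrow> 'v) \<Rightarrow> poly_edge \<Rightarrow> shape \<Rightarrow> shape \<Rightarrow> bool" where
  "retractable sc e a b \<longleftrightarrow> (\<exists>\<Phi> \<Psi>. typed \<Phi> (b \<bowtie> a) b \<and> typed \<Psi> (b \<bowtie> a) b \<and>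
     (\<forall>g :: ('v, 'k) pt. shape g = b \<longrightarrow> ev sc \<Phi> (g \<bowtie> ev sc (esource e) g) = g) \<and>
     (\<forall>g :: ('v, 'k) pt. shape g = b \<longrightarrow> ev sc \<Psi> (g \<bowtie> ev sc (etarget e) g) = g) \<and>
     (\<forall>z :: ('v, 'k) pt. shape z = b \<bowtie> b \<longrightarrow>
        ev sc (etarget e) (ev sc (fix_right \<Phi> \<Psi> e) z) = ev sc (esource e) (ev sc (fix_left \<Phi> e) z)))"

text \<open>Besides functoriality it records that the structure maps over \<open>V\<close> respect
  the vertex sets, which \<open>edge_functor\<close> does not say. The lifting theorem uses these
  inclusions as hypotheses of the chain rule and reproduces them.\<close>

definition edge_fun :: "('k::comm_ring_1 \<Rightarrow> 'v::ab_group_add \<Rightarrow> 'v) \<Rightarrow> ('k \<Rightarrow> 'w::ab_group_add \<Rightarrow> 'w) \<Rightarrow>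
    poly_edge \<Rightarrow> ('v, 'k) pt set \<Rightarrow> ('v, 'k) pt set \<Rightarrow>
    (('v, 'k) pt \<Rightarrow> ('w, 'k) pt) \<Rightarrow> (('v, 'k) pt \<Rightarrow> ('w, 'k) pt) \<Rightarrow> bool" where
  "edge_fun scV scW e XA XB FA FB \<longleftrightarrow>
     (\<forall>g\<in>XB. ev scV (esource e) g \<in> XA \<and> FA (ev scV (esource e) g) = ev scW (esource e) (FB g)) \<and>
     (\<forall>g\<in>XB. ev scV (etarget e) g \<in> XA \<and> FA (ev scV (etarget e) g) = ev scW (etarget e) (FB g)) \<and>
     (\<forall>x\<in>XA. ev scV (eunit e) x \<in> XB \<and> FB (ev scV (eunit e) x) = ev scW (eunit e) (FA x)) \<and>
     (\<forall>g'\<in>XB. \<forall>g\<in>XB. ev scV (etarget e) g = ev scV (esource e) g' \<longrightarrow>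
        ev scV (emult e) (g' \<bowtie> g) \<in> XB \<and>
        FB (ev scV (emult e) (g' \<bowtie> g)) = ev scW (emult e) (FB g' \<bowtie> FB g))"

lemma typed_fix_left: "typed_edge e a b \<Longrightarrow> typed \<Phi> (b \<bowtie> a) b \<Longrightarrow> typed (fix_left \<Phi> e) (b \<bowtie> b) b"
  unfolding fix_left_def typed_edge_def by (elim conjE) ((assumption | rule typed.intros)+)

lemma typed_fix_right:
  "typed_edge e a b \<Longrightarrow> typed \<Phi> (b \<bowtie> a) b \<Longrightarrow> typed \<Psi> (b \<bowtie> a) b \<Longrightarrow>
    typed (fix_right \<Phi> \<Psi> e) (b \<bowtie> b) b"
  using typed_fix_left[of e a b \<Phi>] unfolding fix_right_def typed_edge_def
  by (elim conjE) ((assumption | rule typed.intros)+, blast+)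

text \<open>A way of lifting polynomial maps (\<open>L\<close>), pairs (\<open>S\<close>), shapes (\<open>sh\<close>), open sets (\<open>D\<close>), and maps of
  class \<open>C\<^sup>1\<close>, where \<open>R X F F'\<close> says that \<open>F'\<close> is a lift of \<open>F\<close>.\<close>

locale lifting = dense_modules scV scW
  for scV :: "'k::{comm_ring_1, topological_ab_group_add, topological_semigroup_mult, t2_space} \<Rightarrow>
      'v::{topological_ab_group_add, t2_space} \<Rightarrow> 'v"
    and scW :: "'k \<Rightarrow> 'w::{topological_ab_group_add, t2_space} \<Rightarrow> 'w" +
  fixes L :: "pmap \<Rightarrow> pmap" and S :: pmap and sh :: "shape \<Rightarrow> shape"
    and D :: "('v, 'k) pt set \<Rightarrow> ('v, 'k) pt set"
    and R :: "('v, 'k) pt set \<Rightarrow> (('v, 'k) pt \<Rightarrow> ('w, 'k) pt) \<Rightarrow> (('v, 'k) pt \<Rightarrow> ('w, 'k) pt) \<Rightarrow> bool"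
  assumes typed_L: "typed p a b \<Longrightarrow> typed (L p) (sh a) (sh b)"
    and L_comp: "typed q a b \<Longrightarrow> typed p b c \<Longrightarrow> shape z = sh a \<Longrightarrow>
      ev scV (L (p \<odot>\<^sub>p q)) z = ev scV (L p) (ev scV (L q) z)"
    and L_Id: "shape z = sh a \<Longrightarrow> ev scV (L PId) z = z"
    and L_cong: "typed p a b \<Longrightarrow> typed q a b \<Longrightarrow> (\<And>x. shape x = a \<Longrightarrow> ev scV p x = ev scV q x) \<Longrightarrow>
      shape z = sh a \<Longrightarrow> ev scV (L p) z = ev scV (L q) z"
    and typed_S: "typed S (sh a \<bowtie> sh b) (sh (a \<bowtie> b))"
    and S_L: "typed p a b \<Longrightarrow> typed q a c \<Longrightarrow> shape z = sh a \<Longrightarrow>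
      ev scV S (ev scV (L p) z \<bowtie> ev scV (L q) z) = ev scV (L (p \<bowtie>\<^sub>p q)) z"
    and L_snd: "shape g' = sh a \<Longrightarrow> shape g = sh b \<Longrightarrow> ev scV (L PSnd) (ev scV S (g' \<bowtie> g)) = g"
    and S_fst: "shape g' = sh a \<Longrightarrow> shape g = sh b \<Longrightarrow> shape h = sh c \<Longrightarrow>
      ev scV S (ev scV (L PFst) (ev scV S (g' \<bowtie> g)) \<bowtie> h) = ev scV S (g' \<bowtie> h)"
    and D_shape: "X \<subseteq> {x. shape x = a} \<Longrightarrow> D X \<subseteq> {z. shape z = sh a}"
    and D_L: "typed p a b \<Longrightarrow> X \<subseteq> {x. shape x = a} \<Longrightarrow> (\<And>x. x \<in> X \<Longrightarrow> ev scV p x \<in> Y) \<Longrightarrow> z \<in> D X \<Longrightarrow>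
      ev scV (L p) z \<in> D Y"
    and D_vimage: "typed p a b \<Longrightarrow> typed q a c \<Longrightarrow> shape z = sh a \<Longrightarrow> ev scV (L p) z \<in> D Y \<Longrightarrow>
      ev scV (L q) z \<in> D Y' \<Longrightarrow> z \<in> D {x. shape x = a \<and> ev scV p x \<in> Y \<and> ev scV q x \<in> Y'}"
    and R_comp: "R Y F F' \<Longrightarrow> typed p a b \<Longrightarrow> X \<subseteq> {x. shape x = a} \<Longrightarrow> (\<And>x. x \<in> X \<Longrightarrow> ev scV p x \<in> Y) \<Longrightarrow>
      R X (\<lambda>x. F (ev scV p x)) (\<lambda>z. F' (ev scV (L p) z))"
    and R_post: "R X F F' \<Longrightarrow> (\<And>x. x \<in> X \<Longrightarrow> shape (F x) = b) \<Longrightarrow> typed q b c \<Longrightarrow>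
      R X (\<lambda>x. ev scW q (F x)) (\<lambda>z. ev scW (L q) (F' z))"
    and R_Join: "R X F F' \<Longrightarrow> R X G G' \<Longrightarrow> R X (\<lambda>x. F x \<bowtie> G x) (\<lambda>z. ev scW S (F' z \<bowtie> G' z))"
    and R_unique: "R X F F' \<Longrightarrow> R X G G' \<Longrightarrow> open X \<Longrightarrow> (\<And>x. x \<in> X \<Longrightarrow> F x = G x) \<Longrightarrow> z \<in> D X \<Longrightarrow>
      F' z = G' z"
begin

lemma typed_lift_edge:
  assumes "typed_edge e a b"
  shows "typed_edge (lift_edge L S e) (sh a) (sh b)"
  using assms unfolding typed_edge_def lift_edge_def poly_edge.simps
  by (auto intro: typed_L typed_S typed.intros(9)[OF typed_S])

text \<open>In the intended instances the shuffle takes the new scalars from \<open>g\<close>, so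
  \<open>L PFst\<close> recovers \<open>g'\<close> from the shuffled pair only up to these scalars.
  \<open>S_fst\<close> closes the gap: \<open>S\<close> ignores the scalars in its first
  slot.\<close>

lemma S_target:
  assumes e: "typed_edge e a b" and g: "shape g' = sh b" "shape g = sh b"
  shows "ev scV S (g' \<bowtie> ev scV (L (etarget e)) g) =
    ev scV (L (PFst \<bowtie>\<^sub>p etarget e \<odot>\<^sub>p PSnd)) (ev scV S (g' \<bowtie> g))"
proof -
  let ?Z = "ev scV S (g' \<bowtie> g)"
  have t: "typed (etarget e) b a" using e by (simp add: typed_edge_def)
  have Z: "shape ?Z = sh (b \<bowtie> b)" by (rule V.shape_ev[OF typed_S]) (use g in simp)
  have "ev scV (L (PFst \<bowtie>\<^sub>p etarget e \<odot>\<^sub>p PSnd)) ?Z =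
      ev scV S (ev scV (L PFst) ?Z \<bowtie> ev scV (L (etarget e \<odot>\<^sub>p PSnd)) ?Z)"
    by (rule S_L[symmetric, OF typed.intros(2) typed.intros(9)[OF typed.intros(3) t] Z])
  also have "ev scV (L (etarget e \<odot>\<^sub>p PSnd)) ?Z = ev scV (L (etarget e)) g"
    using L_comp[OF typed.intros(3) t Z] L_snd[OF g] by simp
  also have "ev scV S (ev scV (L PFst) ?Z \<bowtie> ev scV (L (etarget e)) g) = ev scV S (g' \<bowtie> ev scV (L (etarget e)) g)"
    by (rule S_fst[OF g V.shape_ev[OF typed_L[OF t] g(2)]])
  finally show ?thesis by simp
qed

text \<open>Correcting a pair for the lifted edge, with \<open>L \<Phi>\<close> for
  \<open>\<Phi>\<close>, is the lift of the correction. With \<open>fix_right_lift\<close> this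
  reduces claims about the lifted edge to polynomial identities for \<open>e\<close> pushed through
  \<open>L\<close>.\<close>

lemma fix_left_lift:
  assumes e: "typed_edge e a b" and \<Phi>: "typed \<Phi> (b \<bowtie> a) b" and g: "shape g' = sh b" "shape g = sh b"
  shows "ev scV (fix_left (L \<Phi> \<odot>\<^sub>p S) (lift_edge L S e)) (g' \<bowtie> g) =
    ev scV (L (fix_left \<Phi> e)) (ev scV S (g' \<bowtie> g))"
proof -
  let ?Z = "ev scV S (g' \<bowtie> g)"
  have t: "typed (etarget e) b a" using e by (simp add: typed_edge_def)
  have Z: "shape ?Z = sh (b \<bowtie> b)" by (rule V.shape_ev[OF typed_S]) (use g in simp)
  have tq: "typed (PFst \<bowtie>\<^sub>p etarget e \<odot>\<^sub>p PSnd) (b \<bowtie> b) (b \<bowtie> a)"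
    by (rule typed.intros t)+
  show ?thesis
    using L_comp[OF tq \<Phi> Z] S_target[OF e g] by (simp add: fix_left_def lift_edge_def)
qed

lemma fix_right_lift:
  assumes e: "typed_edge e a b" and \<Phi>: "typed \<Phi> (b \<bowtie> a) b" and \<Psi>: "typed \<Psi> (b \<bowtie> a) b"
    and g: "shape g' = sh b" "shape g = sh b"
  shows "ev scV (fix_right (L \<Phi> \<odot>\<^sub>p S) (L \<Psi> \<odot>\<^sub>p S) (lift_edge L S e)) (g' \<bowtie> g) =
    ev scV (L (fix_right \<Phi> \<Psi> e)) (ev scV S (g' \<bowtie> g))"
proof -
  let ?Z = "ev scV S (g' \<bowtie> g)"
  have s: "typed (esource e) b a" using e by (simp add: typed_edge_def)
  have Z: "shape ?Z = sh (b \<bowtie> b)" by (rule V.shape_ev[OF typed_S]) (use g in simp)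
  have tl: "typed (fix_left \<Phi> e) (b \<bowtie> b) b" by (rule typed_fix_left[OF e \<Phi>])
  have ts: "typed (esource e \<odot>\<^sub>p fix_left \<Phi> e) (b \<bowtie> b) a" by (rule typed.intros(9)[OF tl s])
  have tq: "typed (PSnd \<bowtie>\<^sub>p esource e \<odot>\<^sub>p fix_left \<Phi> e) (b \<bowtie> b) (b \<bowtie> a)"
    by (rule typed.intros ts)+
  have "ev scV (L (fix_right \<Phi> \<Psi> e)) ?Z =
      ev scV (L \<Psi>) (ev scV (L (PSnd \<bowtie>\<^sub>p esource e \<odot>\<^sub>p fix_left \<Phi> e)) ?Z)"
    unfolding fix_right_def by (rule L_comp[OF tq \<Psi> Z])
  also have "ev scV (L (PSnd \<bowtie>\<^sub>p esource e \<odot>\<^sub>p fix_left \<Phi> e)) ?Z =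
      ev scV S (ev scV (L PSnd) ?Z \<bowtie> ev scV (L (esource e \<odot>\<^sub>p fix_left \<Phi> e)) ?Z)"
    by (rule S_L[symmetric, OF typed.intros(3) ts Z])
  also have "ev scV (L (esource e \<odot>\<^sub>p fix_left \<Phi> e)) ?Z = ev scV (L (esource e)) (ev scV (L (fix_left \<Phi> e)) ?Z)"
    by (rule L_comp[OF tl s Z])
  finally show ?thesis
    using fix_left_lift[OF e \<Phi> g] L_snd[OF g] by (simp add: fix_right_def lift_edge_def)
qed

text \<open>The hypothesis equates a polynomial map with \<open>PId\<close> on a whole shape, and
  such identities lift by \<open>L_cong\<close>.\<close>

lemma L_section:
  assumes \<Phi>: "typed \<Phi> (b \<bowtie> a) b" and s: "typed s b a"
    and id: "\<And>g. shape g = b \<Longrightarrow> ev scV \<Phi> (g \<bowtie> ev scV s g) = g" and g: "shape g = sh b"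
  shows "ev scV (L \<Phi>) (ev scV S (g \<bowtie> ev scV (L s) g)) = g"
proof -
  have t: "typed (PId \<bowtie>\<^sub>p s) b (b \<bowtie> a)" by (rule typed.intros s)+
  have "ev scV S (g \<bowtie> ev scV (L s) g) = ev scV (L (PId \<bowtie>\<^sub>p s)) g"
    using S_L[OF typed.intros(1) s g] L_Id[OF g] by simp
  moreover have "ev scV (L (\<Phi> \<odot>\<^sub>p (PId \<bowtie>\<^sub>p s))) g = ev scV (L PId) g"
    by (rule L_cong[OF typed.intros(9)[OF t \<Phi>] typed.intros(1) _ g]) (simp add: id)
  ultimately show ?thesis using L_comp[OF t \<Phi> g] L_Id[OF g] by simp
qed

text \<open>The conditions are identities between polynomial maps on whole shapes, not on composable
  pairs; this is why the property survives repeated lifting. The lifted corrections are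
  \<open>L \<Phi>\<close> and \<open>L \<Psi>\<close> after the shuffle \<open>S\<close>.\<close>

lemma retractable_lift:
  assumes e: "typed_edge e a b" and r: "retractable scV e a b"
  shows "retractable scV (lift_edge L S e) (sh a) (sh b)"
proof -
  obtain \<Phi> \<Psi> where \<Phi>: "typed \<Phi> (b \<bowtie> a) b" and \<Psi>: "typed \<Psi> (b \<bowtie> a) b"
    and A: "\<And>g. shape g = b \<Longrightarrow> ev scV \<Phi> (g \<bowtie> ev scV (esource e) g) = g"
    and B: "\<And>g. shape g = b \<Longrightarrow> ev scV \<Psi> (g \<bowtie> ev scV (etarget e) g) = g"
    and C: "\<And>z. shape z = b \<bowtie> b \<Longrightarrow>
      ev scV (etarget e) (ev scV (fix_right \<Phi> \<Psi> e) z) = ev scV (esource e) (ev scV (fix_left \<Phi> e) z)"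
    using r unfolding retractable_def by blast
  have st: "typed (esource e) b a" "typed (etarget e) b a" using e by (auto simp: typed_edge_def)
  note tl = typed_fix_left[OF e \<Phi>] and tr = typed_fix_right[OF e \<Phi> \<Psi>]
  show ?thesis
    unfolding retractable_def
  proof (rule exI[of _ "L \<Phi> \<odot>\<^sub>p S"], rule exI[of _ "L \<Psi> \<odot>\<^sub>p S"], intro conjI allI impI)
    show "typed (L \<Phi> \<odot>\<^sub>p S) (sh b \<bowtie> sh a) (sh b)" by (rule typed.intros(9)[OF typed_S typed_L[OF \<Phi>]])
    show "typed (L \<Psi> \<odot>\<^sub>p S) (sh b \<bowtie> sh a) (sh b)" by (rule typed.intros(9)[OF typed_S typed_L[OF \<Psi>]])
    fix g :: "('v, 'k) pt" assume g: "shape g = sh b"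
    show "ev scV (L \<Phi> \<odot>\<^sub>p S) (g \<bowtie> ev scV (esource (lift_edge L S e)) g) = g"
      using L_section[OF \<Phi> st(1) A g] by (simp add: lift_edge_def)
    show "ev scV (L \<Psi> \<odot>\<^sub>p S) (g \<bowtie> ev scV (etarget (lift_edge L S e)) g) = g"
      using L_section[OF \<Psi> st(2) B g] by (simp add: lift_edge_def)
  next
    fix z :: "('v, 'k) pt" assume "shape z = sh b \<bowtie> sh b"
    then obtain g' g where z: "z = g' \<bowtie> g" "shape g' = sh b" "shape g = sh b" by (rule shape_JoinE)
    let ?Z = "ev scV S (g' \<bowtie> g)"
    have Z: "shape ?Z = sh (b \<bowtie> b)" by (rule V.shape_ev[OF typed_S]) (use z in simp)
    have "ev scV (L (etarget e \<odot>\<^sub>p fix_right \<Phi> \<Psi> e)) ?Z = ev scV (L (esource e \<odot>\<^sub>p fix_left \<Phi> e)) ?Z"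
      by (rule L_cong[OF typed.intros(9)[OF tr st(2)] typed.intros(9)[OF tl st(1)] _ Z]) (simp add: C)
    then show "ev scV (etarget (lift_edge L S e)) (ev scV (fix_right (L \<Phi> \<odot>\<^sub>p S) (L \<Psi> \<odot>\<^sub>p S) (lift_edge L S e)) z) =
        ev scV (esource (lift_edge L S e)) (ev scV (fix_left (L \<Phi> \<odot>\<^sub>p S) (lift_edge L S e)) z)"
      unfolding z(1) fix_right_lift[OF e \<Phi> \<Psi> z(2,3)] fix_left_lift[OF e \<Phi> z(2,3)]
      using L_comp[OF tr st(2) Z] L_comp[OF tl st(1) Z] by (simp add: lift_edge_def)
  qed
qed

text \<open>Both sides are lifts of one map on the open set \<open>XB\<close>, by
  \<open>R_comp\<close> and by \<open>R_post\<close>, so \<open>R_unique\<close> identifies them. It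
  settles sources, targets and units, which are defined on whole vertex sets.\<close>

lemma R_natural:
  assumes "R XA FA FA'" "R XB FB FB'" "open XB" "XB \<subseteq> {x. shape x = b}" "typed p b a"
    and "\<And>x. x \<in> XB \<Longrightarrow> shape (FB x) = b"
    and "\<And>x. x \<in> XB \<Longrightarrow> ev scV p x \<in> XA \<and> FA (ev scV p x) = ev scW p (FB x)" and "z \<in> D XB"
  shows "ev scV (L p) z \<in> D XA \<and> FA' (ev scV (L p) z) = ev scW (L p) (FB' z)"
proof
  show "ev scV (L p) z \<in> D XA" by (rule D_L[OF assms(5,4) _ assms(8)]) (use assms(7) in blast)
  have "R XB (\<lambda>x. FA (ev scV p x)) (\<lambda>z. FA' (ev scV (L p) z))"
    by (rule R_comp[OF assms(1,5,4)]) (use assms(7) in blast)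
  moreover have "R XB (\<lambda>x. ev scW p (FB x)) (\<lambda>z. ev scW (L p) (FB' z))"
    by (rule R_post[OF assms(2,6,5)])
  ultimately show "FA' (ev scV (L p) z) = ev scW (L p) (FB' z)"
    by (rule R_unique[OF _ _ assms(3) _ assms(8)]) (use assms(7) in blast)
qed

theorem edge_fun_lift:
  assumes e: "typed_edge e a b" and r: "retractable scV e a b"
    and X: "open XA" "open XB" "XA \<subseteq> {x. shape x = a}" "XB \<subseteq> {x. shape x = b}"
    and shF: "\<And>x. x \<in> XA \<Longrightarrow> shape (FA x) = a" "\<And>x. x \<in> XB \<Longrightarrow> shape (FB x) = b"
    and R: "R XA FA FA'" "R XB FB FB'" and ef: "edge_fun scV scW e XA XB FA FB"
  shows "edge_fun scV scW (lift_edge L S e) (D XA) (D XB) FA' FB'"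
proof -
  have st: "typed (esource e) b a" "typed (etarget e) b a" "typed (eunit e) a b" "typed (emult e) (b \<bowtie> b) b"
    using e by (auto simp: typed_edge_def)
  obtain \<Phi> \<Psi> where \<Phi>: "typed \<Phi> (b \<bowtie> a) b" and \<Psi>: "typed \<Psi> (b \<bowtie> a) b"
    and A: "\<And>g. shape g = b \<Longrightarrow> ev scV \<Phi> (g \<bowtie> ev scV (esource e) g) = g"
    and B: "\<And>g. shape g = b \<Longrightarrow> ev scV \<Psi> (g \<bowtie> ev scV (etarget e) g) = g"
    and C: "\<And>z. shape z = b \<bowtie> b \<Longrightarrow>
      ev scV (etarget e) (ev scV (fix_right \<Phi> \<Psi> e) z) = ev scV (esource e) (ev scV (fix_left \<Phi> e) z)"
    using r unfolding retractable_def by blast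
  let ?l = "fix_left \<Phi> e" and ?r = "fix_right \<Phi> \<Psi> e"
  note tl = typed_fix_left[OF e \<Phi>] and tr = typed_fix_right[OF e \<Phi> \<Psi>]
  have tlr: "typed (?l \<bowtie>\<^sub>p ?r) (b \<bowtie> b) (b \<bowtie> b)" by (rule typed.intros tl tr)+
  \<comment> \<open>All pairs whose two corrected factors lie in \<open>XB\<close>. Unlike the set
    of composable pairs it is open, so the functor law for products can be differentiated on
    it.\<close>
  let ?Q = "{z. shape z = b \<bowtie> b \<and> ev scV ?l z \<in> XB \<and> ev scV ?r z \<in> XB}"
  have Qsh: "?Q \<subseteq> {z. shape z = b \<bowtie> b}" by blast
  have Q: "open ?Q"
  proof -
    let ?E = "{z :: ('v, 'k) pt. shape z = b \<bowtie> b}"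
    have "continuous_on ?E (ev scV ?l)" "continuous_on ?E (ev scV ?r)"
      by (rule V.continuous_on_ev[OF tl continuous_on_id] V.continuous_on_ev[OF tr continuous_on_id]; simp)+
    then have "open (ev scV ?l -` XB \<inter> ?E)" "open (ev scV ?r -` XB \<inter> ?E)"
      using X(2) unfolding continuous_on_open_vimage[OF open_shape] by blast+
    then have "open ((ev scV ?l -` XB \<inter> ?E) \<inter> (ev scV ?r -` XB \<inter> ?E))" by (rule open_Int)
    moreover have "(ev scV ?l -` XB \<inter> ?E) \<inter> (ev scV ?r -` XB \<inter> ?E) = ?Q" by blast
    ultimately show ?thesis by simp
  qed
  have mQ: "ev scV (emult e \<odot>\<^sub>p (?l \<bowtie>\<^sub>p ?r)) z \<in> XB \<and>
      FB (ev scV (emult e \<odot>\<^sub>p (?l \<bowtie>\<^sub>p ?r)) z) = ev scW (emult e) (FB (ev scV ?l z) \<bowtie> FB (ev scV ?r z))"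
    if "z \<in> ?Q" for z
    using ef C[of z] that unfolding edge_fun_def by simp
  \<comment> \<open>The image of the corrected product and the product of the images of the
    corrected factors give two lifts of one map on \<open>?Q\<close>.\<close>
  have "R ?Q (\<lambda>z. FB (ev scV (emult e \<odot>\<^sub>p (?l \<bowtie>\<^sub>p ?r)) z)) (\<lambda>z. FB' (ev scV (L (emult e \<odot>\<^sub>p (?l \<bowtie>\<^sub>p ?r))) z))"
    by (rule R_comp[OF R(2) typed.intros(9)[OF tlr st(4)] Qsh]) (use mQ in blast)
  moreover have "R ?Q (\<lambda>z. ev scW (emult e) (FB (ev scV ?l z) \<bowtie> FB (ev scV ?r z)))
      (\<lambda>z. ev scW (L (emult e)) (ev scW S (FB' (ev scV (L ?l) z) \<bowtie> FB' (ev scV (L ?r) z))))"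
  proof (rule R_post[OF R_Join[OF R_comp[OF R(2) tl Qsh] R_comp[OF R(2) tr Qsh]] _ st(4)])
  qed (use shF(2) in auto)
  ultimately have unique: "FB' (ev scV (L (emult e \<odot>\<^sub>p (?l \<bowtie>\<^sub>p ?r))) z) =
      ev scW (L (emult e)) (ev scW S (FB' (ev scV (L ?l) z) \<bowtie> FB' (ev scV (L ?r) z)))"
    if "z \<in> D ?Q" for z
    by (rule R_unique[OF _ _ Q _ that]) (use mQ in blast)
  have mult: "ev scV (L (emult e)) (ev scV S (g' \<bowtie> g)) \<in> D XB \<and>
      FB' (ev scV (L (emult e)) (ev scV S (g' \<bowtie> g))) = ev scW (L (emult e)) (ev scW S (FB' g' \<bowtie> FB' g))"
    if gX: "g' \<in> D XB" "g \<in> D XB" and c: "ev scV (L (etarget e)) g = ev scV (L (esource e)) g'" for g' g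
  proof -
    have g: "shape g' = sh b" "shape g = sh b" using gX D_shape[OF X(4)] by blast+
    let ?Z = "ev scV S (g' \<bowtie> g)"
    have Z: "shape ?Z = sh (b \<bowtie> b)" by (rule V.shape_ev[OF typed_S]) (use g in simp)
    \<comment> \<open>A composable pair of the lifted edge is left unchanged by the lifted
      correction, so the identity on \<open>D ?Q\<close> specialises to it.\<close>
    have l: "ev scV (L ?l) ?Z = g'"
      using fix_left_lift[OF e \<Phi> g] c L_section[OF \<Phi> st(1) A g(1)]
      by (simp add: fix_left_def[of "L \<Phi> \<odot>\<^sub>p S"] lift_edge_def)
    have r: "ev scV (L ?r) ?Z = g"
      using fix_right_lift[OF e \<Phi> \<Psi> g] c[symmetric] L_section[OF \<Psi> st(2) B g(2)] l fix_left_lift[OF e \<Phi> g]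
      by (simp add: fix_right_def[of "L \<Phi> \<odot>\<^sub>p S"] lift_edge_def)
    have ZQ: "?Z \<in> D ?Q" by (rule D_vimage[OF tl tr Z]) (use l r gX in simp_all)
    have eq: "ev scV (L (emult e \<odot>\<^sub>p (?l \<bowtie>\<^sub>p ?r))) ?Z = ev scV (L (emult e)) ?Z"
      using L_comp[OF tlr st(4) Z] S_L[OF tl tr Z] l r by simp
    have "ev scV (L (emult e \<odot>\<^sub>p (?l \<bowtie>\<^sub>p ?r))) ?Z \<in> D XB"
      by (rule D_L[OF typed.intros(9)[OF tlr st(4)] Qsh _ ZQ]) (use mQ in blast)
    then show ?thesis using unique[OF ZQ] eq l r by simp
  qed
  have src: "ev scV (L (esource e)) z \<in> D XA \<and>
      FA' (ev scV (L (esource e)) z) = ev scW (L (esource e)) (FB' z)" if "z \<in> D XB" for z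
    by (rule R_natural[OF R X(2,4) st(1) shF(2) _ that]) (use ef in \<open>simp_all add: edge_fun_def\<close>)
  have tgt: "ev scV (L (etarget e)) z \<in> D XA \<and>
      FA' (ev scV (L (etarget e)) z) = ev scW (L (etarget e)) (FB' z)" if "z \<in> D XB" for z
    by (rule R_natural[OF R X(2,4) st(2) shF(2) _ that]) (use ef in \<open>simp_all add: edge_fun_def\<close>)
  have unt: "ev scV (L (eunit e)) z \<in> D XB \<and>
      FB' (ev scV (L (eunit e)) z) = ev scW (L (eunit e)) (FA' z)" if "z \<in> D XA" for z
    by (rule R_natural[OF R(2,1) X(1,3) st(3) shF(1) _ that]) (use ef in \<open>simp_all add: edge_fun_def\<close>)
  show ?thesis
    unfolding edge_fun_def lift_edge_def poly_edge.simps ev.simps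
    using src tgt unt mult by blast
qed

end

lemma shape_JoinE3:
  assumes "shape z = a \<bowtie> b \<bowtie> c"
  obtains x v r where "z = x \<bowtie> v \<bowtie> r" "shape x = a" "shape v = b" "shape r = c"
  using assms by (elim shape_JoinE) simp

section \<open>The two kinds of lifting: by new scalars and by difference quotients\<close>

locale id_lifting = dense_modules scV scW
  for scV :: "'k::{comm_ring_1, topological_ab_group_add, topological_semigroup_mult, t2_space} \<Rightarrow>
      'v::{topological_ab_group_add, t2_space} \<Rightarrow> 'v"
    and scW :: "'k \<Rightarrow> 'w::{topological_ab_group_add, t2_space} \<Rightarrow> 'w" +
  fixes c :: shape
begin

definition D :: "('v, 'k) pt set \<Rightarrow> ('v, 'k) pt set" where
  "D X = {x \<bowtie> r |x r. x \<in> X \<and> shape r = c}"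

definition R :: "('v, 'k) pt set \<Rightarrow> (('v, 'k) pt \<Rightarrow> ('w, 'k) pt) \<Rightarrow> (('v, 'k) pt \<Rightarrow> ('w, 'k) pt) \<Rightarrow> bool" where
  "R X F F' \<longleftrightarrow> (\<forall>x r. x \<in> X \<longrightarrow> shape r = c \<longrightarrow> F' (x \<bowtie> r) = F x \<bowtie> recast r)"

lemma DE: assumes "z \<in> D X" obtains x r where "z = x \<bowtie> r" "x \<in> X" "shape r = c"
  using assms by (auto simp: D_def)

sublocale lifting scV scW lift_id shuffle_id "\<lambda>a. a \<bowtie> c" D R
proof
  fix p a b assume "typed p a b"
  then show "typed (lift_id p) (a \<bowtie> c) (b \<bowtie> c)"
    unfolding lift_id_def by - (assumption | rule typed.intros)+
next
  fix q a b p d and z :: "('v, 'k) pt" assume "shape z = a \<bowtie> c"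
  then show "ev scV (lift_id (p \<odot>\<^sub>p q)) z = ev scV (lift_id p) (ev scV (lift_id q) z)"
    by (elim shape_JoinE) (simp add: lift_id_def)
next
  fix a and z :: "('v, 'k) pt" assume "shape z = a \<bowtie> c"
  then show "ev scV (lift_id PId) z = z"
    by (elim shape_JoinE) (simp add: lift_id_def)
next
  fix p a b q and z :: "('v, 'k) pt"
  assume "\<And>x. shape x = a \<Longrightarrow> ev scV p x = ev scV q x" "shape z = a \<bowtie> c"
  then show "ev scV (lift_id p) z = ev scV (lift_id q) z"
    by (elim shape_JoinE) (simp add: lift_id_def)
next
  fix a b
  show "typed shuffle_id ((a \<bowtie> c) \<bowtie> b \<bowtie> c) ((a \<bowtie> b) \<bowtie> c)"
    unfolding shuffle_id_def by (rule typed.intros)+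
next
  fix p a b q d and z :: "('v, 'k) pt" assume "shape z = a \<bowtie> c"
  then show "ev scV shuffle_id (ev scV (lift_id p) z \<bowtie> ev scV (lift_id q) z) = ev scV (lift_id (p \<bowtie>\<^sub>p q)) z"
    by (elim shape_JoinE) (simp add: lift_id_def shuffle_id_def)
next
  fix g' g :: "('v, 'k) pt" and a b assume "shape g' = a \<bowtie> c" "shape g = b \<bowtie> c"
  then show "ev scV (lift_id PSnd) (ev scV shuffle_id (g' \<bowtie> g)) = g"
    by (elim shape_JoinE) (simp add: lift_id_def shuffle_id_def)
next
  fix g' g h :: "('v, 'k) pt" and a b d
  assume "shape g' = a \<bowtie> c" "shape g = b \<bowtie> c" "shape h = d \<bowtie> c"
  then show "ev scV shuffle_id (ev scV (lift_id PFst) (ev scV shuffle_id (g' \<bowtie> g)) \<bowtie> h) =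
      ev scV shuffle_id (g' \<bowtie> h)"
    by (elim shape_JoinE) (simp add: lift_id_def shuffle_id_def)
next
  fix X :: "('v, 'k) pt set" and a assume "X \<subseteq> {x. shape x = a}"
  then show "D X \<subseteq> {z. shape z = a \<bowtie> c}"
    by (auto simp: D_def)
next
  fix p a b and X Y :: "('v, 'k) pt set" and z :: "('v, 'k) pt"
  assume "\<And>x. x \<in> X \<Longrightarrow> ev scV p x \<in> Y" "z \<in> D X"
  then show "ev scV (lift_id p) z \<in> D Y"
    by (auto simp: D_def lift_id_def)
next
  fix p a b q d and z :: "('v, 'k) pt" and Y Y' :: "('v, 'k) pt set"
  assume z: "shape z = a \<bowtie> c" and *: "ev scV (lift_id p) z \<in> D Y" "ev scV (lift_id q) z \<in> D Y'"
  obtain x r where "z = x \<bowtie> r" "shape x = a" "shape r = c" using z by (rule shape_JoinE)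
  then show "z \<in> D {x. shape x = a \<and> ev scV p x \<in> Y \<and> ev scV q x \<in> Y'}"
    using * by (simp add: D_def lift_id_def)
next
  fix Y X :: "('v, 'k) pt set" and F F' :: "('v, 'k) pt \<Rightarrow> ('w, 'k) pt" and p a b
  assume "R Y F F'" "\<And>x. x \<in> X \<Longrightarrow> ev scV p x \<in> Y"
  then show "R X (\<lambda>x. F (ev scV p x)) (\<lambda>z. F' (ev scV (lift_id p) z))"
    by (simp add: R_def lift_id_def)
next
  fix X :: "('v, 'k) pt set" and F F' :: "('v, 'k) pt \<Rightarrow> ('w, 'k) pt" and q b d
  assume "R X F F'"
  then show "R X (\<lambda>x. ev scW q (F x)) (\<lambda>z. ev scW (lift_id q) (F' z))"
    by (simp add: R_def lift_id_def)
next
  fix X :: "('v, 'k) pt set" and F F' G G' :: "('v, 'k) pt \<Rightarrow> ('w, 'k) pt"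
  assume "R X F F'" "R X G G'"
  then show "R X (\<lambda>x. F x \<bowtie> G x) (\<lambda>z. ev scW shuffle_id (F' z \<bowtie> G' z))"
    by (simp add: R_def shuffle_id_def)
next
  fix X :: "('v, 'k) pt set" and F F' G G' :: "('v, 'k) pt \<Rightarrow> ('w, 'k) pt" and z :: "('v, 'k) pt"
  assume "R X F F'" "R X G G'" "\<And>x. x \<in> X \<Longrightarrow> F x = G x" "z \<in> D X"
  then show "F' z = G' z"
    by (elim DE) (simp add: R_def)
qed

end

text \<open>The liftings \<open>lift1\<close> and \<open>lift1_bar\<close>: the new scalars form a tuple \<open>r\<close> of shape \<open>c\<close>, and difference
  quotients are taken at the scalar \<open>\<tau>V r\<close>.\<close>

locale slope_lifting = dense_modules scV scW
  for scV :: "'k::{comm_ring_1, topological_ab_group_add, topological_semigroup_mult, t2_space} \<Rightarrow>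
      'v::{topological_ab_group_add, t2_space} \<Rightarrow> 'v"
    and scW :: "'k \<Rightarrow> 'w::{topological_ab_group_add, t2_space} \<Rightarrow> 'w" +
  fixes L :: "pmap \<Rightarrow> pmap" and c :: shape
    and \<tau>V :: "('v, 'k) pt \<Rightarrow> 'k" and \<tau>W :: "('w, 'k) pt \<Rightarrow> 'k"
  assumes typed_L': "typed p a b \<Longrightarrow> typed (L p) (a \<bowtie> a \<bowtie> c) (b \<bowtie> b \<bowtie> c)"
    and L_V: "shape r = c \<Longrightarrow>
      ev scV (L p) (x \<bowtie> v \<bowtie> r) = ev scV p x \<bowtie> ev scV (dq p) (x \<bowtie> v \<bowtie> Scal (\<tau>V r)) \<bowtie> r"
    and L_W: "shape r' = c \<Longrightarrow>
      ev scW (L p) (y \<bowtie> w \<bowtie> r') = ev scW p y \<bowtie> ev scW (dq p) (y \<bowtie> w \<bowtie> Scal (\<tau>W r')) \<bowtie> r'"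
    and \<tau>W_recast: "shape r = c \<Longrightarrow> \<tau>W (recast r) = \<tau>V r"
begin

definition D :: "('v, 'k) pt set \<Rightarrow> ('v, 'k) pt set" where
  "D X = {x \<bowtie> v \<bowtie> r |x v r. x \<bowtie> v \<bowtie> Scal (\<tau>V r) \<in> ext1 scV X \<and> shape r = c}"

definition R :: "('v, 'k) pt set \<Rightarrow> (('v, 'k) pt \<Rightarrow> ('w, 'k) pt) \<Rightarrow> (('v, 'k) pt \<Rightarrow> ('w, 'k) pt) \<Rightarrow> bool" where
  "R X F F' \<longleftrightarrow> (\<exists>G. slope_of scV scW X F G \<and> (\<forall>x v r. x \<bowtie> v \<bowtie> r \<in> D X \<longrightarrow>
     F' (x \<bowtie> v \<bowtie> r) = F x \<bowtie> G (x \<bowtie> v \<bowtie> Scal (\<tau>V r)) \<bowtie> recast r))"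

lemma D_iff: "x \<bowtie> v \<bowtie> r \<in> D X \<longleftrightarrow> x \<bowtie> v \<bowtie> Scal (\<tau>V r) \<in> ext1 scV X \<and> shape r = c"
  by (auto simp: D_def)

lemma D_E:
  assumes "z \<in> D X"
  obtains x v r where "z = x \<bowtie> v \<bowtie> r" "x \<bowtie> v \<bowtie> Scal (\<tau>V r) \<in> ext1 scV X" "shape r = c"
  using assms by (auto simp: D_def)

lemma L_D:
  assumes "typed p a b" "X \<subseteq> {x. shape x = a}" "\<And>x. x \<in> X \<Longrightarrow> ev scV p x \<in> Y" "z \<in> D X"
  shows "ev scV (L p) z \<in> D Y"
proof -
  obtain x v r where z: "z = x \<bowtie> v \<bowtie> r" "x \<bowtie> v \<bowtie> Scal (\<tau>V r) \<in> ext1 scV X" "shape r = c"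
    using assms(4) by (rule D_E)
  then show ?thesis
    using ev_lift1_ext1[OF V.module_axioms assms(1-3) z(2)] by (simp add: L_V D_iff)
qed

text \<open>Compatibility with composition and pairing is the recursion of \<open>dq\<close>, the
  conditions on \<open>D\<close> come from \<open>ev_dq\<close>, \<open>L_cong\<close> is
  \<open>dq_cong\<close>, and the rules for \<open>R\<close> are the chain rules and
  \<open>slope_unique\<close>.\<close>

sublocale lifting scV scW L shuffle1 "\<lambda>a. a \<bowtie> a \<bowtie> c" D R
proof
  fix p a b assume "typed p a b"
  then show "typed (L p) (a \<bowtie> a \<bowtie> c) (b \<bowtie> b \<bowtie> c)" by (rule typed_L')
next
  fix q a b p d and z :: "('v, 'k) pt" assume "shape z = a \<bowtie> a \<bowtie> c"
  then show "ev scV (L (p \<odot>\<^sub>p q)) z = ev scV (L p) (ev scV (L q) z)"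
    by (elim shape_JoinE) (simp add: L_V)
next
  fix a and z :: "('v, 'k) pt" assume "shape z = a \<bowtie> a \<bowtie> c"
  then show "ev scV (L PId) z = z"
    by (elim shape_JoinE) (simp add: L_V)
next
  fix p a b q and z :: "('v, 'k) pt"
  assume pq: "typed p a b" "typed q a b" "\<And>x. shape x = a \<Longrightarrow> ev scV p x = ev scV q x"
    and "shape z = a \<bowtie> a \<bowtie> c"
  then obtain x v r where z: "z = x \<bowtie> v \<bowtie> r" "shape x = a" "shape v = a" "shape r = c"
    by (elim shape_JoinE3)
  show "ev scV (L p) z = ev scV (L q) z"
    using dq_cong[OF pq, of "x \<bowtie> v \<bowtie> Scal (\<tau>V r)"] z pq(3)[OF z(2)] by (simp add: L_V)
next
  fix a b
  show "typed shuffle1 ((a \<bowtie> a \<bowtie> c) \<bowtie> b \<bowtie> b \<bowtie> c) ((a \<bowtie> b) \<bowtie> (a \<bowtie> b) \<bowtie> c)"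
    unfolding shuffle1_def by (rule typed.intros)+
next
  fix p a b q d and z :: "('v, 'k) pt" assume "shape z = a \<bowtie> a \<bowtie> c"
  then show "ev scV shuffle1 (ev scV (L p) z \<bowtie> ev scV (L q) z) = ev scV (L (p \<bowtie>\<^sub>p q)) z"
    by (elim shape_JoinE) (simp add: L_V shuffle1_def)
next
  fix g' g :: "('v, 'k) pt" and a b assume "shape g' = a \<bowtie> a \<bowtie> c" "shape g = b \<bowtie> b \<bowtie> c"
  then show "ev scV (L PSnd) (ev scV shuffle1 (g' \<bowtie> g)) = g"
    by (elim shape_JoinE) (simp add: L_V shuffle1_def)
next
  fix g' g h :: "('v, 'k) pt" and a b d
  assume "shape g' = a \<bowtie> a \<bowtie> c" "shape g = b \<bowtie> b \<bowtie> c" "shape h = d \<bowtie> d \<bowtie> c"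
  then show "ev scV shuffle1 (ev scV (L PFst) (ev scV shuffle1 (g' \<bowtie> g)) \<bowtie> h) =
      ev scV shuffle1 (g' \<bowtie> h)"
    by (elim shape_JoinE) (simp add: L_V shuffle1_def)
next
  fix X :: "('v, 'k) pt set" and a assume X: "X \<subseteq> {x. shape x = a}"
  show "D X \<subseteq> {z. shape z = a \<bowtie> a \<bowtie> c}"
    using shape_ext1[OF X, of scV] by (auto simp: D_def)
next
  fix p a b and X Y :: "('v, 'k) pt set" and z :: "('v, 'k) pt"
  assume "typed p a b" "X \<subseteq> {x. shape x = a}" "\<And>x. x \<in> X \<Longrightarrow> ev scV p x \<in> Y" "z \<in> D X"
  then show "ev scV (L p) z \<in> D Y" by (rule L_D)
next
  fix p a b q d and z :: "('v, 'k) pt" and Y Y' :: "('v, 'k) pt set"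
  assume t: "typed p a b" "typed q a d" and z: "shape z = a \<bowtie> a \<bowtie> c"
    and *: "ev scV (L p) z \<in> D Y" "ev scV (L q) z \<in> D Y'"
  obtain x v r where z': "z = x \<bowtie> v \<bowtie> r" "shape x = a" "shape v = a" "shape r = c"
    using z by (elim shape_JoinE3)
  then show "z \<in> D {x. shape x = a \<and> ev scV p x \<in> Y \<and> ev scV q x \<in> Y'}"
    using * ev_dq[OF V.module_axioms t(1) z'(2,3), of "\<tau>V r"] ev_dq[OF V.module_axioms t(2) z'(2,3), of "\<tau>V r"]
    by (simp add: D_iff ext1_iff L_V)
next
  fix Y X :: "('v, 'k) pt set" and F F' :: "('v, 'k) pt \<Rightarrow> ('w, 'k) pt" and p a b
  assume *: "R Y F F'" "typed p a b" "X \<subseteq> {x. shape x = a}" "\<And>x. x \<in> X \<Longrightarrow> ev scV p x \<in> Y"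
  from *(1) obtain G where G: "slope_of scV scW Y F G"
    and F': "\<And>x v r. x \<bowtie> v \<bowtie> r \<in> D Y \<Longrightarrow> F' (x \<bowtie> v \<bowtie> r) = F x \<bowtie> G (x \<bowtie> v \<bowtie> Scal (\<tau>V r)) \<bowtie> recast r"
    unfolding R_def by blast
  show "R X (\<lambda>x. F (ev scV p x)) (\<lambda>z. F' (ev scV (L p) z))"
    unfolding R_def
  proof (rule exI[of _ "\<lambda>z. G (ev scV (lift1 p) z)"], intro conjI allI impI)
    show "slope_of scV scW X (\<lambda>x. F (ev scV p x)) (\<lambda>z. G (ev scV (lift1 p) z))"
      by (rule slope_comp[OF G *(2-4)])
    fix x v r assume z: "x \<bowtie> v \<bowtie> r \<in> D X"
    then have r: "shape r = c" by (simp add: D_iff)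
    show "F' (ev scV (L p) (x \<bowtie> v \<bowtie> r)) = F (ev scV p x) \<bowtie>
        G (ev scV (lift1 p) (x \<bowtie> v \<bowtie> Scal (\<tau>V r))) \<bowtie> recast r"
      using L_D[OF *(2-4) z] F' by (simp add: L_V[OF r])
  qed
next
  fix X :: "('v, 'k) pt set" and F F' :: "('v, 'k) pt \<Rightarrow> ('w, 'k) pt" and q b d
  assume *: "R X F F'" "\<And>x. x \<in> X \<Longrightarrow> shape (F x) = b" "typed q b d"
  from *(1) obtain G where G: "slope_of scV scW X F G"
    and F': "\<And>x v r. x \<bowtie> v \<bowtie> r \<in> D X \<Longrightarrow> F' (x \<bowtie> v \<bowtie> r) = F x \<bowtie> G (x \<bowtie> v \<bowtie> Scal (\<tau>V r)) \<bowtie> recast r"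
    unfolding R_def by blast
  show "R X (\<lambda>x. ev scW q (F x)) (\<lambda>z. ev scW (L q) (F' z))"
    unfolding R_def
    by (rule exI, rule conjI[OF slope_post[OF G *(2,3)]]) (simp_all add: F' L_W D_iff \<tau>W_recast)
next
  fix X :: "('v, 'k) pt set" and F F' H H' :: "('v, 'k) pt \<Rightarrow> ('w, 'k) pt"
  assume *: "R X F F'" "R X H H'"
  from *(1) obtain G where G: "slope_of scV scW X F G"
    and F': "\<And>x v r. x \<bowtie> v \<bowtie> r \<in> D X \<Longrightarrow> F' (x \<bowtie> v \<bowtie> r) = F x \<bowtie> G (x \<bowtie> v \<bowtie> Scal (\<tau>V r)) \<bowtie> recast r"
    unfolding R_def by blast
  from *(2) obtain K where K: "slope_of scV scW X H K"
    and H': "\<And>x v r. x \<bowtie> v \<bowtie> r \<in> D X \<Longrightarrow> H' (x \<bowtie> v \<bowtie> r) = H x \<bowtie> K (x \<bowtie> v \<bowtie> Scal (\<tau>V r)) \<bowtie> recast r"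
    unfolding R_def by blast
  show "R X (\<lambda>x. F x \<bowtie> H x) (\<lambda>z. ev scW shuffle1 (F' z \<bowtie> H' z))"
    unfolding R_def
    by (rule exI, rule conjI[OF slope_Join[OF G K]]) (simp_all add: F' H' shuffle1_def)
next
  fix X :: "('v, 'k) pt set" and F F' H H' :: "('v, 'k) pt \<Rightarrow> ('w, 'k) pt" and z :: "('v, 'k) pt"
  assume *: "R X F F'" "R X H H'" "open X" "\<And>x. x \<in> X \<Longrightarrow> F x = H x" "z \<in> D X"
  from *(1) obtain G where G: "slope_of scV scW X F G"
    and F': "\<And>x v r. x \<bowtie> v \<bowtie> r \<in> D X \<Longrightarrow> F' (x \<bowtie> v \<bowtie> r) = F x \<bowtie> G (x \<bowtie> v \<bowtie> Scal (\<tau>V r)) \<bowtie> recast r"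
    unfolding R_def by blast
  from *(2) obtain K where K: "slope_of scV scW X H K"
    and H': "\<And>x v r. x \<bowtie> v \<bowtie> r \<in> D X \<Longrightarrow> H' (x \<bowtie> v \<bowtie> r) = H x \<bowtie> K (x \<bowtie> v \<bowtie> Scal (\<tau>V r)) \<bowtie> recast r"
    unfolding R_def by blast
  obtain x v r where z: "z = x \<bowtie> v \<bowtie> r" "x \<bowtie> v \<bowtie> Scal (\<tau>V r) \<in> ext1 scV X" "shape r = c"
    using *(5) by (rule D_E)
  then have "x \<in> X" by (simp add: ext1_iff)
  then show "F' z = H' z"
    using F'[of x v r] H'[of x v r] z *(5) slope_unique[OF G K *(4,3) z(2)] *(4)[of x] by simp
qed

end

context dense_modules
begin

sublocale id1: id_lifting scV scW "Scal ()"
  by unfold_locales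

sublocale id2: id_lifting scV scW "Scal () \<bowtie> Scal ()"
  by unfold_locales

sublocale sl: slope_lifting scV scW lift1 "Scal ()" the_scal the_scal
proof
  fix p a b assume "typed p a b"
  then show "typed (lift1 p) (a \<bowtie> a \<bowtie> Scal ()) (b \<bowtie> b \<bowtie> Scal ())" by (rule typed_lift1)
qed (auto)

sublocale slb: slope_lifting scV scW lift1_bar "Scal () \<bowtie> Scal ()"
  "\<lambda>r. the_scal (pfst r) * the_scal (psnd r)" "\<lambda>r. the_scal (pfst r) * the_scal (psnd r)"
proof
  fix p a b assume "typed p a b"
  then show "typed (lift1_bar p) (a \<bowtie> a \<bowtie> Scal () \<bowtie> Scal ()) (b \<bowtie> b \<bowtie> Scal () \<bowtie> Scal ())"
    unfolding lift1_bar_def by - (assumption | rule typed_dq typed.intros)+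
qed (auto simp: lift1_bar_def elim!: shape_JoinE shape_ScalE)

lemma id1_D: "id1.D X = times_scalars X"
  by (auto simp: id1.D_def times_scalars_def)

lemma id2_D: "id2.D X = times_scalars2 X"
  by (auto simp: id2.D_def times_scalars2_def elim!: shape_JoinE)

lemma sl_D: "sl.D X = ext1 scV X"
  by (auto simp: sl.D_def ext1_def)

lemma slb_D: "slb.D X = ext1_bar scV X"
  by (auto simp: slb.D_def ext1_def ext1_bar_def elim!: shape_JoinE)

end

section \<open>The homogeneous law of a \<open>C\<^sup>n\<close>-map\<close>

text \<open>\<open>Cn\<close> concerns maps into \<open>W\<close> and one sequence of chosen slopes.
  Vertex maps have values in trees and live on many sets, so differentiability is restated with an
  existential slope at each order, which makes it stable under polynomial pullback and
  pairing.\<close>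

primrec smooth :: "('k::{comm_ring_1, topological_space} \<Rightarrow> 'v::{plus, topological_space} \<Rightarrow> 'v) \<Rightarrow>
    ('k \<Rightarrow> 'w::{plus, topological_space} \<Rightarrow> 'w) \<Rightarrow> nat \<Rightarrow> ('v, 'k) pt set \<Rightarrow>
    (('v, 'k) pt \<Rightarrow> ('w, 'k) pt) \<Rightarrow> bool" where
  "smooth scV scW 0 X F \<longleftrightarrow> continuous_on X F"
| "smooth scV scW (Suc m) X F \<longleftrightarrow> (\<exists>G. slope_of scV scW X F G \<and> smooth scV scW m (ext1 scV X) G)"

lemma slope_of_cong: "slope_of scV scW X F G \<Longrightarrow> (\<And>x. x \<in> X \<Longrightarrow> F x = F' x) \<Longrightarrow> slope_of scV scW X F' G"
  unfolding slope_of_def ext1_iff by (simp cong: continuous_on_cong)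

lemma smooth_cong: "smooth scV scW m X F \<Longrightarrow> (\<And>x. x \<in> X \<Longrightarrow> F x = F' x) \<Longrightarrow> smooth scV scW m X F'"
  by (cases m) (auto cong: continuous_on_cong intro: slope_of_cong)

lemma smooth_SucD: "smooth scV scW (Suc m) X F \<Longrightarrow> smooth scV scW m X F"
proof (induction m arbitrary: X F)
  case 0
  then show ?case by (auto dest: slope_ofD(1))
next
  case (Suc m)
  from Suc.prems obtain G where "slope_of scV scW X F G" "smooth scV scW (Suc m) (ext1 scV X) G"
    unfolding smooth.simps(2)[of _ _ "Suc m"] by blast
  then show ?case using Suc.IH by auto
qed

context dense_modules
begin

text \<open>The slope of the composite is again a smooth map after a polynomial one, namely after
  \<open>lift1 p\<close>; hence the induction with \<open>p\<close> arbitrary.\<close>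

lemma smooth_comp:
  "smooth scV scW m Y F \<Longrightarrow> typed p a b \<Longrightarrow> X \<subseteq> {x. shape x = a} \<Longrightarrow> (\<And>x. x \<in> X \<Longrightarrow> ev scV p x \<in> Y) \<Longrightarrow>
    smooth scV scW m X (\<lambda>x. F (ev scV p x))"
proof (induction m arbitrary: X Y F p a b)
  case 0
  have "continuous_on X (ev scV p)"
    by (rule V.continuous_on_ev[OF 0(2) continuous_on_id]) (use 0(3) in blast)
  then show ?case
    using 0(1,4) by (auto intro: continuous_on_compose2)
next
  case (Suc m)
  from Suc.prems(1) obtain G where G: "slope_of scV scW Y F G" "smooth scV scW m (ext1 scV Y) G" by auto
  have "smooth scV scW m (ext1 scV X) (\<lambda>z. G (ev scV (lift1 p) z))"
    by (rule Suc.IH[OF G(2) typed_lift1[OF Suc.prems(2)] shape_ext1[OF Suc.prems(3)]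
          ev_lift1_ext1[OF V.module_axioms Suc.prems(2,3,4)]])
  then show ?case using slope_comp[OF G(1) Suc.prems(2-4)] by auto
qed

lemma smooth_Join:
  "smooth scV scW m X F \<Longrightarrow> smooth scV scW m X F' \<Longrightarrow> smooth scV scW m X (\<lambda>x. F x \<bowtie> F' x)"
proof (induction m arbitrary: X F F')
  case (Suc m)
  from Suc.prems obtain G G' where "slope_of scV scW X F G" "smooth scV scW m (ext1 scV X) G"
    "slope_of scV scW X F' G'" "smooth scV scW m (ext1 scV X) G'" by auto
  then show ?case using slope_Join Suc.IH by (auto intro!: exI[of _ "\<lambda>z. G z \<bowtie> G' z"])
qed (auto intro: continuous_on_Join)

lemma smooth_recast_ev:
  "typed p a b \<Longrightarrow> X \<subseteq> {x. shape x = a} \<Longrightarrow> smooth scV scW m X (\<lambda>x. recast (ev scV p x))"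
proof (induction m arbitrary: X p a)
  case 0
  then show ?case using slope_ofD(1)[OF slope_recast_ev[OF 0]] by simp
next
  case (Suc m)
  then show ?case
    using slope_recast_ev[OF Suc.prems] Suc.IH[OF typed_dq[OF Suc.prems(1)] shape_ext1[OF Suc.prems(2)]]
    by auto
qed

end

text \<open>\<open>psnd\<close> is the whole tuple of new scalars, so one map serves both for
  \<open>(x, t)\<close> and for \<open>(x, s, t)\<close>.\<close>

definition lift_map :: "(('v, 'k) pt \<Rightarrow> ('w::zero, 'k) pt) \<Rightarrow> ('v, 'k) pt \<Rightarrow> ('w, 'k) pt" where
  "lift_map F = (\<lambda>z. F (pfst z) \<bowtie> recast (psnd z))"

definition lift_slope :: "(('v, 'k) pt \<Rightarrow> ('w::zero, 'k) pt) \<Rightarrow> (('v, 'k) pt \<Rightarrow> ('w, 'k) pt) \<Rightarrow>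
    ('v, 'k) pt \<Rightarrow> ('w, 'k) pt" where
  "lift_slope F G = (\<lambda>z. F (pfst z) \<bowtie> G z \<bowtie> recast (psnd (psnd z)))"

definition lift_slope_bar :: "(('v, 'k::times) pt \<Rightarrow> ('w::zero, 'k) pt) \<Rightarrow> (('v, 'k) pt \<Rightarrow> ('w, 'k) pt) \<Rightarrow>
    ('v, 'k) pt \<Rightarrow> ('w, 'k) pt" where
  "lift_slope_bar F G = (\<lambda>z. let r = psnd (psnd z) in
     F (pfst z) \<bowtie> G (pfst z \<bowtie> pfst (psnd z) \<bowtie> Scal (the_scal (pfst r) * the_scal (psnd r))) \<bowtie> recast r)"

section \<open>The first-order edge categories\<close>

lemma typed_base_edges:
  "typed_edge edge1 (a \<bowtie> Scal ()) (a \<bowtie> a \<bowtie> Scal ())"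
  "typed_edge edge1_bar (a \<bowtie> Scal () \<bowtie> Scal ()) (a \<bowtie> a \<bowtie> Scal () \<bowtie> Scal ())"
  "typed_edge edge_scal (a \<bowtie> Scal ()) (a \<bowtie> Scal () \<bowtie> Scal ())"
  "typed_edge edge_scal_bar (a \<bowtie> a \<bowtie> Scal ()) (a \<bowtie> a \<bowtie> Scal () \<bowtie> Scal ())"
  unfolding typed_edge_def edge1_def edge1_bar_def edge_scal_def edge_scal_bar_def poly_edge.simps
  by (rule conjI typed.intros)+

text \<open>The source of \<open>(x, v, t)\<close> is \<open>(x, t)\<close>, so it can be prescribed
  by overwriting \<open>x\<close> and \<open>t\<close> in \<open>g'\<close> with those of the target
  of \<open>g\<close>; \<open>g\<close> itself stays. The same works in \<open>edge1_bar\<close>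
  with \<open>(s, t)\<close> for \<open>t\<close>.\<close>

lemma retractable_edge1: "retractable sc edge1 (a \<bowtie> Scal ()) (a \<bowtie> a \<bowtie> Scal ())"
  unfolding retractable_def
proof (rule exI[of _ "PFst \<odot>\<^sub>p PSnd \<bowtie>\<^sub>p pr2 \<odot>\<^sub>p PFst \<bowtie>\<^sub>p PSnd \<odot>\<^sub>p PSnd"], rule exI[of _ PFst], intro conjI)
qed ((rule typed.intros)+ | auto simp: fix_left_def fix_right_def edge1_def elim!: shape_JoinE)+

lemma retractable_edge1_bar:
  "retractable sc edge1_bar (a \<bowtie> Scal () \<bowtie> Scal ()) (a \<bowtie> a \<bowtie> Scal () \<bowtie> Scal ())"
  unfolding retractable_def
proof (rule exI[of _ "PFst \<odot>\<^sub>p PSnd \<bowtie>\<^sub>p pr2 \<odot>\<^sub>p PFst \<bowtie>\<^sub>p PSnd \<odot>\<^sub>p PSnd"], rule exI[of _ PFst], intro conjI)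
qed ((rule typed.intros)+ | auto simp: fix_left_def fix_right_def edge1_bar_def elim!: shape_JoinE)+

text \<open>Prescribing the source \<open>(x, s t)\<close> of \<open>g'\<close> would require
  division by \<open>s\<close>. The target \<open>(x, t)\<close> of \<open>g\<close> can be
  overwritten, so here \<open>g'\<close> stays and \<open>g\<close> is corrected.\<close>

lemma retractable_edge_scal: "retractable sc edge_scal (a \<bowtie> Scal ()) (a \<bowtie> Scal () \<bowtie> Scal ())"
  unfolding retractable_def
proof (rule exI[of _ PFst], rule exI[of _ "PFst \<odot>\<^sub>p PSnd \<bowtie>\<^sub>p pr2 \<odot>\<^sub>p PFst \<bowtie>\<^sub>p PSnd \<odot>\<^sub>p PSnd"], intro conjI)
qed ((rule typed.intros)+ | auto simp: fix_left_def fix_right_def edge_scal_def elim!: shape_JoinE)+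

text \<open>The correction is split. \<open>x\<close> and \<open>v\<close> stand openly in the
  source \<open>(x, v, s t)\<close> and are overwritten in \<open>g'\<close>; \<open>t\<close>
  stands openly in the target \<open>(x, s v, t)\<close> and is overwritten in \<open>g\<close>.
  Prescribing \<open>v\<close> at the target or \<open>t\<close> at the source would require
  division by \<open>s\<close>.\<close>

lemma retractable_edge_scal_bar:
  "retractable sc edge_scal_bar (a \<bowtie> a \<bowtie> Scal ()) (a \<bowtie> a \<bowtie> Scal () \<bowtie> Scal ())"
  unfolding retractable_def
proof (rule exI[of _ "PFst \<odot>\<^sub>p PSnd \<bowtie>\<^sub>p pr2 \<odot>\<^sub>p PSnd \<bowtie>\<^sub>p rest2 \<odot>\<^sub>p PFst"],
    rule exI[of _ "PFst \<odot>\<^sub>p PFst \<bowtie>\<^sub>p pr2 \<odot>\<^sub>p PFst \<bowtie>\<^sub>p pr3 \<odot>\<^sub>p PFst \<bowtie>\<^sub>p rest2 \<odot>\<^sub>p PSnd"], intro conjI)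
qed ((rule typed.intros)+ | auto simp: fix_left_def fix_right_def edge_scal_bar_def elim!: shape_JoinE)+

context dense_modules
begin

lemma id1_R: "id1.R X F (lift_map F)"
  by (simp add: id1.R_def lift_map_def)

lemma id2_R: "id2.R X F (lift_map F)"
  by (simp add: id2.R_def lift_map_def)

lemma sl_R: "slope_of scV scW X F G \<Longrightarrow> sl.R X F (lift_slope F G)"
  unfolding sl.R_def by (rule exI[of _ G]) (auto simp: lift_slope_def sl.D_iff)

lemma slb_R: "slope_of scV scW X F G \<Longrightarrow> slb.R X F (lift_slope_bar F G)"
  unfolding slb.R_def by (rule exI[of _ G]) (auto simp: lift_slope_bar_def slb.D_iff Let_def)

text \<open>For the unprimed direction, targets are the slope equation, units are
  \<open>slope_zero\<close> and products are \<open>slope_add\<close>. For the primed one,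
  \<open>slope_scale\<close> gives the target on \<open>(x, v, s, t)\<close>, and on
  \<open>(x, s, t)\<close> only scalars are touched.\<close>

lemma edge_fun_base:
  assumes G: "slope_of scV scW X F G" and X: "open X" and sh: "X \<subseteq> {x. shape x = a}"
    "\<And>x. x \<in> X \<Longrightarrow> shape (F x) = b"
  shows "edge_fun scV scW edge1 (times_scalars X) (ext1 scV X) (lift_map F) (lift_slope F G)"
    and "edge_fun scV scW edge1_bar (times_scalars2 X) (ext1_bar scV X) (lift_map F) (lift_slope_bar F G)"
    and "edge_fun scV scW edge_scal (times_scalars X) (times_scalars2 X) (lift_map F) (lift_map F)"
    and "edge_fun scV scW edge_scal_bar (ext1 scV X) (ext1_bar scV X) (lift_slope F G) (lift_slope_bar F G)"
proof -
  have add: "padd x (pscale scV t (padd v v')) = padd (padd x (pscale scV t v)) (pscale scV t v')"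
    if "shape v = shape x" "shape v' = shape x" for x v v' t
    using V.pscale_padd[of v "shape x" v' t] padd_assoc[of x "shape x" "pscale scV t v" "pscale scV t v'"]
      that by simp
  note defs = edge_fun_def times_scalars_def times_scalars2_def ext1_bar_def lift_map_def
    lift_slope_def lift_slope_bar_def Let_def
  show "edge_fun scV scW edge1 (times_scalars X) (ext1 scV X) (lift_map F) (lift_slope F G)"
    by (auto simp: defs edge1_def ext1_iff add slope_ofD(4)[OF G] slope_zero[OF G X]
        slope_add[OF G X _ _ _ _ _ sh(2)] elim!: ext1E)
  show "edge_fun scV scW edge1_bar (times_scalars2 X) (ext1_bar scV X) (lift_map F) (lift_slope_bar F G)"
    by (auto simp: defs edge1_bar_def add slope_ofD(4)[OF G] slope_zero[OF G X]
        slope_add[OF G X _ _ _ _ _ sh(2)])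
  show "edge_fun scV scW edge_scal (times_scalars X) (times_scalars2 X) (lift_map F) (lift_map F)"
    by (auto simp: defs edge_scal_def)
  show "edge_fun scV scW edge_scal_bar (ext1 scV X) (ext1_bar scV X) (lift_slope F G) (lift_slope_bar F G)"
    by (auto simp: defs edge_scal_bar_def ext1_iff V.pscale_pscale mult_ac slope_scale[OF G X] elim!: ext1E)
qed

end

lemma enat_SucD: "enat (Suc k) \<le> n \<Longrightarrow> enat k \<le> n"
  by (meson enat_ord_simps(1) le_SucI order_refl order_trans)

section \<open>Vertex sets and vertex maps of the homogeneous law\<close>

primrec hshape :: "nat \<Rightarrow> dir set \<Rightarrow> shape" where
  "hshape 0 \<alpha> = Vec ()"
| "hshape (Suc n) \<alpha> =
     (let a = hshape n (\<alpha> - {Dir (Suc n), Dir' (Suc n)}) in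
      if Dir (Suc n) \<in> \<alpha>
      then (if Dir' (Suc n) \<in> \<alpha> then a \<bowtie> a \<bowtie> Scal () \<bowtie> Scal () else a \<bowtie> a \<bowtie> Scal ())
      else (if Dir' (Suc n) \<in> \<alpha> then a \<bowtie> Scal () \<bowtie> Scal () else a \<bowtie> Scal ()))"

lemma shape_H_vertex: "H_vertex sc U n \<alpha> \<subseteq> {x. shape x = hshape n \<alpha>}"
proof (induction n arbitrary: \<alpha>)
  case (Suc n)
  have "shape x = hshape n \<beta>" if "x \<in> H_vertex sc U n \<beta>" for x \<beta>
    using Suc.IH that by blast
  then show ?case
    by (auto simp: Let_def times_scalars_def times_scalars2_def ext1_def ext1_bar_def)
qed auto

lemma open_times_scalars: assumes "open X" shows "open (times_scalars X)"
proof -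
  have "times_scalars X = {x \<bowtie> y |x y. x \<in> X \<and> y \<in> range Scal}"
    unfolding times_scalars_def by blast
  then show ?thesis using open_Join[OF assms open_range_Scal] by simp
qed

lemma open_times_scalars2: assumes "open X" shows "open (times_scalars2 X)"
proof -
  have "times_scalars2 X = {x \<bowtie> y |x y. x \<in> X \<and> y \<in> {x \<bowtie> y |x y. x \<in> range Scal \<and> y \<in> range Scal}}"
    unfolding times_scalars2_def by blast
  then show ?thesis
    using open_Join[OF assms open_Join[OF open_range_Scal open_range_Scal]] by simp
qed

context topological_module
begin

lemma open_ext1_bar:
  assumes "open X" "X \<subseteq> {x. shape x = a}"
  shows "open (ext1_bar scale X)"
proof -
  let ?E = "{z :: ('a, 'k) pt. shape z = a \<bowtie> a \<bowtie> Scal () \<bowtie> Scal ()}"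
  let ?p = "pr1 \<bowtie>\<^sub>p pr2 \<bowtie>\<^sub>p pr3 *\<^sub>p rest3"
  have "typed ?p (a \<bowtie> a \<bowtie> Scal () \<bowtie> Scal ()) (a \<bowtie> a \<bowtie> Scal ())" by (rule typed.intros)+
  then have c: "continuous_on ?E (ev scale ?p)" by (rule continuous_on_ev) (auto intro: continuous_on_id)
  then have "open (ev scale ?p -` ext1 scale X \<inter> ?E)"
    using open_ext1[OF assms] unfolding continuous_on_open_vimage[OF open_shape] by blast
  moreover have "ext1_bar scale X = ev scale ?p -` ext1 scale X \<inter> ?E"
    using assms(2) by (auto simp: ext1_def ext1_bar_def elim!: shape_JoinE shape_ScalE)
  ultimately show ?thesis by (simp only:)
qed

lemma open_H_vertex: "open U \<Longrightarrow> open (H_vertex scale U n \<alpha>)"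
proof (induction n arbitrary: \<alpha>)
  case (Suc n)
  then show ?case
    by (auto simp: Let_def intro: open_times_scalars open_times_scalars2 open_ext1[OF _ shape_H_vertex]
        open_ext1_bar[OF _ shape_H_vertex])
qed (simp add: open_Vec_image)

end

definition the_slope where
  "the_slope scV scW X F = (SOME G. slope_of scV scW X F G)"

text \<open>Without \<open>Dir (Suc n)\<close> nothing is differentiated, so \<open>lift_map\<close>
  covers the cases with and without \<open>Dir' (Suc n)\<close>. The choice made by
  \<open>the_slope\<close> is harmless on open vertex sets, where slopes are unique.\<close>

primrec H_map :: "('k::{comm_ring_1, topological_space} \<Rightarrow> 'v::{plus, topological_space} \<Rightarrow> 'v) \<Rightarrow>
    ('k \<Rightarrow> 'w::{monoid_add, topological_space} \<Rightarrow> 'w) \<Rightarrow> 'v set \<Rightarrow> ('v \<Rightarrow> 'w) \<Rightarrow> nat \<Rightarrow> dir set \<Rightarrow>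
    ('v, 'k) pt \<Rightarrow> ('w, 'k) pt" where
  "H_map scV scW U f 0 \<alpha> = (\<lambda>z. Vec (f (the_vec z)))"
| "H_map scV scW U f (Suc n) \<alpha> =
     (let \<beta> = \<alpha> - {Dir (Suc n), Dir' (Suc n)}; F = H_map scV scW U f n \<beta>;
          G = the_slope scV scW (H_vertex scV U n \<beta>) F in
      if Dir (Suc n) \<in> \<alpha>
      then (if Dir' (Suc n) \<in> \<alpha> then lift_slope_bar F G else lift_slope F G)
      else lift_map F)"

locale cn_map = dense_modules scV scW
  for scV :: "'k::{comm_ring_1, topological_ab_group_add, topological_semigroup_mult, t2_space} \<Rightarrow>
      'v::{topological_ab_group_add, t2_space} \<Rightarrow> 'v"
    and scW :: "'k \<Rightarrow> 'w::{topological_ab_group_add, t2_space} \<Rightarrow> 'w" +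
  fixes U :: "'v set" and U' :: "'w set" and f :: "'v \<Rightarrow> 'w" and n :: enat
  assumes open_U: "open U" and f_U: "x \<in> U \<Longrightarrow> f x \<in> U'"
    and smooth_f: "enat m \<le> n \<Longrightarrow> smooth scV scW m (Vec ` U) (\<lambda>z. Vec (f (the_vec z)))"
begin

abbreviation "X \<equiv> H_vertex scV U"
abbreviation "F \<equiv> H_map scV scW U f"
abbreviation "G k \<alpha> \<equiv> the_slope scV scW (X k \<alpha>) (F k \<alpha>)"

lemmas open_X = V.open_H_vertex[OF open_U]
lemmas shape_X = shape_H_vertex[of scV U]

lemma slope_of_the_slope:
  assumes "smooth scV scW (Suc m) (X k \<alpha>) (F k \<alpha>)"
  shows "slope_of scV scW (X k \<alpha>) (F k \<alpha>) (G k \<alpha>)"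
  using assms someI_ex[of "slope_of scV scW (X k \<alpha>) (F k \<alpha>)"] by (auto simp: the_slope_def)

text \<open>Uniqueness on the open vertex set transfers smoothness from the slope that witnesses it
  to the chosen one.\<close>

lemma smooth_the_slope:
  assumes "smooth scV scW (Suc m) (X k \<alpha>) (F k \<alpha>)"
  shows "smooth scV scW m (ext1 scV (X k \<alpha>)) (G k \<alpha>)"
proof -
  obtain H where H: "slope_of scV scW (X k \<alpha>) (F k \<alpha>) H" "smooth scV scW m (ext1 scV (X k \<alpha>)) H"
    using assms by auto
  show ?thesis
    by (rule smooth_cong[OF H(2)]) (rule slope_unique[OF H(1) slope_of_the_slope[OF assms] _ open_X], auto)
qed

text \<open>Each step of the recursion spends one order of differentiability: at level
  \<open>k\<close> there are \<open>m\<close> orders left if \<open>k + m \<le> n\<close>. The new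
  vertex maps are joins of polynomial pullbacks of the old map and its slope with recast
  scalars.\<close>

lemma smooth_F: "enat (k + m) \<le> n \<Longrightarrow> smooth scV scW m (X k \<alpha>) (F k \<alpha>)"
proof (induction k arbitrary: m \<alpha>)
  case 0
  then show ?case by (simp add: smooth_f)
next
  case (Suc k)
  let ?\<beta> = "\<alpha> - {Dir (Suc k), Dir' (Suc k)}"
  let ?X = "X k ?\<beta>" and ?F = "F k ?\<beta>" and ?G = "G k ?\<beta>" and ?a = "hshape k ?\<beta>"
  have s: "smooth scV scW (Suc m) ?X ?F" using Suc.prems by (intro Suc.IH) simp
  note F = smooth_SucD[OF s] and G = smooth_the_slope[OF s]
  have xa: "shape x = ?a" if "x \<in> ?X" for x using shape_X that by blast
  have map: "smooth scV scW m Y (lift_map ?F)"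
    if "Y \<subseteq> {z. shape z = ?a \<bowtie> c}" "\<And>z. z \<in> Y \<Longrightarrow> pfst z \<in> ?X" for Y c
    using smooth_Join[OF smooth_comp[OF F typed.intros(2) that(1)] smooth_recast_ev[OF typed.intros(3) that(1)]]
      that(2) by (simp add: lift_map_def)
  have t1: "typed rest2 (?a \<bowtie> ?a \<bowtie> c) c" for c by (rule typed.intros)+
  \<comment> \<open>This polynomial map sends \<open>(x, v, s, t)\<close> to
    \<open>(x, v, s t)\<close>, where the homogeneous lift evaluates the slope.\<close>
  have t2: "typed (pr1 \<bowtie>\<^sub>p pr2 \<bowtie>\<^sub>p pr3 *\<^sub>p rest3) (?a \<bowtie> ?a \<bowtie> Scal () \<bowtie> Scal ()) (?a \<bowtie> ?a \<bowtie> Scal ())"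
    by (rule typed.intros)+
  have slope: "smooth scV scW m (ext1 scV ?X) (lift_slope ?F ?G)"
  proof -
    have sh: "ext1 scV ?X \<subseteq> {z. shape z = ?a \<bowtie> ?a \<bowtie> Scal ()}" by (rule shape_ext1[OF shape_X])
    have "smooth scV scW m (ext1 scV ?X) (\<lambda>z. ?F (ev scV pr1 z))"
      by (rule smooth_comp[OF F typed.intros(2) sh]) (auto elim!: ext1E)
    from smooth_Join[OF this smooth_Join[OF G smooth_recast_ev[OF t1 sh]]] show ?thesis
      by (simp add: lift_slope_def)
  qed
  have slope_bar: "smooth scV scW m (ext1_bar scV ?X) (lift_slope_bar ?F ?G)"
  proof -
    have sh: "ext1_bar scV ?X \<subseteq> {z. shape z = ?a \<bowtie> ?a \<bowtie> Scal () \<bowtie> Scal ()}"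
      using xa by (auto simp: ext1_bar_def)
    have 1: "smooth scV scW m (ext1_bar scV ?X) (\<lambda>z. ?F (ev scV pr1 z))"
      by (rule smooth_comp[OF F typed.intros(2) sh]) (auto simp: ext1_bar_def)
    have 2: "smooth scV scW m (ext1_bar scV ?X) (\<lambda>z. ?G (ev scV (pr1 \<bowtie>\<^sub>p pr2 \<bowtie>\<^sub>p pr3 *\<^sub>p rest3) z))"
      by (rule smooth_comp[OF G t2 sh]) (auto simp: ext1_bar_def ext1_iff)
    show ?thesis
      by (rule smooth_cong[OF smooth_Join[OF 1 smooth_Join[OF 2 smooth_recast_ev[OF t1 sh]]]])
        (auto simp: lift_slope_bar_def Let_def ext1_bar_def)
  qed
  have "smooth scV scW m (times_scalars ?X) (lift_map ?F)"
    "smooth scV scW m (times_scalars2 ?X) (lift_map ?F)"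
    by (rule map[of _ "Scal ()"] map[of _ "Scal () \<bowtie> Scal ()"];
        use xa in \<open>auto simp: times_scalars_def times_scalars2_def\<close>)+
  then show ?case using slope slope_bar by (simp add: Let_def del: Diff_insert0)
qed

lemma slope_of_G: "enat (Suc k) \<le> n \<Longrightarrow> slope_of scV scW (X k \<alpha>) (F k \<alpha>) (G k \<alpha>)"
  by (rule slope_of_the_slope[of 0], rule smooth_F) simp

text \<open>The condition on \<open>F x + t * G\<close> in the image vertex set holds because this
  point is \<open>F (x + t v)\<close>, the image of a point of the source vertex set; hence the
  slope equation is used from right to left.\<close>

lemma F_vertex: "enat k \<le> n \<Longrightarrow> z \<in> X k \<alpha> \<Longrightarrow> F k \<alpha> z \<in> H_vertex scW U' k \<alpha>"
proof (induction k arbitrary: \<alpha> z)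
  case 0
  then show ?case using f_U by auto
next
  case (Suc k)
  let ?\<beta> = "\<alpha> - {Dir (Suc k), Dir' (Suc k)}"
  have "enat k \<le> n" using Suc.prems(1) by (rule enat_SucD)
  note IH = Suc.IH[OF this, of _ ?\<beta>]
  note G = slope_ofD(3,4)[OF slope_of_G[OF Suc.prems(1), of ?\<beta>]]
  show ?case
    using Suc.prems(2) IH G(1)
    by (auto simp: Let_def times_scalars_def times_scalars2_def ext1_def ext1_bar_def lift_map_def
        lift_slope_def lift_slope_bar_def G(2)[symmetric] split: if_splits)
qed

lemma shape_F: "enat k \<le> n \<Longrightarrow> z \<in> X k \<alpha> \<Longrightarrow> shape (F k \<alpha> z) = hshape k \<alpha>"
  using F_vertex shape_H_vertex by blast

text \<open>Typing and retractability are carried along because \<open>edge_fun_lift\<close> asks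
  for them. In a new direction the edge is one of the four first-order ones; in an old direction it
  is lifted according to the new directions that the vertex contains.\<close>

lemma H_edge_fun:
  "enat k \<le> n \<Longrightarrow> i \<in> dirs k \<Longrightarrow> i \<notin> \<beta> \<Longrightarrow>
    typed_edge (H_edge k \<beta> i) (hshape k \<beta>) (hshape k (insert i \<beta>)) \<and>
    retractable scV (H_edge k \<beta> i) (hshape k \<beta>) (hshape k (insert i \<beta>)) \<and>
    edge_fun scV scW (H_edge k \<beta> i) (X k \<beta>) (X k (insert i \<beta>)) (F k \<beta>) (F k (insert i \<beta>))"
proof (induction k arbitrary: \<beta> i)
  case 0
  then show ?case by (simp add: dirs_def)
next
  case (Suc k)
  let ?N = "{Dir (Suc k), Dir' (Suc k)}"
  let ?\<beta> = "\<beta> - ?N"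
  have k: "enat k \<le> n" using Suc.prems(1) by (rule enat_SucD)
  note G = slope_of_G[OF Suc.prems(1)]
  note base = edge_fun_base[OF G[of ?\<beta>] open_X shape_X shape_F[OF k]]
  have "i = Dir (Suc k) \<or> i = Dir' (Suc k) \<or> i \<in> dirs k"
    using Suc.prems(2) by (auto simp: dirs_def le_Suc_eq)
  moreover have ?case if i: "i = Dir (Suc k)"
  proof -
    have "insert i \<beta> - ?N = ?\<beta>" using i by blast
    then show ?thesis
      using i Suc.prems(3) base(1,2) typed_base_edges(1,2) retractable_edge1[of scV] retractable_edge1_bar[of scV]
      by (simp add: Let_def del: Diff_insert0)
  qed
  moreover have ?case if i: "i = Dir' (Suc k)"
  proof -
    have "insert i \<beta> - ?N = ?\<beta>" using i by blast
    then show ?thesis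
      using i Suc.prems(3) base(3,4) typed_base_edges(3,4) retractable_edge_scal[of scV]
        retractable_edge_scal_bar[of scV]
      by (simp add: Let_def del: Diff_insert0)
  qed
  moreover have ?case if i: "i \<in> dirs k"
  proof -
    have N: "i \<noteq> Dir (Suc k)" "i \<noteq> Dir' (Suc k)" using i by (auto simp: dirs_def)
    then have ins: "insert i \<beta> - ?N = insert i ?\<beta>" by blast
    let ?e = "H_edge k ?\<beta> i"
    have "i \<notin> ?\<beta>" using Suc.prems(3) by blast
    from Suc.IH[OF k i this]
    have IH: "typed_edge ?e (hshape k ?\<beta>) (hshape k (insert i ?\<beta>))"
      "retractable scV ?e (hshape k ?\<beta>) (hshape k (insert i ?\<beta>))"
      "edge_fun scV scW ?e (X k ?\<beta>) (X k (insert i ?\<beta>)) (F k ?\<beta>) (F k (insert i ?\<beta>))" by blast+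
    note X = open_X[of k ?\<beta>] open_X[of k "insert i ?\<beta>"] shape_X[of k ?\<beta>] shape_X[of k "insert i ?\<beta>"]
    \<comment> \<open>One lift for each subset of the two new directions: one scalar, two scalars,
      slope at \<open>t\<close>, slope at \<open>s t\<close>.\<close>
    note lifts =
      id1.edge_fun_lift[OF IH(1,2) X shape_F[OF k] shape_F[OF k] id1_R id1_R IH(3), unfolded id1_D]
      id2.edge_fun_lift[OF IH(1,2) X shape_F[OF k] shape_F[OF k] id2_R id2_R IH(3), unfolded id2_D]
      sl.edge_fun_lift[OF IH(1,2) X shape_F[OF k] shape_F[OF k] sl_R[OF G] sl_R[OF G] IH(3), unfolded sl_D]
      slb.edge_fun_lift[OF IH(1,2) X shape_F[OF k] shape_F[OF k] slb_R[OF G] slb_R[OF G] IH(3), unfolded slb_D]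
    note rets = id1.retractable_lift[OF IH(1,2)] id2.retractable_lift[OF IH(1,2)]
      sl.retractable_lift[OF IH(1,2)] slb.retractable_lift[OF IH(1,2)]
    note tys = id1.typed_lift_edge[OF IH(1)] id2.typed_lift_edge[OF IH(1)]
      sl.typed_lift_edge[OF IH(1)] slb.typed_lift_edge[OF IH(1)]
    show ?thesis
      using N lifts rets tys by (simp add: Let_def ins del: Diff_insert0 insert_Diff_if)
  qed
  ultimately show ?case by blast
qed

end

lemma dirs_Suc: "dirs (Suc k) = insert (Dir (Suc k)) (insert (Dir' (Suc k)) (dirs k))"
  unfolding dirs_def by (auto simp: atLeastAtMostSuc_conv)

text \<open>With \<open>G_edge_eq\<close>: the groupoid cube is the subcube of the homogeneous one
  spanned by the unprimed directions, so restricting a homogeneous law makes sense.\<close>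

lemma G_vertex_eq: "G_vertex sc U k \<alpha> = H_vertex sc U k (Dir ` \<alpha>)"
proof (induction k arbitrary: \<alpha>)
  case (Suc k)
  have "Dir ` \<alpha> - {Dir (Suc k), Dir' (Suc k)} = Dir ` (\<alpha> - {Suc k})" by auto
  moreover have "\<alpha> - {Suc k} = \<alpha>" if "Suc k \<notin> \<alpha>" using that by simp
  ultimately show ?case using Suc.IH by (auto simp: Let_def)
qed simp

lemma G_edge_eq: "G_edge k \<beta> i = H_edge k (Dir ` \<beta>) (Dir i)"
proof (induction k arbitrary: \<beta> i)
  case (Suc k)
  have "Dir ` \<beta> - {Dir (Suc k), Dir' (Suc k)} = Dir ` (\<beta> - {Suc k})" by auto
  moreover have "\<beta> - {Suc k} = \<beta>" if "Suc k \<notin> \<beta>" using that by simp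
  ultimately show ?case using Suc.IH by (auto simp: Let_def)
qed simp

lemma H_cube_sel [simp]:
  "vertex (H_cube sc U k) = H_vertex sc U k"
  "source (H_cube sc U k) \<beta> i = ev sc (esource (H_edge k \<beta> i))"
  "target (H_cube sc U k) \<beta> i = ev sc (etarget (H_edge k \<beta> i))"
  "unit (H_cube sc U k) \<beta> i = ev sc (eunit (H_edge k \<beta> i))"
  "mult (H_cube sc U k) \<beta> i g' g = ev sc (emult (H_edge k \<beta> i)) (g' \<bowtie> g)"
  by (simp_all add: H_cube_def poly_cube_def)

lemma G_cube_sel [simp]:
  "vertex (G_cube sc U k) = G_vertex sc U k"
  "source (G_cube sc U k) \<beta> i = ev sc (esource (G_edge k \<beta> i))"
  "target (G_cube sc U k) \<beta> i = ev sc (etarget (G_edge k \<beta> i))"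
  "unit (G_cube sc U k) \<beta> i = ev sc (eunit (G_edge k \<beta> i))"
  "mult (G_cube sc U k) \<beta> i g' g = ev sc (emult (G_edge k \<beta> i)) (g' \<bowtie> g)"
  by (simp_all add: G_cube_def poly_cube_def)

context cn_map
begin

text \<open>The restrictions make the family extensional in level, vertex and point, as membership
  in the set of laws demands.\<close>

definition H_law :: "nat \<Rightarrow> dir set \<Rightarrow> ('v, 'k) pt \<Rightarrow> ('w, 'k) pt" where
  "H_law = (\<lambda>k\<in>{k. enat k \<le> n}. \<lambda>\<alpha>\<in>Pow (dirs k). \<lambda>z\<in>X k \<alpha>. F k \<alpha> z)"

lemma H_law_eq: "enat k \<le> n \<Longrightarrow> \<alpha> \<subseteq> dirs k \<Longrightarrow> z \<in> X k \<alpha> \<Longrightarrow> H_law k \<alpha> z = F k \<alpha> z"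
  by (simp add: H_law_def)

lemma H_law_morphism:
  assumes k: "enat k \<le> n"
  shows "H_law k \<in> cube_morphisms (dirs k) (H_cube scV U k) (H_cube scW U' k)"
proof -
  have "edge_functor (H_cube scV U k) (H_cube scW U' k) (H_law k) \<beta> i"
    if i: "i \<in> dirs k" and \<beta>: "\<beta> \<subseteq> dirs k - {i}" for i \<beta>
  proof -
    have sub: "\<beta> \<subseteq> dirs k" "insert i \<beta> \<subseteq> dirs k" "i \<notin> \<beta>" using i \<beta> by blast+
    have "edge_fun scV scW (H_edge k \<beta> i) (X k \<beta>) (X k (insert i \<beta>)) (F k \<beta>) (F k (insert i \<beta>))"
      using H_edge_fun[OF k i sub(3)] by blast
    then show ?thesis
      unfolding edge_fun_def edge_functor_def H_cube_sel G_cube_sel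
      by (simp add: H_law_eq[OF k sub(1)] H_law_eq[OF k sub(2)])
  qed
  moreover have "H_law k \<in> (\<Pi>\<^sub>E \<alpha>\<in>Pow (dirs k). X k \<alpha> \<rightarrow>\<^sub>E H_vertex scW U' k \<alpha>)"
    unfolding H_law_def using k F_vertex[OF k] by auto
  ultimately show ?thesis by (simp add: cube_morphisms_def)
qed

lemma H_law_in_laws: "H_law \<in> continuous_homogeneous_laws scV scW n U U'"
proof -
  have mor: "H_law \<in> (\<Pi>\<^sub>E k\<in>{k. enat k \<le> n}. cube_morphisms (dirs k) (H_cube scV U k) (H_cube scW U' k))"
  proof (rule PiE_I)
    show "H_law k = undefined" if "k \<notin> {k. enat k \<le> n}" for k
      using that by (simp add: H_law_def)
  qed (simp add: H_law_morphism)
  have cont: "continuous_on (X k \<alpha>) (H_law k \<alpha>)" if k: "enat k \<le> n" and \<alpha>: "\<alpha> \<subseteq> dirs k" for k \<alpha>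
  proof -
    have "continuous_on (X k \<alpha>) (F k \<alpha>)"
      using smooth_F[of k 0 \<alpha>] k by simp
    then show ?thesis using H_law_eq[OF k \<alpha>] by (simp cong: continuous_on_cong)
  qed
  have id: "H_law (Suc k) \<alpha> (x \<bowtie> Scal t) = H_law k \<alpha> x \<bowtie> Scal t"
    if Suc_k: "enat (Suc k) \<le> n" and \<alpha>: "\<alpha> \<subseteq> dirs (Suc k)"
      and *: "Dir (Suc k) \<notin> \<alpha>" "Dir' (Suc k) \<notin> \<alpha>" "x \<in> X k \<alpha>" for k \<alpha> x t
  proof -
    have k: "enat k \<le> n" using Suc_k by (rule enat_SucD)
    have \<alpha>': "\<alpha> \<subseteq> dirs k" using \<alpha> *(1,2) unfolding dirs_Suc by blast
    have "x \<bowtie> Scal t \<in> X (Suc k) \<alpha>" using * by (simp add: times_scalars_def)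
    then show ?thesis
      using H_law_eq[OF Suc_k \<alpha>] H_law_eq[OF k \<alpha>' *(3)] *(1,2) by (simp add: lift_map_def)
  qed
  have scal: "\<exists>y w. H_law (Suc k) \<alpha> (x \<bowtie> v \<bowtie> Scal t) = y \<bowtie> w \<bowtie> Scal t"
    if "enat (Suc k) \<le> n" "\<alpha> \<subseteq> dirs (Suc k)"
      "Dir (Suc k) \<in> \<alpha>" "Dir' (Suc k) \<notin> \<alpha>" "x \<bowtie> v \<bowtie> Scal t \<in> X (Suc k) \<alpha>" for k \<alpha> x v t
    unfolding H_law_eq[OF that(1,2,5)] using that(3,4) by (simp add: lift_slope_def Let_def)
  have scal': "\<exists>y. H_law (Suc k) \<alpha> (x \<bowtie> Scal s \<bowtie> Scal t) = y \<bowtie> Scal s \<bowtie> Scal t"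
    if "enat (Suc k) \<le> n" "\<alpha> \<subseteq> dirs (Suc k)"
      "Dir (Suc k) \<notin> \<alpha>" "Dir' (Suc k) \<in> \<alpha>" "x \<bowtie> Scal s \<bowtie> Scal t \<in> X (Suc k) \<alpha>" for k \<alpha> x s t
    unfolding H_law_eq[OF that(1,2,5)] using that(3,4) by (simp add: lift_map_def Let_def)
  have scal_bar: "\<exists>y w. H_law (Suc k) \<alpha> (x \<bowtie> v \<bowtie> Scal s \<bowtie> Scal t) = y \<bowtie> w \<bowtie> Scal s \<bowtie> Scal t"
    if "enat (Suc k) \<le> n" "\<alpha> \<subseteq> dirs (Suc k)"
      "Dir (Suc k) \<in> \<alpha>" "Dir' (Suc k) \<in> \<alpha>" "x \<bowtie> v \<bowtie> Scal s \<bowtie> Scal t \<in> X (Suc k) \<alpha>" for k \<alpha> x v s t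
    unfolding H_law_eq[OF that(1,2,5)] using that(3,4) by (simp add: lift_slope_bar_def Let_def)
  show ?thesis
    unfolding continuous_homogeneous_laws_def homogeneous_laws_def H_cube_sel mem_Collect_eq
    by (intro conjI allI impI ballI; (rule mor cont id scal scal' scal_bar; assumption))
qed

lemma base_H_law: "x \<in> U \<Longrightarrow> base_map U H_law x = f x"
  using H_law_eq[of 0 "{}" "Vec x"] by (simp add: base_map_def zero_enat_def[symmetric])

end

section \<open>Restriction to the unprimed directions\<close>

definition restrict_law :: "enat \<Rightarrow> (nat \<Rightarrow> dir set \<Rightarrow> 'a \<Rightarrow> 'b) \<Rightarrow> nat \<Rightarrow> nat set \<Rightarrow> 'a \<Rightarrow> 'b" where
  "restrict_law n F = (\<lambda>k\<in>{k. enat k \<le> n}. \<lambda>\<alpha>\<in>Pow {1..k}. F k (Dir ` \<alpha>))"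

lemma restrict_law_in_laws:
  assumes F: "F \<in> continuous_homogeneous_laws scV scW n U U'"
  shows "restrict_law n F \<in> continuous_laws scV scW n U U'"
proof -
  have dirs: "Dir ` \<alpha> \<subseteq> dirs k" if "\<alpha> \<subseteq> {1..k}" for \<alpha> k
    using that by (auto simp: dirs_def)
  have eq: "restrict_law n F k \<alpha> = F k (Dir ` \<alpha>)" if "enat k \<le> n" "\<alpha> \<subseteq> {1..k}" for k \<alpha>
    using that by (simp add: restrict_law_def)
  have mor: "F k \<in> cube_morphisms (dirs k) (H_cube scV U k) (H_cube scW U' k)" if "enat k \<le> n" for k
    using F that unfolding continuous_homogeneous_laws_def homogeneous_laws_def by blast
  have id: "F (Suc k) \<alpha> (x \<bowtie> Scal t) = F k \<alpha> x \<bowtie> Scal t"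
    if "enat (Suc k) \<le> n" "\<alpha> \<subseteq> dirs (Suc k)" "Dir (Suc k) \<notin> \<alpha>" "Dir' (Suc k) \<notin> \<alpha>"
      "x \<in> H_vertex scV U k \<alpha>" for k \<alpha> x t
    using F that unfolding continuous_homogeneous_laws_def homogeneous_laws_def H_cube_sel by simp
  have cont: "continuous_on (H_vertex scV U k \<alpha>) (F k \<alpha>)" if "enat k \<le> n" "\<alpha> \<subseteq> dirs k" for k \<alpha>
    using F that unfolding continuous_homogeneous_laws_def H_cube_sel by simp
  have "restrict_law n F k \<in> cube_morphisms {1..k} (G_cube scV U k) (G_cube scW U' k)" if k: "enat k \<le> n" for k
  proof -
    have FP: "F k \<in> (\<Pi>\<^sub>E \<alpha>\<in>Pow (dirs k). H_vertex scV U k \<alpha> \<rightarrow>\<^sub>E H_vertex scW U' k \<alpha>)"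
      and FE: "\<And>i \<beta>. i \<in> dirs k \<Longrightarrow> \<beta> \<subseteq> dirs k - {i} \<Longrightarrow>
        edge_functor (H_cube scV U k) (H_cube scW U' k) (F k) \<beta> i"
      using mor[OF k] by (simp_all add: cube_morphisms_def)
    have "restrict_law n F k \<in> (\<Pi>\<^sub>E \<alpha>\<in>Pow {1..k}. G_vertex scV U k \<alpha> \<rightarrow>\<^sub>E G_vertex scW U' k \<alpha>)"
    proof (rule PiE_I)
      fix \<alpha> assume "\<alpha> \<in> Pow {1..k}"
      then show "restrict_law n F k \<alpha> \<in> G_vertex scV U k \<alpha> \<rightarrow>\<^sub>E G_vertex scW U' k \<alpha>"
        using PiE_mem[OF FP, of "Dir ` \<alpha>"] dirs[of \<alpha> k] eq[OF k, of \<alpha>] by (simp add: G_vertex_eq)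
    next
      fix \<alpha> assume "\<alpha> \<notin> Pow {1..k}"
      then show "restrict_law n F k \<alpha> = undefined" using k by (simp add: restrict_law_def)
    qed
    moreover have "edge_functor (G_cube scV U k) (G_cube scW U' k) (restrict_law n F k) \<beta> i"
      if i: "i \<in> {1..k}" and \<beta>: "\<beta> \<subseteq> {1..k} - {i}" for i \<beta>
    proof -
      have sub: "\<beta> \<subseteq> {1..k}" "insert i \<beta> \<subseteq> {1..k}" using i \<beta> by blast+
      have "Dir i \<in> dirs k" "Dir ` \<beta> \<subseteq> dirs k - {Dir i}" using i \<beta> by (auto simp: dirs_def)
      then have "edge_functor (H_cube scV U k) (H_cube scW U' k) (F k) (Dir ` \<beta>) (Dir i)"
        by (rule FE)
      then show ?thesis
        unfolding edge_functor_def H_cube_sel G_cube_sel G_vertex_eq G_edge_eq eq[OF k sub(1)] eq[OF k sub(2)]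
        by simp
    qed
    ultimately show ?thesis by (simp add: cube_morphisms_def)
  qed
  then have mor': "restrict_law n F \<in> (\<Pi>\<^sub>E k\<in>{k. enat k \<le> n}. cube_morphisms {1..k} (G_cube scV U k) (G_cube scW U' k))"
    by (auto simp: PiE_iff extensional_def restrict_law_def)
  have id': "restrict_law n F (Suc k) \<alpha> (x \<bowtie> Scal t) = restrict_law n F k \<alpha> x \<bowtie> Scal t"
    if k: "enat (Suc k) \<le> n" "\<alpha> \<subseteq> {1..Suc k}" "Suc k \<notin> \<alpha>" "x \<in> G_vertex scV U k \<alpha>" for k \<alpha> x t
  proof -
    have k': "enat k \<le> n" using k(1) by (rule enat_SucD)
    have \<alpha>: "\<alpha> \<subseteq> {1..k}" using k(2,3) by (auto simp: le_Suc_eq)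
    have "Dir ` \<alpha> \<subseteq> dirs (Suc k)" "Dir (Suc k) \<notin> Dir ` \<alpha>" "Dir' (Suc k) \<notin> Dir ` \<alpha>"
      using k(3) dirs[OF k(2)] by auto
    then show ?thesis
      using id[OF k(1)] k(4) unfolding eq[OF k(1,2)] eq[OF k' \<alpha>] G_vertex_eq by simp
  qed
  have cont': "continuous_on (G_vertex scV U k \<alpha>) (restrict_law n F k \<alpha>)"
    if "enat k \<le> n" "\<alpha> \<subseteq> {1..k}" for k \<alpha>
    using cont[OF that(1) dirs[OF that(2)]] eq[OF that] by (simp add: G_vertex_eq)
  show ?thesis
    unfolding continuous_laws_def laws_def G_cube_sel mem_Collect_eq
    by (intro conjI allI impI ballI; (rule mor' cont' id'; assumption))
qed

lemma base_restrict_law: "base_map U (restrict_law n F) = base_map U F"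
  by (simp add: base_map_def restrict_law_def zero_enat_def[symmetric])

section \<open>The base map of a law\<close>

lemma Cn_mono: "Cn scV scW U f n \<Longrightarrow> m \<le> n \<Longrightarrow> Cn scV scW U f m"
  by (induction n) (auto simp: le_Suc_eq)

context dense_modules
begin

lemma open_slope_dom: "open U \<Longrightarrow> open (slope_dom scV U k) \<and> (\<exists>a. slope_dom scV U k \<subseteq> {x. shape x = a})"
proof (induction k)
  case (Suc k)
  then obtain a where "slope_dom scV U k \<subseteq> {x. shape x = a}" "open (slope_dom scV U k)" by blast
  then show ?case
    using V.open_ext1[of "slope_dom scV U k" a] shape_ext1[of "slope_dom scV U k" a scV]
    by (intro conjI exI[of _ "a \<bowtie> a \<bowtie> Scal ()"]) simp_all
qed (auto simp: open_Vec_image)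

text \<open>The argument of \<open>slope_unique\<close>, for maps into \<open>W\<close> instead of
  trees. It pins down the slopes that \<open>slope\<close> picks by \<open>SOME\<close>.\<close>

lemma is_slope_unique:
  assumes "is_slope scV scW X f g" "is_slope scV scW X f h" "open X" "z \<in> ext1 scV X"
  shows "g z = h z"
proof -
  obtain x v t where z: "z = x \<bowtie> v \<bowtie> Scal t" "x \<in> X" "shape v = shape x" "padd x (pscale scV t v) \<in> X"
    using assms(4) by (rule ext1E)
  have c: "continuous_on (ext1 scV X) g" "continuous_on (ext1 scV X) h"
    using assms(1,2) by (auto simp: is_slope_def)
  have "g (x \<bowtie> v \<bowtie> Scal u) = h (x \<bowtie> v \<bowtie> Scal u)"
    if u: "u \<in> {t. padd x (pscale scV t v) \<in> X}" "u dvd 1" for u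
  proof -
    obtain r where "1 = u * r" using u(2) by (elim dvdE)
    then show ?thesis using assms(1,2) u(1) z by (simp add: is_slope_def ext1_iff)
  qed
  from dense_eq[OF V.open_line[OF assms(3) z(3)] continuous_on_line_slope[OF c(1) z(2,3)]
      continuous_on_line_slope[OF c(2) z(2,3)] this, of t]
  show ?thesis using z by simp
qed

text \<open>\<open>is_slope\<close> gives the equation at units only; both sides are continuous in
  \<open>t\<close>, so density extends it to all scalars.\<close>

lemma is_slope_imp_slope_of:
  assumes g: "is_slope scV scW X f g" and f: "continuous_on X f" and X: "open X"
  shows "slope_of scV scW X (\<lambda>z. Vec (f z)) (\<lambda>z. Vec (g z))"
proof (rule slope_ofI)
  show "continuous_on X (\<lambda>z. Vec (f z) :: ('w, 'k) pt)" by (rule continuous_on_Vec[OF f])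
  have cg: "continuous_on (ext1 scV X) g" using g by (simp add: is_slope_def)
  show "continuous_on (ext1 scV X) (\<lambda>z. Vec (g z) :: ('w, 'k) pt)" by (rule continuous_on_Vec[OF cg])
  fix x v t assume x: "x \<in> X" "shape v = shape x" "padd x (pscale scV t v) \<in> X"
  let ?T = "{t. padd x (pscale scV t v) \<in> X}"
  have c1: "continuous_on ?T (\<lambda>t. f (padd x (pscale scV t v)))"
    by (rule continuous_on_compose2[OF f V.continuous_on_line[OF x(2)]]) auto
  have c2: "continuous_on ?T (\<lambda>t. f x + scW t (g (x \<bowtie> v \<bowtie> Scal t)))"
    by (intro continuous_on_add continuous_on_const W.continuous_on_scale continuous_on_id
        continuous_on_line_slope[OF cg x(1,2)])
  have "f (padd x (pscale scV u v)) = f x + scW u (g (x \<bowtie> v \<bowtie> Scal u))" if u: "u \<in> ?T" "u dvd 1" for u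
  proof -
    obtain r where r: "1 = u * r" using u(2) by (elim dvdE)
    then show ?thesis using g u(1) x by (simp add: is_slope_def ext1_iff)
  qed
  from dense_eq[OF V.open_line[OF X x(2)] c1 c2 this, of t]
  show "shape (Vec (g (x \<bowtie> v \<bowtie> Scal t)) :: ('w, 'k) pt) = shape (Vec (f x) :: ('w, 'k) pt) \<and>
      (Vec (f (padd x (pscale scV t v))) :: ('w, 'k) pt) =
      padd (Vec (f x)) (pscale scW t (Vec (g (x \<bowtie> v \<bowtie> Scal t))))"
    using x by simp
qed

lemma is_slope_slope:
  assumes "Cn scV scW U f (Suc k)"
  shows "is_slope scV scW (slope_dom scV U k) (slope scV scW U f k) (slope scV scW U f (Suc k))"
  using assms someI_ex[of "is_slope scV scW (slope_dom scV U k) (slope scV scW U f k)"]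
  by (auto simp: C1_def)

lemma continuous_on_slope: "Cn scV scW U f k \<Longrightarrow> continuous_on (slope_dom scV U k) (slope scV scW U f k)"
proof (cases k)
  case 0
  assume "Cn scV scW U f k"
  then show ?thesis
    unfolding 0 slope_dom.simps slope.simps Cn.simps
    by (intro continuous_on_compose continuous_on_the_vec continuous_on_id) (auto simp: image_image)
next
  case (Suc j)
  assume "Cn scV scW U f k"
  then show ?thesis using is_slope_slope[of U f j] Suc by (simp add: is_slope_def)
qed

text \<open>If \<open>f\<close> has class \<open>j + m\<close>, its chosen slope of order
  \<open>j\<close> has \<open>m\<close> orders left. Induction on \<open>m\<close> with
  \<open>j\<close> arbitrary moves along the chain of slopes; \<open>j = 0\<close> is the case of
  interest.\<close>

lemma Cn_imp_smooth:
  "open U \<Longrightarrow> Cn scV scW U f (j + m) \<Longrightarrow>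
    smooth scV scW m (slope_dom scV U j) (\<lambda>z. Vec (slope scV scW U f j z))"
proof (induction m arbitrary: j)
  case 0
  then show ?case by (simp add: continuous_on_Vec continuous_on_slope)
next
  case (Suc m)
  have C: "Cn scV scW U f j" "Cn scV scW U f (Suc j)" by (rule Cn_mono[OF Suc.prems(2)]; simp)+
  have "slope_of scV scW (slope_dom scV U j) (\<lambda>z. Vec (slope scV scW U f j z))
      (\<lambda>z. Vec (slope scV scW U f (Suc j) z))"
    using is_slope_slope[OF C(2)] continuous_on_slope[OF C(1)] open_slope_dom[OF Suc.prems(1)]
    by (intro is_slope_imp_slope_of) auto
  moreover have "smooth scV scW m (ext1 scV (slope_dom scV U j)) (\<lambda>z. Vec (slope scV scW U f (Suc j) z))"
    using Suc.IH[of "Suc j"] Suc.prems by simp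
  ultimately show ?case by auto
qed

end

section \<open>Iterated difference quotients inside a law\<close>

lemma slope_dom_eq: "slope_dom sc U k = G_vertex sc U k {1..k}"
proof (induction k)
  case (Suc k)
  have "{1..Suc k} - {Suc k} = {1..k}" by auto
  then show ?case using Suc.IH by simp
qed simp

text \<open>The \<open>W\<close>-coordinate of a point of the top vertex at which a law carries \<open>f\<^sup>[\<^sup>k\<^sup>]\<close>.\<close>

primrec last_slope :: "nat \<Rightarrow> ('w, 'k) pt \<Rightarrow> 'w" where
  "last_slope 0 z = the_vec z"
| "last_slope (Suc k) z = last_slope k (pfst (psnd z))"

primrec slope_shape :: "nat \<Rightarrow> shape" where
  "slope_shape 0 = Vec ()"
| "slope_shape (Suc k) = slope_shape k \<bowtie> slope_shape k \<bowtie> Scal ()"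

lemma shape_slope_dom: "slope_dom sc U k \<subseteq> {x. shape x = slope_shape k}"
  by (induction k) (auto intro: shape_ext1[THEN subsetD, simplified])

text \<open>Together with \<open>last_slope_pscale\<close> this is linearity of the coordinate, by
  which it commutes with forming difference quotients.\<close>

lemma last_slope_padd: "shape y = slope_shape k \<Longrightarrow> shape z = slope_shape k \<Longrightarrow>
    last_slope k (padd y z) = last_slope k y + last_slope k z"
proof (induction k arbitrary: y z)
  case (Suc k)
  obtain y1 y2 y3 where y: "y = y1 \<bowtie> y2 \<bowtie> y3" "shape y2 = slope_shape k"
    using Suc.prems(1) unfolding slope_shape.simps by (rule shape_JoinE3)
  obtain z1 z2 z3 where z: "z = z1 \<bowtie> z2 \<bowtie> z3" "shape z2 = slope_shape k"
    using Suc.prems(2) unfolding slope_shape.simps by (rule shape_JoinE3)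
  show ?case using y z Suc.IH by simp
qed auto

lemma last_slope_pscale: "shape z = slope_shape k \<Longrightarrow>
    last_slope k (pscale sc t z) = sc t (last_slope k z)"
proof (induction k arbitrary: z)
  case (Suc k)
  obtain z1 z2 z3 where z: "z = z1 \<bowtie> z2 \<bowtie> z3" "shape z2 = slope_shape k"
    using Suc.prems unfolding slope_shape.simps by (rule shape_JoinE3)
  show ?case using z Suc.IH by simp
qed auto

lemma continuous_on_last_slope:
  "continuous_on S f \<Longrightarrow> (\<And>x. x \<in> S \<Longrightarrow> shape (f x) = slope_shape k) \<Longrightarrow>
    continuous_on S (\<lambda>x. last_slope k (f x))"
proof (induction k arbitrary: f)
  case 0
  have "f x \<in> range Vec" if "x \<in> S" for x using 0(2)[OF that] by auto
  then show ?case unfolding last_slope.simps by (rule continuous_on_the_vec[OF 0(1)])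
next
  case (Suc k)
  have f: "\<exists>y z. f x = y \<bowtie> z" "\<exists>y z. psnd (f x) = y \<bowtie> z" "shape (pfst (psnd (f x))) = slope_shape k"
    if "x \<in> S" for x
    using Suc.prems(2)[OF that] unfolding slope_shape.simps by (elim shape_JoinE3; simp)+
  show ?case unfolding last_slope.simps
    by (rule Suc.IH[OF continuous_on_pfst[OF continuous_on_psnd[OF Suc.prems(1) f(1)] f(2)] f(3)])
qed

lemma lawsD:
  assumes F: "F \<in> continuous_laws scV scW n U U'" and k: "enat k \<le> n" and \<alpha>: "\<alpha> \<subseteq> {1..k}"
  shows "F k \<alpha> \<in> G_vertex scV U k \<alpha> \<rightarrow>\<^sub>E G_vertex scW U' k \<alpha>"
    and "continuous_on (G_vertex scV U k \<alpha>) (F k \<alpha>)"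
    and "i \<in> {1..k} \<Longrightarrow> i \<notin> \<alpha> \<Longrightarrow> edge_functor (G_cube scV U k) (G_cube scW U' k) (F k) \<alpha> i"
proof -
  have "F k \<in> cube_morphisms {1..k} (G_cube scV U k) (G_cube scW U' k)"
    using F k unfolding continuous_laws_def laws_def by blast
  then have m: "F k \<in> (\<Pi>\<^sub>E \<alpha>\<in>Pow {1..k}. G_vertex scV U k \<alpha> \<rightarrow>\<^sub>E G_vertex scW U' k \<alpha>)"
    and e: "\<And>i \<beta>. i \<in> {1..k} \<Longrightarrow> \<beta> \<subseteq> {1..k} - {i} \<Longrightarrow>
      edge_functor (G_cube scV U k) (G_cube scW U' k) (F k) \<beta> i"
    by (simp_all add: cube_morphisms_def)
  show "F k \<alpha> \<in> G_vertex scV U k \<alpha> \<rightarrow>\<^sub>E G_vertex scW U' k \<alpha>" using PiE_mem[OF m, of \<alpha>] \<alpha> by simp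
  show "continuous_on (G_vertex scV U k \<alpha>) (F k \<alpha>)"
    using F k \<alpha> unfolding continuous_laws_def G_cube_sel by blast
  show "edge_functor (G_cube scV U k) (G_cube scW U' k) (F k) \<alpha> i" if "i \<in> {1..k}" "i \<notin> \<alpha>"
    by (rule e) (use that \<alpha> in blast)+
qed

lemma laws_base:
  assumes F: "F \<in> continuous_laws scV scW n U U'"
    and "enat (Suc k) \<le> n" "\<alpha> \<subseteq> {1..Suc k}" "Suc k \<notin> \<alpha>" "x \<in> G_vertex scV U k \<alpha>"
  shows "F (Suc k) \<alpha> (x \<bowtie> Scal t) = F k \<alpha> x \<bowtie> Scal t"
  using assms unfolding continuous_laws_def laws_def G_cube_sel by simp

lemma homogeneous_lawsD:
  assumes F: "F \<in> continuous_homogeneous_laws scV scW n U U'" and k: "enat k \<le> n" and \<alpha>: "\<alpha> \<subseteq> dirs k"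
  shows "F k \<alpha> \<in> H_vertex scV U k \<alpha> \<rightarrow>\<^sub>E H_vertex scW U' k \<alpha>"
    and "continuous_on (H_vertex scV U k \<alpha>) (F k \<alpha>)"
    and "i \<in> dirs k \<Longrightarrow> i \<notin> \<alpha> \<Longrightarrow> edge_functor (H_cube scV U k) (H_cube scW U' k) (F k) \<alpha> i"
proof -
  have "F k \<in> cube_morphisms (dirs k) (H_cube scV U k) (H_cube scW U' k)"
    using F k unfolding continuous_homogeneous_laws_def homogeneous_laws_def by blast
  then have m: "F k \<in> (\<Pi>\<^sub>E \<alpha>\<in>Pow (dirs k). H_vertex scV U k \<alpha> \<rightarrow>\<^sub>E H_vertex scW U' k \<alpha>)"
    and e: "\<And>i \<beta>. i \<in> dirs k \<Longrightarrow> \<beta> \<subseteq> dirs k - {i} \<Longrightarrow>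
      edge_functor (H_cube scV U k) (H_cube scW U' k) (F k) \<beta> i"
    by (simp_all add: cube_morphisms_def)
  show "F k \<alpha> \<in> H_vertex scV U k \<alpha> \<rightarrow>\<^sub>E H_vertex scW U' k \<alpha>" using PiE_mem[OF m, of \<alpha>] \<alpha> by simp
  show "continuous_on (H_vertex scV U k \<alpha>) (F k \<alpha>)"
    using F k \<alpha> unfolding continuous_homogeneous_laws_def H_cube_sel by blast
  show "edge_functor (H_cube scV U k) (H_cube scW U' k) (F k) \<alpha> i" if "i \<in> dirs k" "i \<notin> \<alpha>"
    by (rule e) (use that \<alpha> in blast)+
qed

lemma homogeneous_laws_base:
  assumes F: "F \<in> continuous_homogeneous_laws scV scW n U U'"
    and "enat (Suc k) \<le> n" "\<alpha> \<subseteq> dirs k" "x \<in> H_vertex scV U k \<alpha>"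
  shows "F (Suc k) \<alpha> (x \<bowtie> Scal t) = F k \<alpha> x \<bowtie> Scal t"
proof -
  have "Dir (Suc k) \<notin> \<alpha>" "Dir' (Suc k) \<notin> \<alpha>" "\<alpha> \<subseteq> dirs (Suc k)"
    using assms(3) by (auto simp: dirs_def)
  then show ?thesis
    using assms unfolding continuous_homogeneous_laws_def homogeneous_laws_def H_cube_sel by simp
qed

lemma homogeneous_laws_scalars:
  assumes F: "F \<in> continuous_homogeneous_laws scV scW n U U'"
    and "enat (Suc k) \<le> n" "\<alpha> \<subseteq> dirs (Suc k)" "Dir' (Suc k) \<in> \<alpha>"
  shows "Dir (Suc k) \<notin> \<alpha> \<Longrightarrow> x \<bowtie> Scal s \<bowtie> Scal t \<in> H_vertex scV U (Suc k) \<alpha> \<Longrightarrow>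
      \<exists>y. F (Suc k) \<alpha> (x \<bowtie> Scal s \<bowtie> Scal t) = y \<bowtie> Scal s \<bowtie> Scal t"
    and "Dir (Suc k) \<in> \<alpha> \<Longrightarrow> x \<bowtie> v \<bowtie> Scal s \<bowtie> Scal t \<in> H_vertex scV U (Suc k) \<alpha> \<Longrightarrow>
      \<exists>y w. F (Suc k) \<alpha> (x \<bowtie> v \<bowtie> Scal s \<bowtie> Scal t) = y \<bowtie> w \<bowtie> Scal s \<bowtie> Scal t"
proof -
  note * = F[unfolded continuous_homogeneous_laws_def homogeneous_laws_def H_cube_sel mem_Collect_eq,
      THEN conjunct1, THEN conjunct2, rule_format, OF assms(2,3)]
  show "\<exists>y. F (Suc k) \<alpha> (x \<bowtie> Scal s \<bowtie> Scal t) = y \<bowtie> Scal s \<bowtie> Scal t"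
    if "Dir (Suc k) \<notin> \<alpha>" "x \<bowtie> Scal s \<bowtie> Scal t \<in> H_vertex scV U (Suc k) \<alpha>"
    using * that assms(4) by blast
  show "\<exists>y w. F (Suc k) \<alpha> (x \<bowtie> v \<bowtie> Scal s \<bowtie> Scal t) = y \<bowtie> w \<bowtie> Scal s \<bowtie> Scal t"
    if "Dir (Suc k) \<in> \<alpha>" "x \<bowtie> v \<bowtie> Scal s \<bowtie> Scal t \<in> H_vertex scV U (Suc k) \<alpha>"
    using * that assms(4) by blast
qed

context dense_modules
begin

text \<open>Stated for bare maps \<open>FA\<close> and \<open>FB\<close>, because laws of both kinds
  contain edges of type \<open>edge1\<close>; \<open>law_slope\<close> and
  \<open>homogeneous_law_slope\<close> are its two instances.\<close>

lemma edge1_slope: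
  assumes F: "continuous_on X F" and FB: "continuous_on (ext1 scV X) FB" "\<And>z. z \<in> ext1 scV X \<Longrightarrow> FB z \<in> ext1 scW Y"
    and FA: "\<And>x t. x \<in> X \<Longrightarrow> FA (x \<bowtie> Scal t) = F x \<bowtie> Scal t"
    and st: "\<And>z. z \<in> ext1 scV X \<Longrightarrow> ev scW (esource edge1) (FB z) = FA (ev scV (esource edge1) z) \<and>
      ev scW (etarget edge1) (FB z) = FA (ev scV (etarget edge1) z)"
  defines "G \<equiv> \<lambda>z. pfst (psnd (FB z))"
  shows "slope_of scV scW X F G" and "z \<in> ext1 scV X \<Longrightarrow> FB z = lift_slope F G z"
proof -
  have *: "FB (x \<bowtie> v \<bowtie> Scal t) = F x \<bowtie> G (x \<bowtie> v \<bowtie> Scal t) \<bowtie> Scal t \<and>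
      shape (G (x \<bowtie> v \<bowtie> Scal t)) = shape (F x) \<and>
      F (padd x (pscale scV t v)) = padd (F x) (pscale scW t (G (x \<bowtie> v \<bowtie> Scal t)))"
    if x: "x \<in> X" "shape v = shape x" "padd x (pscale scV t v) \<in> X" for x v t
  proof -
    have z: "x \<bowtie> v \<bowtie> Scal t \<in> ext1 scV X" using x by (simp add: ext1_iff)
    obtain y w t' where y: "FB (x \<bowtie> v \<bowtie> Scal t) = y \<bowtie> w \<bowtie> Scal t'" "shape w = shape y"
      using FB(2)[OF z] by (rule ext1E)
    have "y = F x \<and> t' = t \<and> padd y (pscale scW t' w) = F (padd x (pscale scV t v))"
      using st[OF z] FA[OF x(1), of t] FA[OF x(3), of t] y(1) by (auto simp: edge1_def)
    then have e: "y = F x" "t' = t" "F (padd x (pscale scV t v)) = padd y (pscale scW t' w)"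
      by auto
    show ?thesis
      using y e(3) unfolding G_def e(1,2) by simp
  qed
  have c: "continuous_on (ext1 scV X) G"
    unfolding G_def
  proof (intro continuous_on_pfst continuous_on_psnd FB(1))
    fix z assume "z \<in> ext1 scV X"
    from FB(2)[OF this] obtain y w t' where "FB z = y \<bowtie> w \<bowtie> Scal t'" by (rule ext1E)
    then show "\<exists>y z'. FB z = y \<bowtie> z'" "\<exists>y z'. psnd (FB z) = y \<bowtie> z'" by simp_all
  qed
  show "slope_of scV scW X F G" by (rule slope_ofI[OF F c]) (use * in blast)
  show "FB z = lift_slope F G z" if "z \<in> ext1 scV X"
    using that by (rule ext1E) (simp add: * lift_slope_def)
qed

lemma law_slope:
  assumes F: "F \<in> continuous_laws scV scW n U U'" and k: "enat (Suc k) \<le> n" and \<alpha>: "\<alpha> \<subseteq> {1..k}"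
  defines "G \<equiv> \<lambda>z. pfst (psnd (F (Suc k) (insert (Suc k) \<alpha>) z))"
  shows "slope_of scV scW (G_vertex scV U k \<alpha>) (F k \<alpha>) G"
    and "z \<in> ext1 scV (G_vertex scV U k \<alpha>) \<Longrightarrow>
      F (Suc k) (insert (Suc k) \<alpha>) z = lift_slope (F k \<alpha>) G z"
proof -
  have sub: "Suc k \<notin> \<alpha>" "\<alpha> \<subseteq> {1..Suc k}" "insert (Suc k) \<alpha> \<subseteq> {1..Suc k}" using \<alpha> by auto
  have "insert (Suc k) \<alpha> - {Suc k} = \<alpha>" using sub(1) by simp
  then have V: "G_vertex sc Y (Suc k) (insert (Suc k) \<alpha>) = ext1 sc (G_vertex sc Y k \<alpha>)"
    for sc :: "'k \<Rightarrow> 'x::plus \<Rightarrow> 'x" and Y by simp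
  have E: "G_edge (Suc k) \<alpha> (Suc k) = edge1" by simp
  have ef: "edge_functor (G_cube scV U (Suc k)) (G_cube scW U' (Suc k)) (F (Suc k)) \<alpha> (Suc k)"
    by (rule lawsD(3)[OF F k sub(2)]) (use sub in auto)
  have FB: "F (Suc k) (insert (Suc k) \<alpha>) z \<in> ext1 scW (G_vertex scW U' k \<alpha>)"
    if "z \<in> ext1 scV (G_vertex scV U k \<alpha>)" for z
    using PiE_mem[OF lawsD(1)[OF F k sub(3)], of z] that unfolding V by simp
  have st: "ev scW (esource edge1) (F (Suc k) (insert (Suc k) \<alpha>) z) = F (Suc k) \<alpha> (ev scV (esource edge1) z) \<and>
      ev scW (etarget edge1) (F (Suc k) (insert (Suc k) \<alpha>) z) = F (Suc k) \<alpha> (ev scV (etarget edge1) z)"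
    if "z \<in> ext1 scV (G_vertex scV U k \<alpha>)" for z
    using ef that unfolding edge_functor_def G_cube_sel V E by blast
  note * = edge1_slope[OF lawsD(2)[OF F enat_SucD[OF k] \<alpha>] lawsD(2)[OF F k sub(3), unfolded V] FB
      laws_base[OF F k sub(2,1)] st]
  show "slope_of scV scW (G_vertex scV U k \<alpha>) (F k \<alpha>) G" unfolding G_def by (rule *(1))
  show "F (Suc k) (insert (Suc k) \<alpha>) z = lift_slope (F k \<alpha>) G z"
    if "z \<in> ext1 scV (G_vertex scV U k \<alpha>)" unfolding G_def by (rule *(2)[OF _ _ _ that])
qed

lemma homogeneous_law_slope:
  assumes F: "F \<in> continuous_homogeneous_laws scV scW n U U'" and k: "enat (Suc k) \<le> n"
    and \<alpha>: "\<alpha> \<subseteq> dirs k"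
  defines "G \<equiv> \<lambda>z. pfst (psnd (F (Suc k) (insert (Dir (Suc k)) \<alpha>) z))"
  shows "slope_of scV scW (H_vertex scV U k \<alpha>) (F k \<alpha>) G"
    and "z \<in> ext1 scV (H_vertex scV U k \<alpha>) \<Longrightarrow>
      F (Suc k) (insert (Dir (Suc k)) \<alpha>) z = lift_slope (F k \<alpha>) G z"
proof -
  have sub: "Dir (Suc k) \<notin> \<alpha>" "Dir' (Suc k) \<notin> \<alpha>" using \<alpha> by (auto simp: dirs_def)
  have sub': "\<alpha> \<subseteq> dirs (Suc k)" "insert (Dir (Suc k)) \<alpha> \<subseteq> dirs (Suc k)" "Dir (Suc k) \<in> dirs (Suc k)"
    using \<alpha> by (auto simp: dirs_Suc)
  have "insert (Dir (Suc k)) \<alpha> - {Dir (Suc k), Dir' (Suc k)} = \<alpha>" using sub by blast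
  then have V: "H_vertex sc Y (Suc k) (insert (Dir (Suc k)) \<alpha>) = ext1 sc (H_vertex sc Y k \<alpha>)"
    for sc :: "'k \<Rightarrow> 'x::plus \<Rightarrow> 'x" and Y using sub by (simp add: Let_def)
  have E: "H_edge (Suc k) \<alpha> (Dir (Suc k)) = edge1" using sub by simp
  note ef = homogeneous_lawsD(3)[OF F k sub'(1,3) sub(1)]
  have FB: "F (Suc k) (insert (Dir (Suc k)) \<alpha>) z \<in> ext1 scW (H_vertex scW U' k \<alpha>)"
    if "z \<in> ext1 scV (H_vertex scV U k \<alpha>)" for z
    using PiE_mem[OF homogeneous_lawsD(1)[OF F k sub'(2)], of z] that unfolding V by simp
  have st: "ev scW (esource edge1) (F (Suc k) (insert (Dir (Suc k)) \<alpha>) z) =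
        F (Suc k) \<alpha> (ev scV (esource edge1) z) \<and>
      ev scW (etarget edge1) (F (Suc k) (insert (Dir (Suc k)) \<alpha>) z) =
        F (Suc k) \<alpha> (ev scV (etarget edge1) z)"
    if "z \<in> ext1 scV (H_vertex scV U k \<alpha>)" for z
    using ef that unfolding edge_functor_def H_cube_sel V E by blast
  note * = edge1_slope[OF homogeneous_lawsD(2)[OF F enat_SucD[OF k] \<alpha>]
      homogeneous_lawsD(2)[OF F k sub'(2), unfolded V] FB homogeneous_laws_base[OF F k \<alpha>] st]
  show "slope_of scV scW (H_vertex scV U k \<alpha>) (F k \<alpha>) G" unfolding G_def by (rule *(1))
  show "F (Suc k) (insert (Dir (Suc k)) \<alpha>) z = lift_slope (F k \<alpha>) G z"
    if "z \<in> ext1 scV (H_vertex scV U k \<alpha>)" unfolding G_def by (rule *(2)[OF _ _ _ that])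
qed

text \<open>The second conjunct drives the induction: the chosen slope of order \<open>k\<close> is
  the last \<open>W\<close>-coordinate of the vertex map at \<open>{1..k}\<close>, and the law
  supplies a continuous slope of that map at level \<open>Suc k\<close>.\<close>

lemma base_map_Cn:
  assumes F: "F \<in> continuous_laws scV scW n U U'" and U: "open U"
  shows "enat k \<le> n \<Longrightarrow> Cn scV scW U (base_map U F) k \<and>
    (\<forall>z\<in>slope_dom scV U k. slope scV scW U (base_map U F) k z = last_slope k (F k {1..k} z))"
proof (induction k)
  case 0
  have m: "F 0 {} \<in> Vec ` U \<rightarrow>\<^sub>E Vec ` U'" using lawsD(1)[OF F 0, of "{}"] by simp
  have "continuous_on (Vec ` U) (F 0 {})" using lawsD(2)[OF F 0, of "{}"] by simp
  then have "continuous_on U (\<lambda>x. F 0 {} (Vec x))"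
    by (rule continuous_on_compose2) (auto intro: continuous_on_Vec continuous_on_id)
  then have "continuous_on U (\<lambda>x. the_vec (F 0 {} (Vec x)))"
    by (rule continuous_on_the_vec) (use m in blast)
  then have "continuous_on U (base_map U F)" by (simp add: base_map_def cong: continuous_on_cong)
  then show ?case by (auto simp: base_map_def)
next
  case (Suc k)
  \<comment> \<open>Keeps \<open>{1..k}\<close> in the form in which the vertices of a law are
    indexed.\<close>
  note One_nat_def [simp del]
  let ?f = "base_map U F" and ?D = "slope_dom scV U k"
  have IH: "Cn scV scW U ?f k" "\<And>z. z \<in> ?D \<Longrightarrow> slope scV scW U ?f k z = last_slope k (F k {1..k} z)"
    using Suc.IH[OF enat_SucD[OF Suc.prems]] by blast+
  have full: "insert (Suc k) {1..k} = {1..Suc k}" by auto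
  define G where "G = (\<lambda>z. pfst (psnd (F (Suc k) {1..Suc k} z)))"
  have G: "slope_of scV scW ?D (F k {1..k}) G"
    using law_slope(1)[OF F Suc.prems order_refl] unfolding slope_dom_eq G_def full .
  have oD: "open ?D" using open_slope_dom[OF U] by blast
  have "F k {1..k} z \<in> slope_dom scW U' k" if "z \<in> ?D" for z
    using PiE_mem[OF lawsD(1)[OF F enat_SucD[OF Suc.prems] order_refl]] that unfolding slope_dom_eq by blast
  then have shF: "shape (F k {1..k} z) = slope_shape k" if "z \<in> ?D" for z
    using shape_slope_dom that by blast
  have shG: "shape (G z) = slope_shape k" if "z \<in> ext1 scV ?D" for z
    using that by (rule ext1E) (simp add: slope_ofD(3)[OF G] shF)
  have isl: "is_slope scV scW ?D (slope scV scW U ?f k) (\<lambda>z. last_slope k (G z))"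
    unfolding is_slope_def
  proof (intro conjI allI impI)
    show "continuous_on (ext1 scV ?D) (\<lambda>z. last_slope k (G z))"
      by (rule continuous_on_last_slope[OF slope_ofD(2)[OF G] shG])
    fix x v t r assume z: "x \<bowtie> v \<bowtie> Scal t \<in> ext1 scV ?D" and r: "t * r = 1"
    have x: "x \<in> ?D" "shape v = shape x" "padd x (pscale scV t v) \<in> ?D"
      using z by (auto simp: ext1_iff)
    have "last_slope k (F k {1..k} (padd x (pscale scV t v))) =
        last_slope k (F k {1..k} x) + scW t (last_slope k (G (x \<bowtie> v \<bowtie> Scal t)))"
      using slope_ofD(4)[OF G x] shF[OF x(1)] shG[OF z] by (simp add: last_slope_padd last_slope_pscale)
    then show "last_slope k (G (x \<bowtie> v \<bowtie> Scal t)) =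
        scW r (slope scV scW U ?f k (padd x (pscale scV t v)) - slope scV scW U ?f k x)"
      using r IH(2)[OF x(1)] IH(2)[OF x(3)] by (simp add: mult.commute)
  qed
  have C: "Cn scV scW U ?f (Suc k)"
    using IH(1) continuous_on_slope[OF IH(1)] isl by (auto simp: C1_def)
  \<comment> \<open>\<open>slope\<close> picks by \<open>SOME\<close>, but uniqueness forces the
    choice to be the slope found in the law.\<close>
  have "slope scV scW U ?f (Suc k) z = last_slope (Suc k) (F (Suc k) {1..Suc k} z)"
    if "z \<in> slope_dom scV U (Suc k)" for z
    using is_slope_unique[OF is_slope_slope[OF C] isl oD, of z] that by (simp add: G_def)
  then show ?case using C by blast
qed

lemma base_map_in_C_maps:
  assumes F: "F \<in> continuous_laws scV scW n U U'" and U: "open U"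
  shows "base_map U F \<in> C_maps scV scW n U U'"
proof -
  have "F 0 {} \<in> Vec ` U \<rightarrow>\<^sub>E Vec ` U'" using lawsD(1)[OF F, of 0 "{}"] by (simp add: zero_enat_def[symmetric])
  then have "the_vec (F 0 {} (Vec x)) \<in> U'" if "x \<in> U" for x
    using PiE_mem[of "F 0 {}" "Vec ` U" "\<lambda>_. Vec ` U'" "Vec x"] that by auto
  then show ?thesis using base_map_Cn[OF F U] by (auto simp: C_maps_def base_map_def)
qed

section \<open>Injectivity of the base map\<close>

lemma base_map_laws_inj:
  assumes U: "open U"
  shows "inj_on (base_map U) (continuous_laws scV scW n U U')"
proof (rule inj_onI)
  fix F F' assume F: "F \<in> continuous_laws scV scW n U U'" and F': "F' \<in> continuous_laws scV scW n U U'"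
    and eq: "base_map U F = base_map U F'"
  \<comment> \<open>At level \<open>Suc k\<close>, vertices without \<open>Suc k\<close> are
    determined by level \<open>k\<close>; at the others both laws provide slopes of maps that agree
    by induction, so the slopes agree.\<close>
  have *: "enat k \<le> n \<Longrightarrow> \<alpha> \<subseteq> {1..k} \<Longrightarrow> z \<in> G_vertex scV U k \<alpha> \<Longrightarrow> F k \<alpha> z = F' k \<alpha> z" for k \<alpha> z
  proof (induction k arbitrary: \<alpha> z)
    case 0
    then obtain x where x: "z = Vec x" "x \<in> U" by auto
    have "F 0 {} z \<in> Vec ` U'" "F' 0 {} z \<in> Vec ` U'"
      using PiE_mem[OF lawsD(1)[OF F, of 0 "{}"], of z] PiE_mem[OF lawsD(1)[OF F', of 0 "{}"], of z] 0 x
      by simp_all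
    moreover have "the_vec (F 0 {} z) = the_vec (F' 0 {} z)"
      using fun_cong[OF eq, of x] x by (simp add: base_map_def)
    ultimately show ?case using 0 by auto
  next
    case (Suc k)
    note k = enat_SucD[OF Suc.prems(1)]
    show ?case
    proof (cases "Suc k \<in> \<alpha>")
      case False
      then have \<alpha>: "\<alpha> \<subseteq> {1..k}" using Suc.prems(2) by (auto simp: le_Suc_eq)
      obtain x t where z: "z = x \<bowtie> Scal t" "x \<in> G_vertex scV U k \<alpha>"
        using Suc.prems(3) False by (auto simp: times_scalars_def)
      then show ?thesis
        using laws_base[OF F Suc.prems(1,2) False z(2)] laws_base[OF F' Suc.prems(1,2) False z(2)]
          Suc.IH[OF k \<alpha> z(2)] by simp
    next
      case True
      define \<beta> where "\<beta> = \<alpha> - {Suc k}"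
      have \<beta>: "\<alpha> = insert (Suc k) \<beta>" "\<beta> \<subseteq> {1..k}"
        using True Suc.prems(2) by (auto simp: \<beta>_def le_Suc_eq)
      have z: "z \<in> ext1 scV (G_vertex scV U k \<beta>)"
        using Suc.prems(3) True by (simp add: \<beta>_def)
      have zp: "pfst z \<in> G_vertex scV U k \<beta>" using z by (auto simp: ext1_def)
      have oX: "open (G_vertex scV U k \<beta>)" unfolding G_vertex_eq by (rule V.open_H_vertex[OF U])
      have "pfst (psnd (F (Suc k) (insert (Suc k) \<beta>) z)) = pfst (psnd (F' (Suc k) (insert (Suc k) \<beta>) z))"
        by (rule slope_unique[OF law_slope(1)[OF F Suc.prems(1) \<beta>(2)] law_slope(1)[OF F' Suc.prems(1) \<beta>(2)]
              Suc.IH[OF k \<beta>(2)] oX z])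
      then show ?thesis
        using law_slope(2)[OF F Suc.prems(1) \<beta>(2) z] law_slope(2)[OF F' Suc.prems(1) \<beta>(2) z]
          Suc.IH[OF k \<beta>(2) zp] unfolding \<beta>(1) lift_slope_def by simp
    qed
  qed
  have L: "F \<in> (\<Pi>\<^sub>E k\<in>{k. enat k \<le> n}. \<Pi>\<^sub>E \<alpha>\<in>Pow {1..k}. G_vertex scV U k \<alpha> \<rightarrow>\<^sub>E G_vertex scW U' k \<alpha>)"
    if "F \<in> continuous_laws scV scW n U U'" for F
    using that unfolding continuous_laws_def laws_def cube_morphisms_def G_cube_sel
    by (auto simp: PiE_iff)
  \<comment> \<open>Laws are extensional in level, vertex and point, so agreement on the vertex sets
    is equality.\<close>
  show "F = F'"
  proof (rule PiE_ext[OF L[OF F] L[OF F']])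
    fix k assume k: "k \<in> {k. enat k \<le> n}"
    show "F k = F' k"
    proof (rule PiE_ext[OF PiE_mem[OF L[OF F] k] PiE_mem[OF L[OF F'] k]])
      fix \<alpha> assume \<alpha>: "\<alpha> \<in> Pow {1..k}"
      show "F k \<alpha> = F' k \<alpha>"
        by (rule PiE_ext[OF lawsD(1)[OF F, of k \<alpha>] lawsD(1)[OF F', of k \<alpha>]]) (use k \<alpha> * in auto)
    qed
  qed
qed

text \<open>Off the newest primed direction the argument is that for groupoid laws. In the primed
  direction the scalars are preserved by definition, so the image of an arrow is recovered from the
  image of one of its end points.\<close>

lemma base_map_homogeneous_laws_inj:
  assumes U: "open U"
  shows "inj_on (base_map U) (continuous_homogeneous_laws scV scW n U U')"
proof (rule inj_onI)
  fix F F' assume F: "F \<in> continuous_homogeneous_laws scV scW n U U'"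
    and F': "F' \<in> continuous_homogeneous_laws scV scW n U U'"
    and eq: "base_map U F = base_map U F'"
  have *: "enat k \<le> n \<Longrightarrow> \<alpha> \<subseteq> dirs k \<Longrightarrow> z \<in> H_vertex scV U k \<alpha> \<Longrightarrow> F k \<alpha> z = F' k \<alpha> z" for k \<alpha> z
  proof (induction k arbitrary: \<alpha> z)
    case 0
    then obtain x where x: "z = Vec x" "x \<in> U" by auto
    have \<alpha>: "\<alpha> = {}" using 0 by (simp add: dirs_def)
    have "F 0 {} z \<in> Vec ` U'" "F' 0 {} z \<in> Vec ` U'"
      using PiE_mem[OF homogeneous_lawsD(1)[OF F, of 0 "{}"], of z]
        PiE_mem[OF homogeneous_lawsD(1)[OF F', of 0 "{}"], of z] 0 x by simp_all
    moreover have "the_vec (F 0 {} z) = the_vec (F' 0 {} z)"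
      using fun_cong[OF eq, of x] x by (simp add: base_map_def)
    ultimately show ?case using \<alpha> by auto
  next
    case (Suc k)
    note k = enat_SucD[OF Suc.prems(1)]
    let ?N = "{Dir (Suc k), Dir' (Suc k)}"
    define \<beta> where "\<beta> = \<alpha> - ?N"
    have \<beta>: "\<beta> \<subseteq> dirs k" "Dir (Suc k) \<notin> \<beta>" "Dir' (Suc k) \<notin> \<beta>" "\<beta> - ?N = \<beta>"
      using Suc.prems(2) unfolding \<beta>_def dirs_Suc by blast+
    let ?X = "H_vertex scV U k \<beta>"
    have oX: "open ?X" by (rule V.open_H_vertex[OF U])
    have sub: "\<beta> \<subseteq> dirs (Suc k)" "insert (Dir (Suc k)) \<beta> \<subseteq> dirs (Suc k)" "Dir' (Suc k) \<in> dirs (Suc k)"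
      using \<beta>(1) unfolding dirs_Suc by blast+
    have id: "F (Suc k) \<beta> z = F' (Suc k) \<beta> z" if "z \<in> times_scalars ?X" for z
      using that homogeneous_laws_base[OF F Suc.prems(1) \<beta>(1)] homogeneous_laws_base[OF F' Suc.prems(1) \<beta>(1)]
        Suc.IH[OF k \<beta>(1)] by (auto simp: times_scalars_def)
    have slope: "F (Suc k) (insert (Dir (Suc k)) \<beta>) z = F' (Suc k) (insert (Dir (Suc k)) \<beta>) z"
      if z: "z \<in> ext1 scV ?X" for z
    proof -
      have zp: "pfst z \<in> ?X" using z by (auto simp: ext1_def)
      have "pfst (psnd (F (Suc k) (insert (Dir (Suc k)) \<beta>) z)) =
          pfst (psnd (F' (Suc k) (insert (Dir (Suc k)) \<beta>) z))"
        by (rule slope_unique[OF homogeneous_law_slope(1)[OF F Suc.prems(1) \<beta>(1)]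
              homogeneous_law_slope(1)[OF F' Suc.prems(1) \<beta>(1)] Suc.IH[OF k \<beta>(1)] oX z])
      then show ?thesis
        using homogeneous_law_slope(2)[OF F Suc.prems(1) \<beta>(1) z]
          homogeneous_law_slope(2)[OF F' Suc.prems(1) \<beta>(1) z] Suc.IH[OF k \<beta>(1) zp]
        unfolding lift_slope_def by simp
    qed
    consider "\<alpha> = \<beta>" | "\<alpha> = insert (Dir (Suc k)) \<beta>" | "\<alpha> = insert (Dir' (Suc k)) \<beta>"
      | "\<alpha> = insert (Dir' (Suc k)) (insert (Dir (Suc k)) \<beta>)"
      unfolding \<beta>_def by blast
    then show ?case
    proof cases
      case 1
      then have "z \<in> times_scalars ?X" using Suc.prems(3) \<beta> by (simp add: Let_def)
      then show ?thesis using id 1 by simp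
    next
      case 2
      have "z \<in> ext1 scV ?X" using Suc.prems(3) \<beta> unfolding 2 by (simp add: Let_def insert_Diff_if)
      then show ?thesis using slope 2 by simp
    next
      case 3
      have "z \<in> times_scalars2 ?X" using Suc.prems(3) \<beta> unfolding 3 by (simp add: Let_def insert_Diff_if)
      then obtain x s t where z: "z = x \<bowtie> Scal s \<bowtie> Scal t" "x \<in> ?X"
        by (auto simp: times_scalars2_def)
      \<comment> \<open>The target \<open>(x, t)\<close> forgets only \<open>s\<close>, which the
        law preserves, so the value at the target determines the image of \<open>z\<close>.\<close>
      have tgt: "\<exists>y. H (Suc k) \<alpha> z = y \<bowtie> Scal s \<bowtie> Scal t \<and> H (Suc k) \<beta> (x \<bowtie> Scal t) = y \<bowtie> Scal t"
        if H: "H \<in> continuous_homogeneous_laws scV scW n U U'" for H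
      proof -
        obtain y where y: "H (Suc k) \<alpha> z = y \<bowtie> Scal s \<bowtie> Scal t"
          using homogeneous_laws_scalars(1)[OF H Suc.prems(1,2), of x s t] Suc.prems(3) z(1) 3 \<beta>(2) by auto
        have "edge_functor (H_cube scV U (Suc k)) (H_cube scW U' (Suc k)) (H (Suc k)) \<beta> (Dir' (Suc k))"
          by (rule homogeneous_lawsD(3)[OF H Suc.prems(1) sub(1,3) \<beta>(3)])
        then have "ev scW (etarget edge_scal) (H (Suc k) \<alpha> z) = H (Suc k) \<beta> (ev scV (etarget edge_scal) z)"
          using Suc.prems(3) \<beta>(2) unfolding edge_functor_def H_cube_sel 3[symmetric] by simp
        then show ?thesis using y z(1) by (simp add: edge_scal_def)
      qed
      have "x \<bowtie> Scal t \<in> times_scalars ?X" using z by (simp add: times_scalars_def)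
      from id[OF this] show ?thesis using tgt[OF F] tgt[OF F'] by auto
    next
      case 4
      have "z \<in> ext1_bar scV ?X" using Suc.prems(3) \<beta> unfolding 4 by (simp add: Let_def insert_Diff_if)
      then obtain x v s t where z: "z = x \<bowtie> v \<bowtie> Scal s \<bowtie> Scal t" "x \<bowtie> v \<bowtie> Scal (s * t) \<in> ext1 scV ?X"
        by (auto simp: ext1_bar_def ext1_iff)
      \<comment> \<open>Here the source \<open>(x, v, s t)\<close> is taken: the target
        \<open>(x, s v, t)\<close> would determine only \<open>s w\<close> and not \<open>w\<close>,
        as \<open>s\<close> may fail to be invertible.\<close>
      have src: "\<exists>y w. H (Suc k) \<alpha> z = y \<bowtie> w \<bowtie> Scal s \<bowtie> Scal t \<and>
          H (Suc k) (insert (Dir (Suc k)) \<beta>) (x \<bowtie> v \<bowtie> Scal (s * t)) = y \<bowtie> w \<bowtie> Scal (s * t)"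
        if H: "H \<in> continuous_homogeneous_laws scV scW n U U'" for H
      proof -
        obtain y w where y: "H (Suc k) \<alpha> z = y \<bowtie> w \<bowtie> Scal s \<bowtie> Scal t"
          using homogeneous_laws_scalars(2)[OF H Suc.prems(1,2), of x v s t] Suc.prems(3) z(1) 4 by auto
        have "edge_functor (H_cube scV U (Suc k)) (H_cube scW U' (Suc k)) (H (Suc k))
            (insert (Dir (Suc k)) \<beta>) (Dir' (Suc k))"
          by (rule homogeneous_lawsD(3)[OF H Suc.prems(1) sub(2,3)]) (use \<beta>(3) in simp)
        then have "ev scW (esource edge_scal_bar) (H (Suc k) \<alpha> z) =
            H (Suc k) (insert (Dir (Suc k)) \<beta>) (ev scV (esource edge_scal_bar) z)"
          using Suc.prems(3) unfolding edge_functor_def H_cube_sel 4[symmetric] by simp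
        then show ?thesis using y z(1) by (simp add: edge_scal_bar_def)
      qed
      from slope[OF z(2)] show ?thesis using src[OF F] src[OF F'] by auto
    qed
  qed
  have L: "F \<in> (\<Pi>\<^sub>E k\<in>{k. enat k \<le> n}. \<Pi>\<^sub>E \<alpha>\<in>Pow (dirs k). H_vertex scV U k \<alpha> \<rightarrow>\<^sub>E H_vertex scW U' k \<alpha>)"
    if "F \<in> continuous_homogeneous_laws scV scW n U U'" for F
    using that unfolding continuous_homogeneous_laws_def homogeneous_laws_def cube_morphisms_def H_cube_sel
    by (auto simp: PiE_iff)
  show "F = F'"
  proof (rule PiE_ext[OF L[OF F] L[OF F']])
    fix k assume k: "k \<in> {k. enat k \<le> n}"
    show "F k = F' k"
    proof (rule PiE_ext[OF PiE_mem[OF L[OF F] k] PiE_mem[OF L[OF F'] k]])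
      fix \<alpha> assume \<alpha>: "\<alpha> \<in> Pow (dirs k)"
      show "F k \<alpha> = F' k \<alpha>"
        by (rule PiE_ext[OF homogeneous_lawsD(1)[OF F, of k \<alpha>] homogeneous_lawsD(1)[OF F', of k \<alpha>]])
          (use k \<alpha> * in auto)
    qed
  qed
qed

lemma C_maps_base:
  assumes f: "f \<in> C_maps scV scW n U U'" and U: "open U"
  shows "\<exists>F\<in>continuous_homogeneous_laws scV scW n U U'. base_map U F = f"
proof -
  have fU: "f \<in> U \<rightarrow>\<^sub>E U'" and C: "\<And>m. enat m \<le> n \<Longrightarrow> Cn scV scW U f m"
    using f by (auto simp: C_maps_def)
  interpret cn_map scV scW U U' f n
  proof
    fix m assume "enat m \<le> n"
    then show "smooth scV scW m (Vec ` U) (\<lambda>z. Vec (f (the_vec z)))"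
      using Cn_imp_smooth[OF U, of f 0 m] C by simp
  qed (use U fU in auto)
  \<comment> \<open>Off \<open>U\<close> both sides are \<open>undefined\<close>, as
    \<open>f\<close> is extensional and \<open>base_map\<close> is restricted to
    \<open>U\<close>.\<close>
  have "base_map U H_law = f"
  proof
    fix x show "base_map U H_law x = f x"
      using base_H_law[of x] PiE_arb[OF fU, of x] by (cases "x \<in> U") (auto simp: base_map_def)
  qed
  then show ?thesis using H_law_in_laws by blast
qed

end

theorem theorem3p16:
  fixes scV :: "'k::{comm_ring_1, topological_ab_group_add, topological_semigroup_mult, t2_space} \<Rightarrow>
                'v::{topological_ab_group_add, t2_space} \<Rightarrow> 'v"
    and scW :: "'k \<Rightarrow> 'w::{topological_ab_group_add, t2_space} \<Rightarrow> 'w"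
    and U :: "'v set" and U' :: "'w set" and n :: enat
  assumes "closure {t::'k. t dvd 1} = UNIV"
    and "topological_module scV" and "topological_module scW"
    and "open U" and "U \<noteq> {}" and "open U'" and "U' \<noteq> {}"
  shows "bij_betw (base_map U) (continuous_laws scV scW n U U') (C_maps scV scW n U U') \<and>
         bij_betw (base_map U) (continuous_homogeneous_laws scV scW n U U') (C_maps scV scW n U U')"
proof -
  interpret V: topological_module scV by fact
  interpret W: topological_module scW by fact
  interpret dense_modules scV scW by unfold_locales fact
  \<comment> \<open>Differentiability of base maps was shown for groupoid laws; a homogeneous law is
    first restricted, which keeps its base map.\<close>
  have hom: "base_map U F \<in> C_maps scV scW n U U'" if "F \<in> continuous_homogeneous_laws scV scW n U U'" for F
    using base_map_in_C_maps[OF restrict_law_in_laws[OF that] assms(4)] by (simp add: base_restrict_law)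
  \<comment> \<open>Conversely, the groupoid law of \<open>f\<close> is the restriction of its
    homogeneous law.\<close>
  have "\<exists>F\<in>continuous_laws scV scW n U U'. base_map U F = f" if "f \<in> C_maps scV scW n U U'" for f
    using C_maps_base[OF that assms(4)] restrict_law_in_laws base_restrict_law by metis
  then show ?thesis
    using base_map_laws_inj[OF assms(4)] base_map_homogeneous_laws_inj[OF assms(4)] hom
      base_map_in_C_maps[OF _ assms(4)] C_maps_base[OF _ assms(4)]
    unfolding bij_betw_def by blast
qed

end
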